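(* If $(G,G_0)$ is a symmetric pair of rank $1$, then the isotropy representation $(G_0:\mathfrak g_1)$ has GNIB.
   Context: The ground field $\Bbbk$ is algebraically closed of characteristic zero. For a Lie algebra $\mathfrak q$ and a finite-dimensional $\mathfrak q$-module $V$, the index is $\mathrm{ind}(\mathfrak q,V)=\dim V-\max_{\xi\in V^*}\dim(\mathfrak q\cdot\xi)$. For a rational representation $(G:V)$ of a reductive group $G$ with Lie algebra $\mathfrak g$, a vector $v\in V$ is nilpotent if $0\in\overline{G\cdot v}$; $\mathfrak g_v$ is the stabiliser of $v$ in $\mathfrak g$, and $V/\mathfrak g\cdot v$ is a $\mathfrak g_v$-module. $(G:V)$ has good nilpotent index behaviour (GNIB) if $\mathrm{ind}(\mathfrak g,V^* )=\mathrm{ind}(\mathfrak g_v,(V/\mathfrak g\cdot v)^* )$ for every nilpotent $v\in V$. If $G$ is connected reductive, $\sigma$ is an involutory automorphism of $\mathfrak g$ with eigenspace decomposition $\mathfrak g=\mathfrak g_0\oplus\mathfrak g_1$ (eigenvalues $+1$, $-1$) and $G_0\subset G$ is the connected subgroup with Lie algebra $\mathfrak g_0$, then $(G,G_0)$ is a symmetric pair and $(G_0:\mathfrak g_1)$ is its isotropy representation. The rank of $(G,G_0)$ is the rank of the symmetric variety $G/G_0$, which equals $\mathrm{ind}(\mathfrak g_0,\mathfrak g_1)$ and the Krull dimension of $\Bbbk[\mathfrak g_1]^{G_0}$. *)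

theory Defs
  imports
    "HOL-Analysis.Analysis"
    "HOL-Computational_Algebra.Polynomial"
    "HOL-Library.Function_Algebras"
    "HOL-Library.Set_Algebras"
begin

section \<open>Vector space structures on matrices and on function spaces\<close>

text \<open>
  The library's \<open>*s\<close> on \<open>'k^'n^'n\<close> multiplies by elements of \<open>'k^'n\<close>, which is not a field; hence
  the explicit scalar multiplication.
\<close>

definition mscale :: "'k::field \<Rightarrow> 'k^'n^'n \<Rightarrow> 'k^'n^'n" where
  "mscale c A = (\<chi> i j. c * A $ i $ j)"

definition fscale :: "'k::field \<Rightarrow> ('v \<Rightarrow> 'k) \<Rightarrow> 'v \<Rightarrow> 'k" where
  "fscale c f = (\<lambda>x. c * f x)"

lemma vector_space_mscale: "vector_space mscale"
  by unfold_locales (simp_all add: mscale_def vec_eq_iff algebra_simps)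

lemma vector_space_fscale: "vector_space fscale"
  by unfold_locales (simp_all add: fscale_def fun_eq_iff algebra_simps)


section \<open>Duals, quotients and the index\<close>

text \<open>
  Linear functionals on \<open>V\<close>, extended by zero outside \<open>V\<close> so that each functional on \<open>V\<close> is
  represented exactly once.  The operations of \<open>V\<close> are parameters because \<open>V\<close> may also be a
  quotient, whose elements are cosets.
\<close>

definition dual_space ::
  "('v \<Rightarrow> 'v \<Rightarrow> 'v) \<Rightarrow> ('k::field \<Rightarrow> 'v \<Rightarrow> 'v) \<Rightarrow> 'v set \<Rightarrow> ('v \<Rightarrow> 'k) set" where
  "dual_space add scl V =
     {f. (\<forall>x\<in>V. \<forall>y\<in>V. f (add x y) = f x + f y) \<and>
         (\<forall>c. \<forall>x\<in>V. f (scl c x) = c * f x) \<and>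
         (\<forall>x. x \<notin> V \<longrightarrow> f x = 0)}"

definition dual_act :: "'v set \<Rightarrow> ('q \<Rightarrow> 'v \<Rightarrow> 'v) \<Rightarrow> 'q \<Rightarrow> ('v \<Rightarrow> 'k::field) \<Rightarrow> 'v \<Rightarrow> 'k" where
  "dual_act V act x f = (\<lambda>v. if v \<in> V then - f (act x v) else 0)"

text \<open>
  The quotient \<open>V / U\<close> as a set of cosets.  Its addition is the elementwise sum of sets.  Adding
  \<open>U\<close> in the next two definitions makes the result a full coset of \<open>U\<close> (the image of \<open>v + U\<close>
  alone may be smaller, e.g. for \<open>c = 0\<close>): \<open>c (v + U) = c v + U\<close> and \<open>x (v + U) = x v + U\<close>.
\<close>

definition quot_space :: "'v::ab_group_add set \<Rightarrow> 'v set \<Rightarrow> 'v set set" where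
  "quot_space V U = (\<lambda>v. v +o U) ` V"

definition quot_scale ::
  "('k \<Rightarrow> 'v \<Rightarrow> 'v) \<Rightarrow> 'v::ab_group_add set \<Rightarrow> 'k \<Rightarrow> 'v set \<Rightarrow> 'v set" where
  "quot_scale s U c C = s c ` C + U"

definition quot_act ::
  "'v::ab_group_add set \<Rightarrow> ('q \<Rightarrow> 'v \<Rightarrow> 'v) \<Rightarrow> 'q \<Rightarrow> 'v set \<Rightarrow> 'v set" where
  "quot_act U act x C = act x ` C + U"

text \<open>
  \<open>ind(q, V) = dim V - max {dim (q \<cdot> \<xi>) | \<xi> \<in> V\<^sup>*}\<close> for a finite-dimensional subspace \<open>V\<close> of a vector
  space with scalar multiplication \<open>s\<close>.
\<close>

definition lie_index ::
  "('k::field \<Rightarrow> 'v::ab_group_add \<Rightarrow> 'v) \<Rightarrow> 'q set \<Rightarrow> ('q \<Rightarrow> 'v \<Rightarrow> 'v) \<Rightarrow> 'v set \<Rightarrow> int" where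
  "lie_index s q act V =
     int (vector_space.dim s V) -
     int (MAX \<xi> \<in> dual_space (+) s V. vector_space.dim fscale ((\<lambda>x. dual_act V act x \<xi>) ` q))"


section \<open>Zariski topology\<close>

text \<open>Polynomial functions: the algebra of functions generated by the linear functionals.\<close>

inductive_set poly_funs :: "('k::field \<Rightarrow> 'v::ab_group_add \<Rightarrow> 'v) \<Rightarrow> ('v \<Rightarrow> 'k) set"
  for s :: "'k \<Rightarrow> 'v \<Rightarrow> 'v" where
  const: "(\<lambda>_. c) \<in> poly_funs s"
| lin: "Vector_Spaces.linear s (*) f \<Longrightarrow> f \<in> poly_funs s"
| add: "f \<in> poly_funs s \<Longrightarrow> g \<in> poly_funs s \<Longrightarrow> (\<lambda>x. f x + g x) \<in> poly_funs s"
| mult: "f \<in> poly_funs s \<Longrightarrow> g \<in> poly_funs s \<Longrightarrow> (\<lambda>x. f x * g x) \<in> poly_funs s"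

definition zariski :: "('k::field \<Rightarrow> 'v::ab_group_add \<Rightarrow> 'v) \<Rightarrow> 'v topology" where
  "zariski s = topology_generated_by {{x. f x \<noteq> 0} | f. f \<in> poly_funs s}"


section \<open>Linear algebraic groups and their Lie algebras\<close>

definition algebraic_group :: "('k::field^'n^'n) set \<Rightarrow> bool" where
  "algebraic_group G \<longleftrightarrow>
     closedin (subtopology (zariski mscale) {A. invertible A}) G \<and>
     mat 1 \<in> G \<and> (\<forall>g\<in>G. \<forall>h\<in>G. g ** h \<in> G) \<and> (\<forall>g\<in>G. matrix_inv g \<in> G)"

definition Ad :: "'k::field^'n^'n \<Rightarrow> 'k^'n^'n \<Rightarrow> 'k^'n^'n" where
  "Ad g y = g ** y ** matrix_inv g"

definition ad :: "'k::field^'n^'n \<Rightarrow> 'k^'n^'n \<Rightarrow> 'k^'n^'n" where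
  "ad x y = x ** y - y ** x"

definition unipotent :: "'k::field^'n^'n \<Rightarrow> bool" where
  "unipotent u \<longleftrightarrow> (\<exists>m. (((**) (u - mat 1)) ^^ m) (mat 1) = 0)"

text \<open>Reductive: the unipotent radical is trivial.\<close>

definition reductive_group :: "('k::field^'n^'n) set \<Rightarrow> bool" where
  "reductive_group G \<longleftrightarrow> algebraic_group G \<and>
     (\<forall>U. algebraic_group U \<and> U \<subseteq> G \<and> (\<forall>g\<in>G. \<forall>u\<in>U. Ad g u \<in> U) \<and>
          connectedin (zariski mscale) U \<and> (\<forall>u\<in>U. unipotent u) \<longrightarrow> U = {mat 1})"

text \<open>
  The tangent space of \<open>G\<close> at the identity: \<open>X\<close> such that every polynomial function \<open>f\<close> vanishing
  on \<open>G\<close> has derivative \<open>0\<close> at \<open>1\<close> in direction \<open>X\<close>.  The derivative is the linear coefficient of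
  the (unique, over an infinite field) polynomial \<open>p(t) = f (1 + t X)\<close>.
\<close>

definition lie_algebra :: "('k::field^'n^'n) set \<Rightarrow> ('k^'n^'n) set" where
  "lie_algebra G =
     {X. \<forall>f \<in> poly_funs mscale. (\<forall>g\<in>G. f g = 0) \<longrightarrow>
           (\<forall>p. (\<forall>t. f (mat 1 + mscale t X) = poly p t) \<longrightarrow> coeff p 1 = 0)}"


section \<open>Good nilpotent index behaviour\<close>

text \<open>
  A representation of \<open>G\<close> on the subspace \<open>V\<close> is given by the action \<open>\<rho>\<close> of \<open>G\<close> together with its
  differential \<open>d\<rho>\<close>, the action of the Lie algebra of \<open>G\<close>.
\<close>

definition nilpotent_vector ::
  "('k::field \<Rightarrow> 'v::ab_group_add \<Rightarrow> 'v) \<Rightarrow> 'g set \<Rightarrow> ('g \<Rightarrow> 'v \<Rightarrow> 'v) \<Rightarrow> 'v \<Rightarrow> bool" where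
  "nilpotent_vector s G \<rho> v \<longleftrightarrow> 0 \<in> zariski s closure_of ((\<lambda>g. \<rho> g v) ` G)"

definition stabiliser :: "'q set \<Rightarrow> ('q \<Rightarrow> 'v::ab_group_add \<Rightarrow> 'v) \<Rightarrow> 'v \<Rightarrow> 'q set" where
  "stabiliser q act v = {x \<in> q. act x v = 0}"

definition GNIB ::
  "('k::field \<Rightarrow> 'v::ab_group_add \<Rightarrow> 'v) \<Rightarrow> ('k^'n^'n) set \<Rightarrow> ('k^'n^'n \<Rightarrow> 'v \<Rightarrow> 'v) \<Rightarrow>
   ('k^'n^'n \<Rightarrow> 'v \<Rightarrow> 'v) \<Rightarrow> 'v set \<Rightarrow> bool" where
  "GNIB s G \<rho> d\<rho> V \<longleftrightarrow>
     (\<forall>v\<in>V. nilpotent_vector s G \<rho> v \<longrightarrow>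
        (let \<gg> = lie_algebra G;
             U = (\<lambda>x. d\<rho> x v) ` \<gg>;
             Q = quot_space V U
         in lie_index fscale \<gg> (dual_act V d\<rho>) (dual_space (+) s V) =
            lie_index fscale (stabiliser \<gg> d\<rho> v) (dual_act Q (quot_act U d\<rho>))
              (dual_space (+) (quot_scale s U) Q)))"


section \<open>Symmetric pairs\<close>

definition lie_involution :: "('k::field^'n^'n) set \<Rightarrow> ('k^'n^'n \<Rightarrow> 'k^'n^'n) \<Rightarrow> bool" where
  "lie_involution \<gg> \<sigma> \<longleftrightarrow>
     (\<forall>x\<in>\<gg>. \<sigma> x \<in> \<gg> \<and> \<sigma> (\<sigma> x) = x) \<and>
     (\<forall>x\<in>\<gg>. \<forall>y\<in>\<gg>. \<sigma> (x + y) = \<sigma> x + \<sigma> y \<and> \<sigma> (ad x y) = ad (\<sigma> x) (\<sigma> y)) \<and>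
     (\<forall>c. \<forall>x\<in>\<gg>. \<sigma> (mscale c x) = mscale c (\<sigma> x))"

definition plus_part :: "('k::field^'n^'n) set \<Rightarrow> ('k^'n^'n \<Rightarrow> 'k^'n^'n) \<Rightarrow> ('k^'n^'n) set" where
  "plus_part \<gg> \<sigma> = {x \<in> \<gg>. \<sigma> x = x}"

definition minus_part :: "('k::field^'n^'n) set \<Rightarrow> ('k^'n^'n \<Rightarrow> 'k^'n^'n) \<Rightarrow> ('k^'n^'n) set" where
  "minus_part \<gg> \<sigma> = {x \<in> \<gg>. \<sigma> x = - x}"

definition symmetric_pair ::
  "('k::field^'n^'n) set \<Rightarrow> ('k^'n^'n \<Rightarrow> 'k^'n^'n) \<Rightarrow> ('k^'n^'n) set \<Rightarrow> bool" where
  "symmetric_pair G \<sigma> G\<^sub>0 \<longleftrightarrow>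
     reductive_group G \<and> connectedin (zariski mscale) G \<and>
     lie_involution (lie_algebra G) \<sigma> \<and>
     algebraic_group G\<^sub>0 \<and> G\<^sub>0 \<subseteq> G \<and> connectedin (zariski mscale) G\<^sub>0 \<and>
     lie_algebra G\<^sub>0 = plus_part (lie_algebra G) \<sigma>"

text \<open>The rank of the symmetric variety \<open>G/G\<^sub>0\<close>, in the form \<open>ind(\<gg>\<^sub>0, \<gg>\<^sub>1)\<close>.\<close>

definition symmetric_rank :: "('k::field^'n^'n) set \<Rightarrow> ('k^'n^'n \<Rightarrow> 'k^'n^'n) \<Rightarrow> int" where
  "symmetric_rank G \<sigma> =
     lie_index mscale (plus_part (lie_algebra G) \<sigma>) ad (minus_part (lie_algebra G) \<sigma>)"

end

theory Submission
  imports Defs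
begin

text \<open>For a reductive \<open>G\<close>, Cartan's criterion and the absence of commutative unipotent normal
  subgroups make the radical of the trace form central; averaging over \<open>\<sigma>\<close> gives an invariant form
  \<open>B\<close> on \<open>g\<close>. In rank one the orthogonal of a generic vector of \<open>g\<^sub>1\<close> is its
  \<open>g\<^sub>0\<close>-orbit, so that \<open>B(z,x) tr(x\<^sup>kv) = B(v,x) tr(x\<^sup>kz)\<close>, and isotropic vectors are
  nilpotent. Embed a nilpotent \<open>e \<noteq> 0\<close> of \<open>g\<^sub>1\<close> in a triple \<open>(e,h,f)\<close> with
  \<open>h \<in> g\<^sub>0\<close>. The vector \<open>s = e + f\<close> is its own commutant in \<open>g\<^sub>1\<close> up to scalars, and
  comparing with \<open>h\<close>, to which \<open>s\<close> is conjugate, bounds the weights enough to yield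
  \<open>g\<^sub>1 = k f + [g\<^sub>0,e] + [g\<^sub>0\<^sup>e,f]\<close>. Conversely \<open>B(e,\<cdot>)\<close> kills
  \<open>[g\<^sub>0,e] + [g\<^sub>0\<^sup>e,y]\<close> for every \<open>y\<close>. Hence the slice representation has index one.\<close>

section \<open>Matrix algebra\<close>

text \<open>Reductivity speaks only of closed normal subgroups of \<open>G\<close>, hence of
  \<open>Ad\<close>-stable subspaces of the Lie algebra, whereas \<open>\<sigma>\<close> lives on
  the Lie algebra alone and the radical of the averaged form is not visibly
  \<open>Ad\<close>-stable. The way round is the plain trace radical, which is stable: once it is
  central, every abelian ideal is central, because a nilpotent \<open>w\<close> with
  \<open>[w,[w,u]] = 0\<close> has \<open>trace (w ** u) = 0\<close>; then the averaged form is
  treated without the group. The proportionality of traces needs an orbit that is a hyperplane,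
  which is not known at an isotropic vector \<open>x\<close>; both sides are polynomial along
  \<open>x + t y0\<close>, so it passes to \<open>t = 0\<close>. The weight bound has two sources. A
  highest weight vector of odd weight \<open>m \<ge> 3\<close> yields an eigenvector of
  \<open>ad s\<close>; with its image under \<open>\<sigma>\<close> it generates a second triple
  with neutral element \<open>(2/m) s\<close>, for which \<open>e'\<close> would have weight
  \<open>4/m\<close>, not an integer. An even weight yields an element of the commutant of
  \<open>s\<close>, hence a multiple of \<open>s\<close>. Weight one survives these tests and is
  what the summand \<open>[g_0^e, f]\<close> has to absorb.\<close>

notation mscale (infixr \<open>*\<^sub>m\<close> 75)

definition munit :: "'n \<times> 'n \<Rightarrow> 'k::field^'n^'n" where
  "munit p = (\<chi> i j. if (i, j) = p then 1 else 0)"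

lemma sum_nth2: "(\<Sum>x\<in>S. f x) $ i $ j = (\<Sum>x\<in>S. f x $ i $ j)"
  by simp

lemma munit_sum: "(\<Sum>p\<in>UNIV. mscale (f p) (munit p)) $ i $ j = f (i, j)"
proof -
  have "(\<Sum>p\<in>UNIV. mscale (f p) (munit p)) $ i $ j = (\<Sum>p\<in>UNIV. if (i, j) = p then f p else 0)"
    unfolding sum_nth2 by (rule sum.cong) (auto simp: mscale_def munit_def)
  then show ?thesis by simp
qed

lemma inj_munit: "inj munit"
  by (rule injI) (auto simp: munit_def vec_eq_iff split: if_splits)

text \<open>The basis of matrix units gives access to the dimension theory of vector spaces under
  \<open>mscale\<close>; ideals, orbits and kernels below are all subspaces of this one matrix
  space.\<close>

global_interpretation M: finite_dimensional_vector_space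
  "mscale :: 'k::field \<Rightarrow> 'k^'n^'n \<Rightarrow> 'k^'n^'n" "range munit"
proof -
  interpret vector_space "mscale :: 'k \<Rightarrow> 'k^'n^'n \<Rightarrow> 'k^'n^'n" by (rule vector_space_mscale)
  have "f p = 0" if z: "(\<Sum>v\<in>range munit. mscale (f v) v) = (0::'k^'n^'n)" and pr: "p \<in> range munit" for f p
  proof -
    obtain i j where p: "p = munit (i, j)" using pr by auto
    have "(\<Sum>q\<in>UNIV. mscale (f (munit q)) (munit q)) = (0::'k^'n^'n)"
      using z by (simp add: sum.reindex[OF inj_munit])
    then show ?thesis using munit_sum[of "\<lambda>q. f (munit q)" i j] p by simp
  qed
  then have ind: "independent (range munit :: ('k^'n^'n) set)"
    by (intro independent_if_scalars_zero) auto
  have "A \<in> span (range munit)" for A :: "'k^'n^'n"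
  proof -
    have "A = (\<Sum>p\<in>UNIV. mscale (A $ fst p $ snd p) (munit p))"
      using munit_sum[of "\<lambda>p. A $ fst p $ snd p"] by (simp add: vec_eq_iff)
    also have "\<dots> \<in> span (range munit)"
      by (intro span_sum span_scale span_base) auto
    finally show ?thesis .
  qed
  then show "finite_dimensional_vector_space (mscale :: 'k \<Rightarrow> 'k^'n^'n \<Rightarrow> 'k^'n^'n) (range munit)"
    by unfold_locales (use ind in auto)
qed

global_interpretation F: vector_space "fscale :: 'k::field \<Rightarrow> ('v \<Rightarrow> 'k) \<Rightarrow> 'v \<Rightarrow> 'k"
  by (rule vector_space_fscale)

global_interpretation MM: finite_dimensional_vector_space_pair
  "mscale :: 'k::field \<Rightarrow> 'k^'n^'n \<Rightarrow> 'k^'n^'n" "range munit"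
  "mscale :: 'k::field \<Rightarrow> 'k^'n^'n \<Rightarrow> 'k^'n^'n" "range munit"
  by unfold_locales

global_interpretation MF: finite_dimensional_vector_space_pair_1
  "mscale :: 'k::field \<Rightarrow> 'k^'n^'n \<Rightarrow> 'k^'n^'n" "range munit"
  "fscale :: 'k::field \<Rightarrow> ('v \<Rightarrow> 'k) \<Rightarrow> 'v \<Rightarrow> 'k"
  by unfold_locales

lemma vector_space_times: "vector_space ((*) :: 'k::field \<Rightarrow> 'k \<Rightarrow> 'k)"
  by unfold_locales (simp_all add: algebra_simps)

global_interpretation K: vector_space "(*) :: 'k::field \<Rightarrow> 'k \<Rightarrow> 'k"
  by (rule vector_space_times)

global_interpretation MK: finite_dimensional_vector_space_pair_1
  "mscale :: 'k::field \<Rightarrow> 'k^'n^'n \<Rightarrow> 'k^'n^'n" "range munit"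
  "(*) :: 'k::field \<Rightarrow> 'k \<Rightarrow> 'k"
  by unfold_locales

abbreviation lin :: "('k::field^'n^'n \<Rightarrow> 'k^'n^'n) \<Rightarrow> bool" where
  "lin \<equiv> Vector_Spaces.linear mscale mscale"

abbreviation linf :: "('k::field^'n^'n \<Rightarrow> 'k) \<Rightarrow> bool" where
  "linf \<equiv> Vector_Spaces.linear mscale (*)"

lemma linI: "(\<And>x y. T (x + y) = T x + T y) \<Longrightarrow> (\<And>c x. T (c *\<^sub>m x) = c *\<^sub>m T x) \<Longrightarrow> lin T"
  by unfold_locales auto

lemma linfI: "(\<And>x y. T (x + y) = T x + T y) \<Longrightarrow> (\<And>c x. T (c *\<^sub>m x) = c * T x) \<Longrightarrow> linf T"
  by unfold_locales auto

lemma mm_simps: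
  fixes A B C :: "'k::field^'n^'n"
  shows "A ** (B + C) = A ** B + A ** C" "(A + B) ** C = A ** C + B ** C"
    "A ** (B - C) = A ** B - A ** C" "(A - B) ** C = A ** C - B ** C"
    "(- A) ** B = - (A ** B)" "A ** (- B) = - (A ** B)" "A ** 0 = 0" "0 ** A = 0"
    "(c *\<^sub>m A) ** B = c *\<^sub>m (A ** B)" "A ** (c *\<^sub>m B) = c *\<^sub>m (A ** B)"
  by (simp_all add: matrix_matrix_mult_def vec_eq_iff mscale_def algebra_simps sum.distrib
      sum_subtractf sum_negf sum_distrib_left)

lemmas msimps = mm_simps matrix_mul_assoc M.scale_right_distrib M.scale_right_diff_distrib
  M.scale_left_distrib M.scale_left_diff_distrib M.scale_minus_left M.scale_minus_right

lemma mscale_trace: "trace (c *\<^sub>m A) = c * trace A"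
  by (simp add: trace_def mscale_def sum_distrib_left)

lemma trace_zero [simp]: "trace (0 :: 'k::field^'n^'n) = 0"
  by (simp add: trace_def)

lemma trace_neg: "trace (- A :: 'k::field^'n^'n) = - trace A"
  by (simp add: trace_def sum_negf)

lemmas trace_simps = trace_add trace_sub trace_neg mscale_trace

lemma trace_rotate: "trace (A ** B ** C) = trace (C ** A ** (B :: 'k::field^'n^'n))"
  using trace_mul_sym[of "A ** B" C] by (simp add: matrix_mul_assoc)

subsection \<open>Powers and nilpotency\<close>

text \<open>The same iterate as in \<open>unipotent\<close>, so that \<open>u\<close> is unipotent
  exactly when \<open>u - mat 1\<close> is \<open>nilp\<close>.\<close>

definition mpow :: "'k::field^'n^'n \<Rightarrow> nat \<Rightarrow> 'k^'n^'n" where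
  "mpow A k = (((**) A) ^^ k) (mat 1)"

lemma mpow_0 [simp]: "mpow A 0 = mat 1"
  by (simp add: mpow_def)

lemma mpow_Suc: "mpow A (Suc k) = A ** mpow A k"
  by (simp add: mpow_def)

lemma mpow_1 [simp]: "mpow A (Suc 0) = A"
  by (simp add: mpow_Suc)

lemma mpow_comm_gen: "A ** C = C ** A \<Longrightarrow> mpow A k ** C = C ** mpow A k"
  by (induction k) (simp_all add: mpow_Suc matrix_mul_assoc, metis matrix_mul_assoc)

lemma mpow_comm: "mpow A k ** A = A ** mpow A k"
  by (rule mpow_comm_gen) simp

lemma mpow_Suc2: "mpow A (Suc k) = mpow A k ** A"
  by (simp add: mpow_Suc mpow_comm)

lemma mpow_add: "mpow A (i + j) = mpow A i ** mpow A j"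
  by (induction i) (simp_all add: mpow_Suc matrix_mul_assoc)

lemma mpow_mult: "A ** B = B ** A \<Longrightarrow> mpow (A ** B) k = mpow A k ** mpow B k"
  by (induction k) (simp_all add: mpow_Suc matrix_mul_assoc, metis mpow_comm_gen matrix_mul_assoc)

lemma mpow_zero_ge: "mpow A k = 0 \<Longrightarrow> k \<le> m \<Longrightarrow> mpow A m = 0"
  by (metis le_add_diff_inverse mpow_add mm_simps(8))

lemma mpow_scale: "mpow (c *\<^sub>m A) k = (c ^ k) *\<^sub>m mpow A k"
  by (induction k) (simp_all add: mpow_Suc mm_simps mult.commute)

definition nilp :: "'k::field^'n^'n \<Rightarrow> bool" where
  "nilp A \<longleftrightarrow> (\<exists>k. mpow A k = 0)"

lemma nilp_0 [simp]: "nilp 0"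
  unfolding nilp_def by (rule exI[of _ 1]) (simp add: mpow_Suc)

lemma nilp_scale: "nilp A \<Longrightarrow> nilp (c *\<^sub>m A)"
  unfolding nilp_def by (metis mpow_scale M.scale_zero_right)

lemma nilp_minus: "nilp A \<Longrightarrow> nilp (- A)"
  using nilp_scale[of A "-1"] by simp

lemma nilp_mult: "nilp A \<Longrightarrow> A ** B = B ** A \<Longrightarrow> nilp (A ** B)"
  unfolding nilp_def by (metis mpow_mult mm_simps(8))

text \<open>A binomial expansion without coefficients: each factor \<open>A + B\<close> is traded
  for an \<open>A\<close> or a \<open>B\<close>, so after \<open>a + b\<close> trades one exponent
  has reached its nilpotency order. The same bookkeeping recurs for left and right multiplication in
  \<open>nilp_ad\<close> and \<open>two_sided_nilp\<close>.\<close>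

lemma nilp_add:
  assumes "nilp A" "nilp B" "A ** B = B ** A"
  shows "nilp (A + B)"
proof -
  obtain a b where a: "mpow A a = 0" and b: "mpow B b = 0" using assms by (auto simp: nilp_def)
  have "mpow A i ** mpow B j ** mpow (A + B) m = 0" if "i + j + m \<ge> a + b" for i j m
    using that
  proof (induction m arbitrary: i j)
    case 0
    then have "i \<ge> a \<or> j \<ge> b" by arith
    then show ?case using mpow_zero_ge[OF a, of i] mpow_zero_ge[OF b, of j] by (auto simp: mm_simps)
  next
    case (Suc m)
    have "mpow B j ** A = A ** mpow B j" using assms(3) by (metis mpow_comm_gen)
    then have "mpow A i ** mpow B j ** mpow (A + B) (Suc m)
      = mpow A (Suc i) ** mpow B j ** mpow (A + B) m + mpow A i ** mpow B (Suc j) ** mpow (A + B) m"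
      unfolding mpow_Suc[of "A + B"] mpow_Suc2[of A] mpow_Suc2[of B]
      by (simp add: msimps) (metis matrix_mul_assoc)
    then show ?case using Suc.IH[of "Suc i" j] Suc.IH[of i "Suc j"] Suc.prems by simp
  qed
  from this[of 0 0 "a + b"] show ?thesis by (auto simp: nilp_def)
qed

lemma lin_ad: "lin (ad x)"
  by (rule linI) (simp_all add: ad_def msimps)

lemma ad_simps:
  "ad (x + y) z = ad x z + ad y z" "ad x (y + z) = ad x y + ad x z"
  "ad (x - y) z = ad x z - ad y z" "ad x (y - z) = ad x y - ad x z"
  "ad (- x) y = - ad x y" "ad x (- y) = - ad x y" "ad 0 x = 0" "ad x 0 = 0"
  "ad (c *\<^sub>m x) y = c *\<^sub>m ad x y" "ad x (c *\<^sub>m y) = c *\<^sub>m ad x y" "ad x x = 0"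
  by (simp_all add: ad_def msimps)

lemma ad_antisym: "ad x y = - ad y x"
  by (simp add: ad_def)

lemma jacobi: "ad x (ad y z) = ad (ad x y) z + ad y (ad x z)"
  by (simp add: ad_def msimps algebra_simps)

lemma ad_eq_0_iff: "ad x y = 0 \<longleftrightarrow> x ** y = y ** x"
  by (simp add: ad_def)

lemma trace_ad: "trace (ad a b ** c) = trace (a ** ad b c)"
proof -
  have "trace (b ** a ** c) = trace (a ** c ** b)" by (metis trace_rotate)
  then show ?thesis by (simp add: ad_def msimps trace_sub)
qed

lemma nilp_ad:
  assumes "nilp A"
  shows "\<exists>k. \<forall>B. (ad A ^^ k) B = 0"
proof -
  obtain a where a: "mpow A a = 0" using assms by (auto simp: nilp_def)
  have "mpow A i ** (ad A ^^ m) B ** mpow A j = 0" if "i + j + m \<ge> 2 * a" for i j m B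
    using that
  proof (induction m arbitrary: i j)
    case 0
    then have "i \<ge> a \<or> j \<ge> a" by arith
    then show ?case using mpow_zero_ge[OF a, of i] mpow_zero_ge[OF a, of j] by (auto simp: mm_simps)
  next
    case (Suc m)
    have "mpow A i ** (ad A ^^ Suc m) B ** mpow A j = mpow A (Suc i) ** (ad A ^^ m) B ** mpow A j
       - mpow A i ** (ad A ^^ m) B ** mpow A (Suc j)"
      unfolding mpow_Suc2[of A i] mpow_Suc[of A j] by (simp add: ad_def msimps)
    then show ?case using Suc.IH[of "Suc i" j] Suc.IH[of i "Suc j"] Suc.prems by simp
  qed
  from this[of 0 0 "2 * a"] show ?thesis by auto
qed

lemma trace_mpow_ad:
  assumes "c ** x = x ** c"
  shows "trace (ad u x ** c) = 0"
  by (subst trace_ad) (simp add: ad_def assms)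

lemma trace_mpow_eigen:
  fixes h x :: "'k::field^'n^'n"
  assumes "ad h x = c *\<^sub>m x" "c \<noteq> 0"
  shows "trace (mpow x (Suc k)) = 0"
proof -
  have "c * trace (mpow x (Suc k)) = trace (ad h x ** mpow x k)"
    by (simp add: assms mpow_Suc mm_simps mscale_trace)
  also have "\<dots> = 0" by (rule trace_mpow_ad) (rule mpow_comm)
  finally show ?thesis using assms(2) by simp
qed

subsection \<open>Traces of nilpotent and idempotent matrices\<close>

text \<open>The matrices whose columns lie in the column space of \<open>A\<close>; the dimension is
  the matrix size times the rank of \<open>A\<close>, so it replaces rank as an induction
  measure.\<close>

definition right_ideal :: "'k::field^'n^'n \<Rightarrow> ('k^'n^'n) set" where
  "right_ideal A = range (\<lambda>X. A ** X)"

lemma subspace_right_ideal: "M.subspace (right_ideal A)"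
proof (rule M.subspaceI)
  fix x y c assume "x \<in> right_ideal A" "y \<in> right_ideal A"
  then obtain X Y where "x = A ** X" "y = A ** Y" by (auto simp: right_ideal_def)
  then show "x + y \<in> right_ideal A" "c *\<^sub>m x \<in> right_ideal A"
    by (simp_all add: right_ideal_def mm_simps(1)[symmetric] mm_simps(10)[symmetric])
next
  show "0 \<in> right_ideal A" unfolding right_ideal_def by (rule range_eqI[of _ _ 0]) (simp add: mm_simps)
qed

lemma right_ideal_self: "A \<in> right_ideal A"
  unfolding right_ideal_def by (rule range_eqI[of _ _ "mat 1"]) simp

lemma right_ideal_mono: "A = B ** C \<Longrightarrow> right_ideal A \<subseteq> right_ideal B"
  by (auto simp: right_ideal_def matrix_mul_assoc[symmetric])

lemma dim_right_ideal_less: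
  assumes "A = B ** C" "B \<notin> right_ideal A"
  shows "M.dim (right_ideal A) < M.dim (right_ideal B)"
proof (rule M.dim_psubset)
  have "right_ideal A \<subset> right_ideal B"
    using right_ideal_mono[OF assms(1)] right_ideal_self[of B] assms(2) by blast
  then show "M.span (right_ideal A) \<subset> M.span (right_ideal B)"
    using subspace_right_ideal M.span_eq_iff by metis
qed

text \<open>A generalised inverse: \<open>A ** G\<close> becomes an idempotent with the same range
  as \<open>A\<close>.\<close>

lemma regular_matrix: "\<exists>G. A ** G ** A = (A :: 'k::field^'n^'n)"
proof -
  obtain g where g: "Vector_Spaces.linear (*s) (*s) g" "\<And>v. v \<in> range ((*v) A) \<Longrightarrow> A *v g v = v"
    using vec.linear_exists_right_inverse_on[OF matrix_vector_mul_linear_gen[of A] vec.subspace_UNIV] by blast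
  have "(A ** matrix g ** A) *v x = A *v x" for x
    using g(2)[of "A *v x"] matrix_works[OF g(1)] by (simp add: matrix_vector_mul_assoc[symmetric])
  then show ?thesis by (metis matrix_eq)
qed

text \<open>Induction on rank, passing from \<open>A\<close> to its restriction to its own range.
  That restriction is represented by \<open>A ** (A ** G)\<close>: it has the trace of
  \<open>A\<close> by cyclicity, is nilpotent again, and has smaller rank.\<close>

lemma trace_nilp: "nilp A \<Longrightarrow> trace A = 0"
proof (induction "M.dim (right_ideal A)" arbitrary: A rule: less_induct)
  case (less A)
  obtain k where k: "mpow A k = 0" using less.prems by (auto simp: nilp_def)
  obtain G where G: "A ** G ** A = A" using regular_matrix by blast
  show ?case
  proof (cases "A = 0")
    case False
    let ?N = "A ** (A ** G)"
    have "A \<notin> right_ideal ?N"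
    proof
      assume "A \<in> right_ideal ?N"
      then obtain X where "A = A ** (A ** G) ** X" by (auto simp: right_ideal_def)
      then have X: "A = A ** A ** (G ** X)" by (simp add: matrix_mul_assoc)
      \<comment> \<open>Substituting \<open>A = A ** A ** (G ** X)\<close> into itself accumulates
        powers of \<open>A\<close> on the left until nilpotency kills them.\<close>
      have "A = mpow A (Suc i) ** mpow (G ** X) i" for i
      proof (induction i)
        case (Suc i)
        have "mpow A (Suc (Suc i)) ** mpow (G ** X) (Suc i)
          = mpow A i ** (A ** A ** (G ** X)) ** mpow (G ** X) i"
          by (simp add: mpow_Suc2[of A] mpow_Suc[of "G ** X"] matrix_mul_assoc)
        then show ?case using X Suc by (metis mpow_Suc2)
      qed simp
      from this[of k] have "A = 0" using k by (simp add: mpow_Suc mm_simps)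
      then show False using False by simp
    qed
    then have lt: "M.dim (right_ideal ?N) < M.dim (right_ideal A)"
      by (rule dim_right_ideal_less[OF refl])
    have "mpow ?N i = mpow A i ** (if i = 0 then mat 1 else A ** G)" for i
    proof (induction i)
      case (Suc i)
      show ?case
      proof (cases i)
        case (Suc j)
        have "A ** (A ** G) ** (mpow A (Suc j) ** (A ** G)) = A ** (A ** G ** A) ** mpow A j ** (A ** G)"
          by (simp add: mpow_Suc matrix_mul_assoc)
        then show ?thesis using Suc.IH Suc G by (simp add: mpow_Suc matrix_mul_assoc)
      qed simp
    qed simp
    from this[of k] have "nilp ?N" using k by (auto simp: nilp_def mm_simps)
    then have "trace ?N = 0" using less.hyps[OF lt] by blast
    then show ?thesis using G trace_mul_sym[of A "A ** G"] by simp
  qed simp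
qed

lemma munit_mult: "(munit (p, q) ** E) $ i $ j = (if i = p then E $ q $ j else 0)"
  by (simp add: matrix_matrix_mult_def munit_def if_distrib[of "\<lambda>x. x * _"] sum.delta' cong: if_cong)

lemma mult_munit: "(E ** munit (p, q)) $ i $ j = (if j = q then E $ i $ p else 0)"
  by (simp add: matrix_matrix_mult_def munit_def if_distrib[of "\<lambda>x. _ * x"] sum.delta' cong: if_cong)

lemma munit_sandwich: "munit (p, q) ** E ** munit (p, q) = (E $ q $ p) *\<^sub>m munit (p, q)"
  by (simp add: vec_eq_iff mult_munit munit_mult mscale_def) (simp add: munit_def)

lemma trace_munit: "trace (munit (p, q) ** E) = E $ q $ p"
  by (simp add: trace_def munit_mult)

text \<open>Idempotents of rank one and trace one are split off until nothing is left. The last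
  clause is how spectral projections are shown to vanish: trace zero forces \<open>m = 0\<close> in
  characteristic zero.\<close>

lemma trace_idempotent:
  fixes E :: "'k::field_char_0^'n^'n"
  shows "E ** E = E \<Longrightarrow> \<exists>m. trace E = of_nat m \<and> (m = 0 \<longrightarrow> E = 0)"
proof (induction "M.dim (right_ideal E)" arbitrary: E rule: less_induct)
  case (less E)
  show ?case
  proof (cases "E = 0")
    case False
    then obtain q p where qp: "E $ q $ p \<noteq> 0" by (auto simp: vec_eq_iff)
    \<comment> \<open>The entry of \<open>E\<close> at \<open>(q, p)\<close> is nonzero, and
      \<open>E ** u ** E\<close> squares to that entry times itself; dividing by the entry gives an
      idempotent of rank one below \<open>E\<close>.\<close>
    define u where "u = (munit (p, q) :: 'k^'n^'n)"
    define E1 where "E1 = inverse (E $ q $ p) *\<^sub>m (E ** u ** E)"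
    have EE1: "E ** E1 = E1"
      unfolding E1_def by (simp add: mm_simps(10) matrix_mul_assoc less.prems)
    have E1E: "E1 ** E = E1"
      unfolding E1_def using less.prems by (simp add: mm_simps(9)) (metis matrix_mul_assoc)
    have "E ** u ** E ** (E ** u ** E) = E ** (u ** (E ** E) ** u) ** E"
      by (simp add: matrix_mul_assoc)
    also have "\<dots> = (E $ q $ p) *\<^sub>m (E ** u ** E)"
      unfolding less.prems u_def munit_sandwich by (simp add: mm_simps)
    finally have E11: "E1 ** E1 = E1"
      unfolding E1_def using qp by (simp add: mm_simps)
    have "trace (E ** u ** E) = trace (u ** (E ** E))"
      using trace_rotate[of E u E] trace_mul_sym[of "E ** E" u] by simp
    then have tr1: "trace E1 = 1"
      unfolding E1_def using qp by (simp add: mscale_trace less.prems u_def trace_munit)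
    have id: "(E - E1) ** (E - E1) = E - E1" by (simp add: mm_simps less.prems EE1 E1E E11)
    have "M.dim (right_ideal (E - E1)) < M.dim (right_ideal E)"
    proof (rule dim_right_ideal_less)
      show "E - E1 = E ** (mat 1 - E1)" by (simp add: mm_simps EE1)
      show "E \<notin> right_ideal (E - E1)"
      proof
        assume "E \<in> right_ideal (E - E1)"
        then obtain X where "E = (E - E1) ** X" by (auto simp: right_ideal_def)
        then have "E1 ** E = (E1 ** (E - E1)) ** X" by (simp add: matrix_mul_assoc[symmetric])
        also have "E1 ** (E - E1) = 0" by (simp add: mm_simps E1E E11)
        finally show False using tr1 E1E by (simp add: mm_simps)
      qed
    qed
    from less.hyps[OF this id] obtain m where "trace (E - E1) = of_nat m" by blast
    then have "trace E = of_nat (Suc m)" using tr1 by (simp add: trace_sub algebra_simps)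
    then show ?thesis by blast
  qed auto
qed

subsection \<open>Generalised eigenspaces\<close>

definition shift :: "('k::field^'n^'n \<Rightarrow> 'k^'n^'n) \<Rightarrow> 'k \<Rightarrow> 'k^'n^'n \<Rightarrow> 'k^'n^'n" where
  "shift T c v = T v - c *\<^sub>m v"

lemma lin_shift: "lin T \<Longrightarrow> lin (shift T c)"
  by (rule linI) (simp_all add: shift_def MM.linear_add MM.linear_scale msimps algebra_simps)

lemma lin_funpow: "lin T \<Longrightarrow> lin (T ^^ k)"
proof (induction k)
  case 0
  show ?case by (rule linI) simp_all
next
  case (Suc k)
  then have "lin (T ^^ k)" by simp
  then show ?case using Suc.prems
    by (intro linI) (simp_all add: MM.linear_add MM.linear_scale)
qed

lemma funpow_in: "(\<And>x. x \<in> p \<Longrightarrow> T x \<in> p) \<Longrightarrow> v \<in> p \<Longrightarrow> (T ^^ k) v \<in> p"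
  by (induction k) auto

definition geig :: "('k::field^'n^'n \<Rightarrow> 'k^'n^'n) \<Rightarrow> ('k^'n^'n) set \<Rightarrow> 'k \<Rightarrow> ('k^'n^'n) set" where
  "geig T p c = {v \<in> p. \<exists>N. (shift T c ^^ N) v = 0}"

lemma geig_0: "lin T \<Longrightarrow> M.subspace p \<Longrightarrow> 0 \<in> geig T p c"
  by (auto simp: geig_def M.subspace_0 intro!: exI[of _ 0])

text \<open>On the generalised eigenspace for \<open>c\<close> the operator
  \<open>T - d = (T - c) + (c - d)\<close> is a nilpotent plus a nonzero scalar, hence invertible.
  Induction on the order of nilpotency builds the inverse inside \<open>p\<close>.\<close>

lemma geig_solve:
  assumes T: "lin T" and p: "M.subspace p" "\<And>x. x \<in> p \<Longrightarrow> T x \<in> p"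
    and w: "w \<in> geig T p c" and "c \<noteq> d"
  shows "\<exists>u \<in> geig T p c. shift T d u = w"
proof -
  have sp: "shift T c x \<in> p" if "x \<in> p" for x
    using that p by (simp add: shift_def M.subspace_diff M.subspace_scale)
  have "\<exists>u\<in>p. shift T d u = w \<and> (shift T c ^^ N) u = 0" if "w \<in> p" "(shift T c ^^ N) w = 0" for N w
    using that
  proof (induction N arbitrary: w)
    case 0
    then show ?case
      by (intro bexI[of _ 0]) (simp_all add: shift_def MM.linear_0[OF T] M.subspace_0 p)
  next
    case (Suc N)
    have "(shift T c ^^ N) (shift T c w) = 0" using Suc.prems by (simp add: funpow_swap1)
    from Suc.IH[OF sp[OF Suc.prems(1)] this] obtain u where
      u: "u \<in> p" "shift T d u = shift T c w" "(shift T c ^^ N) u = 0" by blast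
    let ?k = "inverse (c - d)"
    let ?u = "?k *\<^sub>m (w - u)"
    have k: "?k * (c - d) = 1" using \<open>c \<noteq> d\<close> by simp
    have "shift T d w = shift T c w + (c - d) *\<^sub>m w" by (simp add: shift_def msimps)
    then have "shift T d (w - u) = (c - d) *\<^sub>m w"
      using u(2) MM.linear_diff[OF lin_shift[OF T]] by simp
    then have "shift T d ?u = w"
      using k by (simp add: MM.linear_scale[OF lin_shift[OF T]])
    moreover have "(shift T c ^^ Suc N) ?u = 0"
    proof -
      have "(shift T c ^^ Suc N) u = 0"
        using u(3) MM.linear_0[OF lin_shift[OF T]] by simp
      then show ?thesis using Suc.prems(2)
        by (simp only: MM.linear_scale[OF lin_funpow[OF lin_shift[OF T]]]
            MM.linear_diff[OF lin_funpow[OF lin_shift[OF T]]]) simp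
    qed
    moreover have "?u \<in> p" using Suc.prems(1) u(1) p by (simp add: M.subspace_diff M.subspace_scale)
    ultimately show ?case by blast
  qed
  with w show ?thesis unfolding geig_def by blast
qed

text \<open>The vector \<open>q(T) v\<close>, evaluated by Horner's scheme.\<close>

definition popT :: "('k::field^'n^'n \<Rightarrow> 'k^'n^'n) \<Rightarrow> 'k poly \<Rightarrow> 'k^'n^'n \<Rightarrow> 'k^'n^'n" where
  "popT T q v = fold_coeffs (\<lambda>a x. a *\<^sub>m v + T x) q 0"

lemma popT_0 [simp]: "popT T 0 v = 0"
  by (simp add: popT_def)

lemma popT_pCons: "lin T \<Longrightarrow> popT T (pCons a q) v = a *\<^sub>m v + T (popT T q v)"
  by (cases "q = 0 \<and> a = 0") (auto simp: popT_def MM.linear_0)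

lemma popT_add: "lin T \<Longrightarrow> popT T (p + q) v = popT T p v + popT T q v"
  by (induction p q rule: poly_induct2) (simp_all add: popT_pCons MM.linear_add msimps)

lemma popT_smult: "lin T \<Longrightarrow> popT T (smult c q) v = c *\<^sub>m popT T q v"
  by (induction q) (simp_all add: popT_pCons MM.linear_scale msimps)

lemma popT_mult: "lin T \<Longrightarrow> popT T (p * q) v = popT T p (popT T q v)"
  by (induction p) (simp_all add: popT_pCons popT_add popT_smult)

lemma popT_monom: "lin T \<Longrightarrow> popT T (monom 1 k) v = (T ^^ k) v"
  by (induction k) (simp_all add: popT_pCons monom_0 monom_Suc MM.linear_0)

text \<open>The iterates \<open>T^i v\<close> are linearly dependent in finite dimension; a
  polynomial for the single vector \<open>v\<close> is enough for decomposing
  \<open>v\<close>.\<close>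

lemma annihilating_poly:
  fixes T :: "'k::field^'n^'n \<Rightarrow> 'k^'n^'n"
  assumes T: "lin T"
  shows "\<exists>q. q \<noteq> 0 \<and> popT T q v = 0"
proof -
  define W where "W m = (\<lambda>i. (T ^^ i) v) ` {..<m}" for m
  have "\<exists>m. (T ^^ m) v \<in> M.span (W m)"
  proof (rule ccontr)
    assume n: "\<nexists>m. (T ^^ m) v \<in> M.span (W m)"
    have "M.dim (W m) = m" for m
    proof (induction m)
      case (Suc m)
      have "W (Suc m) = insert ((T ^^ m) v) (W m)" by (auto simp: W_def lessThan_Suc)
      then show ?case using Suc n by (simp add: M.dim_insert)
    qed (simp add: W_def)
    from this[of "Suc (M.dim (UNIV :: ('k^'n^'n) set))"]
      M.dim_subset[of "W (Suc (M.dim (UNIV :: ('k^'n^'n) set)))" UNIV] show False by simp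
  qed
  then obtain m where m: "(T ^^ m) v \<in> M.span (W m)" by blast
  have "\<exists>q. x = popT T q v \<and> (\<forall>i\<ge>m. coeff q i = 0)" if "x \<in> M.span (W m)" for x
    using that
  proof (induction rule: M.span_induct_alt)
    case base
    show ?case by (rule exI[of _ 0]) simp
  next
    case (step c x y)
    then obtain i q where "i < m" "x = (T ^^ i) v" "y = popT T q v" "\<forall>i\<ge>m. coeff q i = 0"
      by (auto simp: W_def)
    then show ?case
      by (intro exI[of _ "smult c (monom 1 i) + q"]) (auto simp: popT_add popT_smult popT_monom T)
  qed
  then obtain q where q: "(T ^^ m) v = popT T q v" "\<forall>i\<ge>m. coeff q i = 0" using m by blast
  have "coeff (monom 1 m - q) m = 1" using q by simp
  then have "monom 1 m - q \<noteq> 0" by (metis coeff_0 zero_neq_one)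
  moreover have "popT T (monom 1 m - q) v = 0"
    using popT_add[OF T, of "monom 1 m - q" q v] q(1) by (simp add: popT_monom[OF T])
  ultimately show ?thesis by blast
qed

text \<open>Induction on the degree of a polynomial annihilating \<open>v\<close>. For a root
  \<open>a\<close> the vector \<open>(T - a) v\<close> has a polynomial of smaller degree; its
  components away from \<open>a\<close> are lifted through \<open>T - a\<close>, and what then
  remains of \<open>v\<close> is a generalised eigenvector for \<open>a\<close>. All components stay
  in the stable subspace \<open>p\<close>.\<close>

lemma geig_decomp:
  fixes T :: "'k::alg_closed_field^'n^'n \<Rightarrow> 'k^'n^'n"
  assumes T: "lin T" and p: "M.subspace p" "\<And>x. x \<in> p \<Longrightarrow> T x \<in> p" and v: "v \<in> p"
  shows "\<exists>L w. finite L \<and> (\<forall>c. w c \<in> geig T p c) \<and> v = (\<Sum>c\<in>L. w c)"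
proof -
  obtain q where "q \<noteq> 0" "popT T q v = 0" using annihilating_poly[OF T] by blast
  then show ?thesis using v
  proof (induction "degree q" arbitrary: q v)
    case 0
    then obtain a where "q = [:a:]" "a \<noteq> 0" by (metis degree_eq_zeroE pCons_0_0)
    then have "v = 0" using 0 by (simp add: popT_pCons[OF T] MM.linear_0[OF T])
    then show ?case by (intro exI[of _ "{}"] exI[of _ "\<lambda>_. 0"]) (simp add: geig_0[OF T p(1)])
  next
    case (Suc n)
    then have "degree q > 0" by simp
    then obtain a where "poly q a = 0" using alg_closed_imp_poly_has_root by blast
    then obtain r where r: "q = [:-a, 1:] * r" by (metis poly_eq_0_iff_dvd dvdE)
    with Suc.prems have r0: "r \<noteq> 0" by auto
    have "degree q = 1 + degree r" unfolding r using r0 by (subst degree_mult_eq) auto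
    with Suc have dr: "n = degree r" by simp
    have "popT T [:-a, 1:] v = shift T a v"
      by (simp add: popT_pCons[OF T] MM.linear_0[OF T] shift_def)
    then have "popT T r (shift T a v) = 0"
      using Suc.prems(2) popT_mult[OF T, of r "[:-a, 1:]" v] by (simp add: r mult.commute del: popT_pCons)
    moreover have "shift T a v \<in> p"
      using Suc.prems p by (simp add: shift_def M.subspace_diff M.subspace_scale)
    ultimately obtain L w where L: "finite L" "\<And>c. w c \<in> geig T p c" "shift T a v = (\<Sum>c\<in>L. w c)"
      using Suc.hyps(1)[OF dr r0] by blast
    have "\<forall>c. \<exists>u. c \<noteq> a \<longrightarrow> u \<in> geig T p c \<and> shift T a u = w c"
      using geig_solve[OF T p(1) p(2) L(2)] by blast
    then obtain u where u: "\<And>c. c \<noteq> a \<Longrightarrow> u c \<in> geig T p c" "\<And>c. c \<noteq> a \<Longrightarrow> shift T a (u c) = w c"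
      by metis
    define v' where "v' = v - (\<Sum>c\<in>L-{a}. u c)"
    have "shift T a v' = (\<Sum>c\<in>L. w c) - (\<Sum>c\<in>L-{a}. w c)"
      unfolding v'_def using L(3) u(2)
      by (simp add: MM.linear_diff[OF lin_shift[OF T]] MM.linear_sum[OF lin_shift[OF T]])
    also have "\<dots> \<in> geig T p a"
      using L(1,2) geig_0[OF T p(1)] by (cases "a \<in> L") (auto simp: sum.remove[of L a])
    finally have "\<exists>N. (shift T a ^^ Suc N) v' = 0"
      unfolding funpow_Suc_right by (auto simp: geig_def)
    moreover have "v' \<in> p" unfolding v'_def
      using Suc.prems(3) u(1) by (intro M.subspace_diff M.subspace_sum p) (auto simp: geig_def)
    ultimately have v'g: "v' \<in> geig T p a" unfolding geig_def by blast
    let ?w = "\<lambda>c. if c = a then v' else u c"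
    have "v = sum ?w (insert a (L - {a}))"
    proof -
      have "sum ?w (insert a (L - {a})) = v' + sum ?w (L - {a})"
        using L(1) by (subst sum.insert) auto
      also have "sum ?w (L - {a}) = (\<Sum>c\<in>L-{a}. u c)" by (rule sum.cong) auto
      finally show ?thesis by (simp add: v'_def)
    qed
    then show ?case
      using L(1) v'g u(1) by (intro exI[of _ "insert a (L - {a})"] exI[of _ ?w]) auto
  qed
qed

lemma geig_disjoint:
  assumes T: "lin T" and v: "v \<in> geig T p c" "v \<in> geig T q d" and "c \<noteq> d"
  shows "v = 0"
proof -
  obtain M where "(shift T c ^^ M) v = 0" using v by (auto simp: geig_def)
  moreover have "\<exists>N. (shift T d ^^ N) v = 0" using v by (auto simp: geig_def)
  ultimately show ?thesis
  proof (induction M arbitrary: v)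
    case (Suc M)
    then obtain N where N: "(shift T d ^^ N) v = 0" by blast
    have comm: "shift T d (shift T c x) = shift T c (shift T d x)" for x
      by (simp add: shift_def MM.linear_diff[OF T] MM.linear_scale[OF T] msimps algebra_simps)
    have "(shift T d ^^ n) (shift T c v) = shift T c ((shift T d ^^ n) v)" for n
      by (induction n) (simp_all add: comm)
    then have "(shift T d ^^ N) (shift T c v) = 0"
      using N MM.linear_0[OF lin_shift[OF T]] by simp
    moreover have "(shift T c ^^ M) (shift T c v) = 0"
      using Suc.prems(1) by (simp only: funpow_Suc_right comp_apply)
    ultimately have "shift T c v = 0" using Suc.IH[of "shift T c v"] by blast
    then have e: "shift T d v = (c - d) *\<^sub>m v" by (simp add: shift_def msimps)
    have "(shift T d ^^ n) v = ((c - d) ^ n) *\<^sub>m v" for n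
      by (induction n) (simp_all add: e MM.linear_scale[OF lin_shift[OF T]] mult.commute)
    with N show ?case using \<open>c \<noteq> d\<close> by simp
  qed simp
qed

lemma lin_mult: "lin (\<lambda>v. A ** v)"
  by (rule linI) (simp_all add: mm_simps)

lemma shift_mult_pow: "(shift (\<lambda>v. A ** v) c ^^ N) v = mpow (A - c *\<^sub>m mat 1) N ** v"
  by (induction N) (simp_all add: mpow_Suc shift_def mm_simps matrix_mul_assoc)

lemma span_mpow_comm:
  assumes "u \<in> M.span (range (mpow A))" "A ** C = C ** A"
  shows "u ** C = C ** u"
  using assms(1) by (induction rule: M.span_induct_alt)
    (auto simp: mm_simps mpow_comm_gen[OF assms(2)])

lemma span_mpow_mult: "u \<in> M.span (range (mpow A)) \<Longrightarrow> A ** u \<in> M.span (range (\<lambda>k. mpow A (Suc k)))"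
proof (induction rule: M.span_induct_alt)
  case (step c x y)
  then obtain k where "x = mpow A k" by auto
  then have "A ** x \<in> M.span (range (\<lambda>k. mpow A (Suc k)))" by (auto simp: mpow_Suc intro: M.span_base)
  then show ?case using step by (simp add: mm_simps M.span_add M.span_scale)
qed (simp add: mm_simps M.span_zero)

text \<open>The projections onto the generalised eigenspaces of \<open>A\<close>. Taking them in the
  span of the powers of \<open>A\<close> makes them commute with whatever commutes with
  \<open>A\<close>. The set \<open>L\<close> may contain more than the eigenvalues;
  \<open>P c\<close> is then zero at the excess.\<close>

definition spectral :: "'k::field^'n^'n \<Rightarrow> 'k set \<Rightarrow> ('k \<Rightarrow> 'k^'n^'n) \<Rightarrow> bool" where
  "spectral A L P \<longleftrightarrow> finite L \<and> (\<Sum>c\<in>L. P c) = mat 1 \<and>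
     (\<forall>c. P c \<in> geig (\<lambda>v. A ** v) (M.span (range (mpow A))) c)"

text \<open>The decomposition of \<open>mat 1\<close> under left multiplication by
  \<open>A\<close>.\<close>

lemma spectral_exists: "\<exists>L P. spectral (A :: 'k::alg_closed_field^'n^'n) L P"
proof -
  have "\<exists>L w. finite L \<and> (\<forall>c. w c \<in> geig (\<lambda>v. A ** v) (M.span (range (mpow A))) c)
      \<and> mat 1 = (\<Sum>c\<in>L. w c)"
  proof (rule geig_decomp[OF lin_mult M.subspace_span])
    show "A ** x \<in> M.span (range (mpow A))" if "x \<in> M.span (range (mpow A))" for x
      using span_mpow_mult[OF that] M.span_mono[of "range (\<lambda>k. mpow A (Suc k))" "range (mpow A)"] by auto
    show "mat 1 \<in> M.span (range (mpow A))" by (intro M.span_base range_eqI[of _ _ 0]) simp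
  qed
  then show ?thesis unfolding spectral_def by metis
qed

context
  fixes A :: "'k::field^'n^'n" and L P
  assumes sp: "spectral A L P"
begin

lemma spectral_comm: "A ** C = C ** A \<Longrightarrow> P c ** C = C ** P c"
  using sp span_mpow_comm unfolding spectral_def geig_def by blast

lemma spectral_comm_self: "P c ** A = A ** P c"
  by (rule spectral_comm) simp

lemma spectral_kill: "\<exists>N. mpow (A - c *\<^sub>m mat 1) N ** P c = 0"
  using sp by (simp add: spectral_def geig_def shift_mult_pow)

lemma spectral_orth:
  assumes "c \<noteq> d" shows "P c ** P d = 0"
proof -
  obtain M N where M: "mpow (A - c *\<^sub>m mat 1) M ** P c = 0" and N: "mpow (A - d *\<^sub>m mat 1) N ** P d = 0"
    using spectral_kill by meson
  have "P c ** P d = P d ** P c" by (rule spectral_comm) (rule spectral_comm_self[symmetric])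
  then have "mpow (A - d *\<^sub>m mat 1) N ** (P c ** P d) = 0"
    using N by (simp add: matrix_mul_assoc mm_simps)
  moreover have "mpow (A - c *\<^sub>m mat 1) M ** (P c ** P d) = 0"
    using M by (simp add: matrix_mul_assoc mm_simps)
  ultimately have "P c ** P d \<in> geig (\<lambda>v. A ** v) UNIV c" "P c ** P d \<in> geig (\<lambda>v. A ** v) UNIV d"
    by (auto simp: geig_def shift_mult_pow)
  then show ?thesis using geig_disjoint[OF lin_mult] assms by blast
qed

lemma spectral_sum_mult: "(\<Sum>c\<in>L. P c ** v) = (v :: 'k^'n^'n)"
proof -
  have "(\<Sum>c\<in>L. P c ** v) = (\<Sum>c\<in>L. P c) ** v"
    by (induction L rule: infinite_finite_induct) (simp_all add: mm_simps)
  then show ?thesis using sp by (simp add: spectral_def)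
qed

lemma spectral_mult_sum: "(\<Sum>c\<in>L. v ** P c) = (v :: 'k^'n^'n)"
proof -
  have "(\<Sum>c\<in>L. v ** P c) = v ** (\<Sum>c\<in>L. P c)"
    by (induction L rule: infinite_finite_induct) (simp_all add: mm_simps)
  then show ?thesis using sp by (simp add: spectral_def)
qed

lemma spectral_finite: "finite L"
  using sp by (simp add: spectral_def)

lemma spectral_idem:
  assumes "c \<in> L" shows "P c ** P c = P c"
proof -
  have "P c = (\<Sum>d\<in>L. P c ** P d)" by (rule spectral_mult_sum[symmetric])
  also have "\<dots> = (\<Sum>d\<in>{c}. P c ** P d)"
    using assms spectral_finite by (intro sum.mono_neutral_right) (auto, metis spectral_orth)
  finally show ?thesis by simp
qed

text \<open>On the range of \<open>P c\<close> the matrix \<open>A\<close> is \<open>c\<close> plus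
  a nilpotent, and nilpotents have trace zero.\<close>

lemma spectral_trace: "trace (A ** P c) = c * trace (P c)"
proof -
  obtain N where N: "mpow (A - c *\<^sub>m mat 1) N ** P c = 0" using spectral_kill by blast
  have cm: "(A - c *\<^sub>m mat 1) ** P c = P c ** (A - c *\<^sub>m mat 1)"
    by (simp add: mm_simps spectral_comm_self)
  have "mpow ((A - c *\<^sub>m mat 1) ** P c) (Suc N) = 0"
  proof -
    have "mpow (A - c *\<^sub>m mat 1) (Suc N) ** mpow (P c) (Suc N)
      = (A - c *\<^sub>m mat 1) ** (mpow (A - c *\<^sub>m mat 1) N ** P c) ** mpow (P c) N"
      by (simp only: mpow_Suc matrix_mul_assoc)
    then have "mpow (A - c *\<^sub>m mat 1) (Suc N) ** mpow (P c) (Suc N) = 0"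
      by (simp only: N mm_simps)
    then show ?thesis by (subst mpow_mult[OF cm])
  qed
  then have "trace ((A - c *\<^sub>m mat 1) ** P c) = 0" by (intro trace_nilp) (auto simp: nilp_def)
  then show ?thesis by (simp add: mm_simps trace_sub mscale_trace)
qed

lemma spectral_nilp:
  assumes "\<And>c. c \<in> L \<Longrightarrow> c \<noteq> 0 \<Longrightarrow> P c = 0"
  shows "nilp A"
proof -
  obtain N where N: "mpow A N ** P 0 = 0" using spectral_kill[of 0] by auto
  have "mpow A N = (\<Sum>c\<in>L. mpow A N ** P c)" by (rule spectral_mult_sum[symmetric])
  also have "\<dots> = 0" using N assms by (intro sum.neutral) (metis mm_simps(7))
  finally show ?thesis by (auto simp: nilp_def)
qed

end

text \<open>Newton's identities are bypassed. For \<open>c \<noteq> 0\<close> left multiplication by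
  \<open>A\<close> is invertible on the generalised eigenspace, so \<open>P c = A ** u\<close> with
  \<open>u\<close> a polynomial in \<open>A\<close>. Thus \<open>P c\<close> is a combination of
  positive powers and has trace zero, and an idempotent of trace zero vanishes.\<close>

lemma nilp_if_traces:
  fixes A :: "'k::{alg_closed_field, field_char_0}^'n^'n"
  assumes "\<And>k. trace (mpow A (Suc k)) = 0"
  shows "nilp A"
proof -
  obtain L P where sp: "spectral A L P" using spectral_exists by blast
  show ?thesis
  proof (rule spectral_nilp[OF sp])
    fix c assume c: "c \<in> L" "c \<noteq> 0"
    let ?p = "M.span (range (mpow A))"
    have "\<exists>u\<in>geig (\<lambda>v. A ** v) ?p c. shift (\<lambda>v. A ** v) 0 u = P c"
    proof (rule geig_solve[OF lin_mult M.subspace_span])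
      show "A ** x \<in> ?p" if "x \<in> ?p" for x
        using span_mpow_mult[OF that] M.span_mono[of "range (\<lambda>k. mpow A (Suc k))" "range (mpow A)"] by auto
    qed (use sp c in \<open>auto simp: spectral_def\<close>)
    then obtain u where "u \<in> ?p" "A ** u = P c" by (auto simp: geig_def shift_def)
    then have "P c \<in> M.span (range (\<lambda>k. mpow A (Suc k)))" using span_mpow_mult by metis
    then have "trace (P c) = 0"
      by (induction rule: M.span_induct_alt) (auto simp: trace_simps assms)
    then show "P c = 0" using trace_idempotent[OF spectral_idem[OF sp c(1)]] by auto
  qed
qed

lemma trace_mpow_nilp: "nilp A \<Longrightarrow> trace (mpow A (Suc k)) = 0"
  by (rule trace_nilp) (simp add: mpow_Suc nilp_mult mpow_comm)

lemma nilp_eigen: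
  fixes x :: "'k::{alg_closed_field, field_char_0}^'n^'n"
  assumes "ad h x = c *\<^sub>m x" "c \<noteq> 0" shows "nilp x"
  by (rule nilp_if_traces) (rule trace_mpow_eigen[OF assms])

subsection \<open>Cartan's criterion\<close>

lemma two_sided_nilp:
  fixes X Z w :: "'k::field^'n^'n"
  assumes "mpow X N ** w = 0" "w ** mpow Z N = 0"
  shows "((\<lambda>v. X ** v - v ** Z) ^^ (2 * N)) w = 0"
proof -
  let ?S = "\<lambda>v. X ** v - v ** Z"
  have "mpow X i ** (?S ^^ m) w ** mpow Z j = 0" if "i + j + m \<ge> 2 * N" for i j m
    using that
  proof (induction m arbitrary: i j)
    case 0
    have 1: "mpow X i ** w = 0" if "i \<ge> N"
      using assms(1) mpow_add[of X "i - N" N] that by (simp add: matrix_mul_assoc[symmetric] mm_simps)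
    have 2: "w ** mpow Z j = 0" if "j \<ge> N"
      using assms(2) mpow_add[of Z N "j - N"] that by (simp add: matrix_mul_assoc mm_simps)
    have "i \<ge> N \<or> j \<ge> N" using 0 by arith
    then show ?case using 1 2 by (auto simp: mm_simps) (simp add: matrix_mul_assoc[symmetric] mm_simps)
  next
    case (Suc m)
    have "mpow X i ** (?S ^^ Suc m) w ** mpow Z j = mpow X (Suc i) ** (?S ^^ m) w ** mpow Z j
       - mpow X i ** (?S ^^ m) w ** mpow Z (Suc j)"
      unfolding mpow_Suc2[of X i] mpow_Suc[of Z j] by (simp add: msimps)
    then show ?case using Suc.IH[of "Suc i" j] Suc.IH[of i "Suc j"] Suc.prems by simp
  qed
  from this[of 0 0 "2 * N"] show ?thesis by simp
qed

lemma mpow_kill_ge: "mpow X N ** (w :: 'k::field^'n^'n) = 0 \<Longrightarrow> N \<le> M \<Longrightarrow> mpow X M ** w = 0"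
  using mpow_add[of X "M - N" N] by (simp add: matrix_mul_assoc[symmetric] mm_simps)

lemma mpow_kill_ge2: "(w :: 'k::field^'n^'n) ** mpow X N = 0 \<Longrightarrow> N \<le> M \<Longrightarrow> w ** mpow X M = 0"
  using mpow_add[of X N "M - N"] by (simp add: matrix_mul_assoc mm_simps)

text \<open>With \<open>f\<close> additive, \<open>\<Sum> f(c) P\<^sub>c\<close> is a replica of \<open>A\<close>: its adjoint action multiplies
  generalised eigenvectors of \<open>ad A\<close> by the values of \<open>f\<close>.\<close>

lemma replica_eigen:
  fixes A :: "'k::field^'n^'n" and f :: "'k \<Rightarrow> 'k"
  assumes sp: "spectral A L P" and f: "\<And>x y. f (x - y) = f x - f y"
    and b: "(shift (ad A) m ^^ N) b = 0"
  shows "ad (\<Sum>c\<in>L. f c *\<^sub>m P c) b = f m *\<^sub>m b"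
proof -
  \<comment> \<open>The block \<open>P c ** b ** P d\<close> is a generalised eigenvector of
    \<open>ad A\<close> for \<open>m\<close>, because \<open>b\<close> is one, and for
    \<open>c - d\<close>, because of the two projections; so only blocks with
    \<open>c - d = m\<close> survive.\<close>
  have z: "P c ** b ** P d = 0" if cd: "c - d \<noteq> m" for c d
  proof -
    let ?w = "P c ** b ** P d"
    have "ad A (P c ** v ** P d) = P c ** ad A v ** P d" for v
      using spectral_comm_self[OF sp, of c] spectral_comm_self[OF sp, of d]
      by (simp add: ad_def msimps) (metis matrix_mul_assoc)
    then have "shift (ad A) m (P c ** v ** P d) = P c ** shift (ad A) m v ** P d" for v
      by (simp add: shift_def mm_simps)
    then have "(shift (ad A) m ^^ k) (P c ** v ** P d) = P c ** (shift (ad A) m ^^ k) v ** P d" for v k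
      by (induction k) simp_all
    then have 1: "?w \<in> geig (ad A) UNIV m" using b by (auto simp: geig_def mm_simps intro!: exI[of _ N])
    obtain K K' where K: "mpow (A - c *\<^sub>m mat 1) K ** P c = 0" "mpow (A - d *\<^sub>m mat 1) K' ** P d = 0"
      using spectral_kill[OF sp] by meson
    let ?X = "A - c *\<^sub>m mat 1" and ?Z = "A - d *\<^sub>m mat 1" and ?M = "max K K'"
    have a: "mpow ?X ?M ** ?w = 0"
      using mpow_kill_ge[OF K(1), of ?M] by (simp add: matrix_mul_assoc mm_simps)
    have "?Z ** P d = P d ** ?Z" by (simp add: mm_simps spectral_comm_self[OF sp])
    then have "P d ** mpow ?Z K' = 0" using K(2) by (metis mpow_comm_gen)
    then have "?w ** mpow ?Z ?M = 0"
      using mpow_kill_ge2[of "P d" ?Z K' ?M] by (simp add: matrix_mul_assoc[symmetric] mm_simps)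
    from two_sided_nilp[OF a this] have "((\<lambda>v. ?X ** v - v ** ?Z) ^^ (2 * ?M)) ?w = 0" .
    moreover have "(\<lambda>v. ?X ** v - v ** ?Z) = shift (ad A) (c - d)"
      by (simp add: fun_eq_iff shift_def ad_def msimps algebra_simps)
    ultimately have "?w \<in> geig (ad A) UNIV (c - d)" by (auto simp: geig_def)
    then show ?thesis using geig_disjoint[OF lin_ad 1] cd by blast
  qed
  have dec: "b = (\<Sum>c\<in>L. \<Sum>d\<in>L. P c ** b ** P d)"
    by (simp add: spectral_mult_sum[OF sp] spectral_sum_mult[OF sp])
  let ?Y = "\<Sum>c\<in>L. f c *\<^sub>m P c"
  have sumL: "(\<Sum>c\<in>L. g c) ** v = (\<Sum>c\<in>L. g c ** v)" for g :: "'k \<Rightarrow> 'k^'n^'n" and v :: "'k^'n^'n"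
    by (induction L rule: infinite_finite_induct) (simp_all add: mm_simps)
  have sumR: "v ** (\<Sum>c\<in>L. g c) = (\<Sum>c\<in>L. v ** g c)" for g :: "'k \<Rightarrow> 'k^'n^'n" and v :: "'k^'n^'n"
    by (induction L rule: infinite_finite_induct) (simp_all add: mm_simps)
  have "ad ?Y b = (\<Sum>c\<in>L. f c *\<^sub>m (P c ** b)) - (\<Sum>d\<in>L. f d *\<^sub>m (b ** P d))"
    by (simp add: ad_def sumL sumR mm_simps)
  also have "(\<Sum>c\<in>L. f c *\<^sub>m (P c ** b)) = (\<Sum>c\<in>L. \<Sum>d\<in>L. f c *\<^sub>m (P c ** b ** P d))"
    by (simp add: M.scale_sum_right[symmetric] spectral_mult_sum[OF sp])
  also have "(\<Sum>d\<in>L. f d *\<^sub>m (b ** P d)) = (\<Sum>d\<in>L. \<Sum>c\<in>L. f d *\<^sub>m (P c ** b ** P d))"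
    by (simp add: M.scale_sum_right[symmetric] matrix_mul_assoc[symmetric] spectral_sum_mult[OF sp])
  also have "\<dots> = (\<Sum>c\<in>L. \<Sum>d\<in>L. f d *\<^sub>m (P c ** b ** P d))" by (rule sum.swap)
  also have "(\<Sum>c\<in>L. \<Sum>d\<in>L. f c *\<^sub>m (P c ** b ** P d)) - \<dots>
      = (\<Sum>c\<in>L. \<Sum>d\<in>L. f (c - d) *\<^sub>m (P c ** b ** P d))"
    by (simp add: sum_subtractf[symmetric] f msimps)
  also have "\<dots> = (\<Sum>c\<in>L. \<Sum>d\<in>L. f m *\<^sub>m (P c ** b ** P d))"
    by (intro sum.cong refl) (metis z M.scale_zero_right)
  also have "\<dots> = f m *\<^sub>m b" using dec by (simp add: M.scale_sum_right[symmetric])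
  finally show ?thesis .
qed

text \<open>A coordinate functional of the field as a vector space over the rationals, for a basis
  containing \<open>c\<close>.\<close>

lemma rational_functional:
  fixes c :: "'k::field_char_0"
  assumes "c \<noteq> 0"
  shows "\<exists>\<phi> :: 'k \<Rightarrow> rat. (\<forall>x y. \<phi> (x + y) = \<phi> x + \<phi> y) \<and> (\<forall>q x. \<phi> (of_rat q * x) = q * \<phi> x) \<and> \<phi> c \<noteq> 0"
proof -
  interpret Q: vector_space_pair "\<lambda>q (x :: 'k). of_rat q * x" "(*) :: rat \<Rightarrow> rat \<Rightarrow> rat"
    by unfold_locales (simp_all add: algebra_simps of_rat_add of_rat_mult)
  have "Q.vs1.independent {c}" using assms by simp
  then obtain g where g: "Vector_Spaces.linear (\<lambda>q x. of_rat q * x) (*) g" "g c = 1"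
    using Q.linear_independent_extend[of "{c}" "\<lambda>_. 1"] by auto
  then show ?thesis using Q.linear_add[OF g(1)] Q.linear_scale[OF g(1)] by (intro exI[of _ g]) auto
qed

text \<open>Cartan's criterion for the representation
  \<open>x \<mapsto> diag(x, \<sigma> x)\<close>, carried by two matrices with separate spectral
  data. If \<open>c \<noteq> 0\<close> were an eigenvalue of \<open>x\<close>, a rational functional
  \<open>\<phi>\<close> not vanishing at \<open>c\<close> would give replicas \<open>Y\<close> and
  \<open>Y'\<close> orthogonal to \<open>[p, p]\<close>, and the orthogonality to \<open>x\<close>
  itself is a vanishing sum of rational squares with positive multiplicities.\<close>

lemma cartan_nilp:
  fixes p :: "('k::{alg_closed_field, field_char_0}^'n^'n) set" and \<sigma> :: "'k^'n^'n \<Rightarrow> 'k^'n^'n"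
  assumes p: "M.subspace p" "\<And>a b. a \<in> p \<Longrightarrow> b \<in> p \<Longrightarrow> ad a b \<in> p"
    and s: "\<And>a b. a \<in> p \<Longrightarrow> b \<in> p \<Longrightarrow> \<sigma> (a + b) = \<sigma> a + \<sigma> b"
      "\<And>c a. a \<in> p \<Longrightarrow> \<sigma> (c *\<^sub>m a) = c *\<^sub>m \<sigma> a"
      "\<And>a b. a \<in> p \<Longrightarrow> b \<in> p \<Longrightarrow> \<sigma> (ad a b) = ad (\<sigma> a) (\<sigma> b)"
    and form: "\<And>a b. a \<in> p \<Longrightarrow> b \<in> p \<Longrightarrow> trace (a ** b) + trace (\<sigma> a ** \<sigma> b) = 0"
    and x: "x \<in> M.span {ad a b | a b. a \<in> p \<and> b \<in> p}"
  shows "nilp x"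
proof -
  have comm_p: "y \<in> p" if "y \<in> M.span {ad a b | a b. a \<in> p \<and> b \<in> p}" for y
    using that M.span_minimal[OF _ p(1), of "{ad a b | a b. a \<in> p \<and> b \<in> p}"] p(2) by blast
  have xp: "x \<in> p" using x comm_p by blast
  have s0: "\<sigma> 0 = 0" using s(2)[of 0 0] M.subspace_0[OF p(1)] by simp
  have s_sum: "\<sigma> (\<Sum>c\<in>S. w c) = (\<Sum>c\<in>S. \<sigma> (w c))" if "\<And>c. w c \<in> p" for S :: "'k set" and w
    by (induction S rule: infinite_finite_induct) (simp_all add: s s0 that M.subspace_sum[OF p(1)])
  obtain L P where sp: "spectral x L P" using spectral_exists by blast
  obtain L' P' where sp': "spectral (\<sigma> x) L' P'" using spectral_exists by blast
  have "P c = 0" if cL: "c \<in> L" and c0: "c \<noteq> 0" for c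
  proof (rule ccontr)
    assume Pc: "P c \<noteq> 0"
    obtain \<phi> :: "'k \<Rightarrow> rat" where \<phi>: "\<And>x y. \<phi> (x + y) = \<phi> x + \<phi> y" "\<And>q x. \<phi> (of_rat q * x) = q * \<phi> x" "\<phi> c \<noteq> 0"
      using rational_functional[OF c0] by blast
    define f where "f x = (of_rat (\<phi> x) :: 'k)" for x
    have f: "f (x - y) = f x - f y" for x y
      using \<phi>(1)[of "x - y" y] by (simp add: f_def of_rat_add)
    have \<phi>0: "\<phi> 0 = 0" using \<phi>(1)[of 0 0] by simp
    have \<phi>sum: "\<phi> (\<Sum>x\<in>S. h x) = (\<Sum>x\<in>S. \<phi> (h x))" for S :: "'k set" and h
      by (induction S rule: infinite_finite_induct) (simp_all add: \<phi> \<phi>0)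
    define Y Y' where "Y = (\<Sum>c\<in>L. f c *\<^sub>m P c)" and "Y' = (\<Sum>c\<in>L'. f c *\<^sub>m P' c)"
    \<comment> \<open>Both replicas induce the same operator on \<open>p\<close>, read through
      \<open>\<sigma>\<close>: it multiplies generalised eigenvectors of \<open>ad x\<close> by
      \<open>\<phi>\<close> of the eigenvalue and so preserves \<open>p\<close>, although
      \<open>Y\<close> itself need not lie in \<open>p\<close>.\<close>
    have rep: "\<exists>b'\<in>p. ad Y b = b' \<and> ad Y' (\<sigma> b) = \<sigma> b'" if b: "b \<in> p" for b
    proof -
      obtain M w where w: "finite M" "\<And>c. w c \<in> geig (ad x) p c" "b = (\<Sum>c\<in>M. w c)"
        using geig_decomp[OF lin_ad p(1) p(2)[OF xp] b] by blast
      have wp: "w c \<in> p" for c using w(2) by (auto simp: geig_def)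
      have Yw: "ad Y (w c) = f c *\<^sub>m w c" for c
        unfolding Y_def using replica_eigen[OF sp f] w(2)[of c] unfolding geig_def by blast
      have Yw': "ad Y' (\<sigma> (w c)) = f c *\<^sub>m \<sigma> (w c)" for c
      proof -
        have iter: "(shift (ad x) c ^^ k) v \<in> p \<and> (shift (ad (\<sigma> x)) c ^^ k) (\<sigma> v) = \<sigma> ((shift (ad x) c ^^ k) v)"
          if "v \<in> p" for k v
        proof (induction k)
          case (Suc k)
          have "\<sigma> (- y) = - \<sigma> y" if "y \<in> p" for y using s(2)[OF that, of "-1"] by simp
          then have "\<sigma> (shift (ad x) c y) = shift (ad (\<sigma> x)) c (\<sigma> y)" if "y \<in> p" for y
            using s(1)[of "ad x y" "- (c *\<^sub>m y)"] that xp p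
            by (simp add: shift_def s M.subspace_scale M.subspace_neg)
          moreover have "shift (ad x) c y \<in> p" if "y \<in> p" for y
            using that xp p by (simp add: shift_def M.subspace_diff M.subspace_scale)
          ultimately show ?case using Suc by simp
        qed (simp add: that)
        obtain N where "(shift (ad x) c ^^ N) (w c) = 0" using w(2)[of c] by (auto simp: geig_def)
        then have "(shift (ad (\<sigma> x)) c ^^ N) (\<sigma> (w c)) = 0"
          using iter[OF wp[of c]] s0 by simp
        then show ?thesis unfolding Y'_def using replica_eigen[OF sp' f] by blast
      qed
      have "ad Y b = (\<Sum>c\<in>M. f c *\<^sub>m w c)"
        unfolding w(3) by (simp add: MM.linear_sum[OF lin_ad] Yw)
      moreover have "ad Y' (\<sigma> b) = \<sigma> (\<Sum>c\<in>M. f c *\<^sub>m w c)"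
        unfolding w(3) using wp M.subspace_scale[OF p(1)]
        by (simp add: MM.linear_sum[OF lin_ad] Yw' s_sum s)
      moreover have "(\<Sum>c\<in>M. f c *\<^sub>m w c) \<in> p"
        using wp by (intro M.subspace_sum p M.subspace_scale)
      ultimately show ?thesis by blast
    qed
    have "y \<in> p \<and> trace (y ** Y) + trace (\<sigma> y ** Y') = 0"
      if "y \<in> M.span {ad a b | a b. a \<in> p \<and> b \<in> p}" for y
      using that
    proof (induction rule: M.span_induct_alt)
      case (step d y z)
      then obtain a b where ab: "a \<in> p" "b \<in> p" "y = ad a b" by blast
      obtain b' where b': "b' \<in> p" "ad Y b = b'" "ad Y' (\<sigma> b) = \<sigma> b'" using rep[OF ab(2)] by blast
      have "trace (y ** Y) + trace (\<sigma> y ** Y') = trace (a ** ad b Y) + trace (\<sigma> a ** ad (\<sigma> b) Y')"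
        by (simp add: ab s trace_ad)
      also have "\<dots> = - (trace (a ** b') + trace (\<sigma> a ** \<sigma> b'))"
        unfolding ad_antisym[of b] ad_antisym[of "\<sigma> b"] b' by (simp add: mm_simps trace_neg)
      finally have y: "trace (y ** Y) + trace (\<sigma> y ** Y') = 0" using form[OF ab(1) b'(1)] by simp
      have "\<sigma> (d *\<^sub>m y + z) = d *\<^sub>m \<sigma> y + \<sigma> z"
        using s step ab p by (simp add: M.subspace_scale)
      then have "trace ((d *\<^sub>m y + z) ** Y) + trace (\<sigma> (d *\<^sub>m y + z) ** Y')
         = d * (trace (y ** Y) + trace (\<sigma> y ** Y')) + (trace (z ** Y) + trace (\<sigma> z ** Y'))"
        by (simp add: mm_simps trace_simps algebra_simps)
      then show ?case using y step ab p by (simp add: M.subspace_add M.subspace_scale)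
    qed (simp add: s0 mm_simps M.subspace_0[OF p(1)])
    from this[OF x] have 0: "trace (x ** Y) + trace (\<sigma> x ** Y') = 0" by blast
    define m m' where "m d = (SOME i. trace (P d) = of_nat i \<and> (i = 0 \<longrightarrow> P d = 0))"
      and "m' d = (SOME i. trace (P' d) = of_nat i \<and> (i = 0 \<longrightarrow> P' d = 0))" for d
    have m: "trace (P d) = of_nat (m d) \<and> (m d = 0 \<longrightarrow> P d = 0)" if "d \<in> L" for d
      unfolding m_def by (rule someI_ex[OF trace_idempotent[OF spectral_idem[OF sp that]]])
    have m': "trace (P' d) = of_nat (m' d)" if "d \<in> L'" for d
      using someI_ex[OF trace_idempotent[OF spectral_idem[OF sp' that]]] unfolding m'_def by blast
    have sumR: "v ** (\<Sum>c\<in>S. g c) = (\<Sum>c\<in>S. v ** g c)" for g :: "'k \<Rightarrow> 'k^'n^'n" and v :: "'k^'n^'n" and S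
      by (induction S rule: infinite_finite_induct) (simp_all add: mm_simps)
    have sumT: "trace (\<Sum>c\<in>S. g c) = (\<Sum>c\<in>S. trace (g c))" for g :: "'k \<Rightarrow> 'k^'n^'n" and S
      by (induction S rule: infinite_finite_induct) (simp_all add: trace_simps)
    have tr: "trace (x ** Y) = (\<Sum>d\<in>L. of_rat (\<phi> d * of_nat (m d)) * d)"
      unfolding Y_def sumR sumT by (intro sum.cong refl)
        (simp add: mm_simps trace_simps spectral_trace[OF sp] m f_def of_rat_mult)
    have tr': "trace (\<sigma> x ** Y') = (\<Sum>d\<in>L'. of_rat (\<phi> d * of_nat (m' d)) * d)"
      unfolding Y'_def sumR sumT by (intro sum.cong refl)
        (simp add: mm_simps trace_simps spectral_trace[OF sp'] m' f_def of_rat_mult)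
    \<comment> \<open>The traces are sums of rational multiples of eigenvalues \<open>d\<close>;
      applying \<open>\<phi>\<close> once more turns each remaining \<open>d\<close> into
      \<open>\<phi> d\<close> and produces the squares.\<close>
    have "\<phi> (trace (x ** Y) + trace (\<sigma> x ** Y')) = (\<Sum>d\<in>L. \<phi> d * \<phi> d * of_nat (m d)) + (\<Sum>d\<in>L'. \<phi> d * \<phi> d * of_nat (m' d))"
      unfolding tr tr' \<phi>(1) \<phi>sum by (simp only: \<phi>(2)) (simp add: mult_ac)
    then have "(\<Sum>d\<in>L. \<phi> d * \<phi> d * of_nat (m d)) + (\<Sum>d\<in>L'. \<phi> d * \<phi> d * of_nat (m' d)) = 0"
      using 0 \<phi>0 by simp
    moreover have "(\<Sum>d\<in>L'. \<phi> d * \<phi> d * of_nat (m' d)) \<ge> 0" "(\<Sum>d\<in>L. \<phi> d * \<phi> d * of_nat (m d)) \<ge> 0"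
      by (auto intro!: sum_nonneg)
    ultimately have "(\<Sum>d\<in>L. \<phi> d * \<phi> d * of_nat (m d)) = 0" by linarith
    then have "\<phi> c * \<phi> c * of_nat (m c) = 0"
      using cL spectral_finite[OF sp] by (subst (asm) sum_nonneg_eq_0_iff) auto
    then show False using \<phi>(3) m[OF cL] Pc by auto
  qed
  then show ?thesis by (rule spectral_nilp[OF sp])
qed

subsection \<open>Engel's theorem\<close>

definition lie_closed :: "('k::field^'n^'n) set \<Rightarrow> bool" where
  "lie_closed m \<longleftrightarrow> M.subspace m \<and> (\<forall>a\<in>m. \<forall>b\<in>m. ad a b \<in> m)"

lemma maximal_subalgebra:
  assumes "lie_closed m" "m \<noteq> {0}"
  shows "\<exists>m'. lie_closed m' \<and> m' \<subset> m \<and> (\<forall>m''. lie_closed m'' \<longrightarrow> m' \<subset> m'' \<longrightarrow> m'' \<subseteq> m \<longrightarrow> m'' = m)"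
proof -
  let ?Q = "\<lambda>m'. lie_closed m' \<and> m' \<subset> m"
  have "0 \<in> m" using assms M.subspace_0 by (auto simp: lie_closed_def)
  then have "?Q {0}" using assms by (auto simp: lie_closed_def ad_simps M.subspace_single_0)
  moreover have "\<forall>m'. ?Q m' \<longrightarrow> M.dim m' \<le> M.dim m" by (auto intro: M.dim_subset)
  ultimately obtain m' where m': "?Q m'" "\<And>m''. ?Q m'' \<Longrightarrow> M.dim m'' \<le> M.dim m'"
    using ex_has_greatest_nat[of ?Q "{0}" M.dim "Suc (M.dim m)"] by (auto simp: less_Suc_eq_le)
  have "m'' = m" if "lie_closed m''" "m' \<subset> m''" "m'' \<subseteq> m" for m''
  proof (rule ccontr)
    assume "m'' \<noteq> m"
    then have "M.dim m'' \<le> M.dim m'" using that m' by blast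
    moreover have "M.span m' \<subset> M.span m''" using that m' by (metis M.span_eq_iff lie_closed_def)
    ultimately show False using M.dim_psubset[of m' m''] by simp
  qed
  with m' show ?thesis by blast
qed

text \<open>A pair of stable subspaces \<open>W \<subset> V\<close> stands for the quotient module.
  This relative form feeds its own induction: applied to a maximal subalgebra \<open>m'\<close>
  inside \<open>m\<close> it gives \<open>y\<close> normalising \<open>m'\<close>, so that
  \<open>m = m' + k y\<close>; applied to \<open>W \<subset> V\<close> it gives vectors killed by
  \<open>m'\<close> modulo \<open>W\<close>, a space that \<open>y\<close> preserves.\<close>

lemma engel:
  fixes m :: "('k::field^'n^'n) set"
  shows "lie_closed m \<Longrightarrow> (\<forall>x\<in>m. nilp x) \<Longrightarrow> M.subspace W \<Longrightarrow> M.subspace V \<Longrightarrow>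
    (\<forall>x\<in>m. \<forall>v\<in>V. ad x v \<in> V) \<Longrightarrow> (\<forall>x\<in>m. \<forall>v\<in>W. ad x v \<in> W) \<Longrightarrow> W \<subset> V \<Longrightarrow>
    \<exists>y\<in>V - W. \<forall>x\<in>m. ad x y \<in> W"
proof (induction "M.dim m" arbitrary: m W V rule: less_induct)
  case (less m W V)
  note prems = less.prems
  show ?case
  proof (cases "m = {0}")
    case True
    then show ?thesis using prems M.subspace_0[OF prems(3)] by (auto simp: ad_simps)
  next
    case False
    obtain m' where m': "lie_closed m'" "m' \<subset> m"
      "\<And>m''. lie_closed m'' \<Longrightarrow> m' \<subset> m'' \<Longrightarrow> m'' \<subseteq> m \<Longrightarrow> m'' = m"
      using maximal_subalgebra[OF prems(1) False] by blast
    have sub: "M.subspace m" "M.subspace m'" using prems(1) m'(1) by (auto simp: lie_closed_def)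
    have dim: "M.dim m' < M.dim m"
      using M.dim_psubset[of m' m] m'(2) sub by (simp add: M.span_eq_iff[THEN iffD2])
    have nil: "\<forall>x\<in>m'. nilp x" using prems(2) m'(2) by auto
    have "\<exists>y\<in>m - m'. \<forall>x\<in>m'. ad x y \<in> m'"
    proof (rule less.hyps[OF dim m'(1) nil sub(2) sub(1)])
      show "\<forall>x\<in>m'. \<forall>v\<in>m. ad x v \<in> m" "\<forall>x\<in>m'. \<forall>v\<in>m'. ad x v \<in> m'"
        using m'(1,2) prems(1) unfolding lie_closed_def by blast+
    qed (rule m'(2))
    then obtain y where y: "y \<in> m" "y \<notin> m'" "\<And>x. x \<in> m' \<Longrightarrow> ad x y \<in> m'" by blast
    define m2 where "m2 = {a + c *\<^sub>m y | a c. a \<in> m'}"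
    have "lie_closed m2"
      unfolding lie_closed_def
    proof (intro conjI ballI M.subspaceI)
      show "0 \<in> m2" unfolding m2_def using M.subspace_0[OF sub(2)] by (force intro: exI[of _ 0])
    next
      fix u v assume "u \<in> m2" "v \<in> m2"
      then obtain a b c d where e: "u = a + c *\<^sub>m y" "v = b + d *\<^sub>m y" "a \<in> m'" "b \<in> m'"
        by (auto simp: m2_def)
      have "u + v = (a + b) + (c + d) *\<^sub>m y" using e by (simp add: msimps)
      then show "u + v \<in> m2" unfolding m2_def using e M.subspace_add[OF sub(2)] by blast
      have "ad y b \<in> m'" using y(3)[OF e(4)] ad_antisym[of y b] M.subspace_neg[OF sub(2)] by simp
      then have "ad u v \<in> m'" unfolding e using e(3,4) y(3) m'(1)
        by (simp add: ad_simps lie_closed_def M.subspace_add M.subspace_scale)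
      then show "ad u v \<in> m2" unfolding m2_def by (force intro: exI[of _ 0])
    next
      fix c u assume "u \<in> m2"
      then obtain a d where e: "u = a + d *\<^sub>m y" "a \<in> m'" by (auto simp: m2_def)
      have "c *\<^sub>m u = (c *\<^sub>m a) + (c * d) *\<^sub>m y" using e by (simp add: msimps)
      then show "c *\<^sub>m u \<in> m2" unfolding m2_def using e M.subspace_scale[OF sub(2)] by blast
    qed
    moreover have "m' \<subset> m2"
    proof
      show "m' \<subseteq> m2" unfolding m2_def by (force intro: exI[of _ 0])
      have "y \<in> m2" unfolding m2_def using M.subspace_0[OF sub(2)] by (force intro: exI[of _ 1])
      then show "m' \<noteq> m2" using y by blast
    qed
    moreover have "m2 \<subseteq> m" unfolding m2_def using m'(2) y(1) sub(1)
      by (auto intro!: M.subspace_add M.subspace_scale)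
    ultimately have m2: "m2 = m" using m'(3) by blast
    define V' where "V' = {v \<in> V. \<forall>x\<in>m'. ad x v \<in> W}"
    have "\<exists>v\<in>V - W. \<forall>x\<in>m'. ad x v \<in> W"
      using less.hyps[OF dim m'(1) nil prems(3,4)] prems(5-7) m'(2) by blast
    then obtain v where v: "v \<in> V'" "v \<notin> W" by (auto simp: V'_def)
    have stab: "ad y u \<in> V'" if u: "u \<in> V'" for u
      unfolding V'_def
    proof safe
      show "ad y u \<in> V" using u y(1) prems(5) by (auto simp: V'_def)
      fix x assume x: "x \<in> m'"
      have "ad x (ad y u) = ad (ad x y) u + ad y (ad x u)" by (rule jacobi)
      then show "ad x (ad y u) \<in> W"
        using u x y prems(3,6) by (auto simp: V'_def intro!: M.subspace_add)
    qed
    obtain k where k: "(ad y ^^ k) v = 0" using nilp_ad[of y] prems(2) y(1) by blast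
    \<comment> \<open>The last iterate of \<open>ad y\<close> on \<open>v\<close> outside
      \<open>W\<close> is killed by \<open>y\<close> modulo \<open>W\<close>, and still by
      \<open>m'\<close>.\<close>
    define j where "j = (LEAST j. (ad y ^^ j) v \<in> W)"
    have j: "(ad y ^^ j) v \<in> W"
      unfolding j_def by (rule LeastI[of _ k]) (simp add: k M.subspace_0[OF prems(3)])
    have "j \<noteq> 0" using j v by (cases j) auto
    then obtain i where i: "j = Suc i" by (cases j) auto
    define u where "u = (ad y ^^ i) v"
    have uW: "u \<notin> W" unfolding u_def using i not_less_Least[of i "\<lambda>j. (ad y ^^ j) v \<in> W"] by (simp add: j_def)
    have uV': "u \<in> V'" unfolding u_def using v(1) stab by (intro funpow_in) auto
    have yu: "ad y u \<in> W" using j by (simp add: i u_def)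
    have "ad x u \<in> W" if "x \<in> m" for x
    proof -
      have "x \<in> m2" using that m2 by simp
      then obtain a c where "x = a + c *\<^sub>m y" "a \<in> m'" unfolding m2_def by blast
      then show ?thesis using uV' yu prems(3)
        by (auto simp: ad_simps V'_def intro!: M.subspace_add M.subspace_scale)
    qed
    then show ?thesis using uW uV' by (auto simp: V'_def)
  qed
qed


subsection \<open>Solvable ideals\<close>

definition brk :: "('k::field^'n^'n) set \<Rightarrow> ('k^'n^'n) set \<Rightarrow> ('k^'n^'n) set" where
  "brk S T = M.span {ad a b | a b. a \<in> S \<and> b \<in> T}"

lemma subspace_brk: "M.subspace (brk S T)"
  by (simp add: brk_def)

lemma brk_in: "a \<in> S \<Longrightarrow> b \<in> T \<Longrightarrow> ad a b \<in> brk S T"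
  unfolding brk_def by (rule M.span_base) blast

lemma brk_least: "M.subspace p \<Longrightarrow> (\<And>a b. a \<in> S \<Longrightarrow> b \<in> T \<Longrightarrow> ad a b \<in> p) \<Longrightarrow> brk S T \<subseteq> p"
  unfolding brk_def by (rule M.span_minimal) auto

lemma brk_mono: "S \<subseteq> S' \<Longrightarrow> T \<subseteq> T' \<Longrightarrow> brk S T \<subseteq> brk S' T'"
  by (rule brk_least[OF subspace_brk]) (auto intro: brk_in)

text \<open>Engel's theorem against a maximal proper ideal \<open>W\<close> gives \<open>y\<close>
  outside \<open>W\<close> with \<open>[p, y]\<close> inside \<open>W\<close>. Then
  \<open>W + k y\<close> is an ideal, hence all of \<open>p\<close>, and \<open>[p, p]\<close> falls
  into \<open>W\<close>.\<close>

lemma perfect_nil: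
  fixes p :: "('k::field^'n^'n) set"
  assumes p: "lie_closed p" "\<forall>x\<in>p. nilp x" "p \<subseteq> brk p p"
  shows "p = {0}"
proof (rule ccontr)
  assume "p \<noteq> {0}"
  have sp: "M.subspace p" using p(1) by (simp add: lie_closed_def)
  let ?Q = "\<lambda>W. M.subspace W \<and> W \<subset> p \<and> (\<forall>a\<in>p. \<forall>b\<in>W. ad a b \<in> W)"
  have "?Q {0}" using \<open>p \<noteq> {0}\<close> M.subspace_0[OF sp] by (auto simp: M.subspace_single_0 ad_simps)
  moreover have "\<forall>W. ?Q W \<longrightarrow> M.dim W \<le> M.dim p" by (auto intro: M.dim_subset)
  ultimately obtain W where W: "?Q W" "\<And>W'. ?Q W' \<Longrightarrow> M.dim W' \<le> M.dim W"
    using ex_has_greatest_nat[of ?Q "{0}" M.dim "Suc (M.dim p)"] by (auto simp: less_Suc_eq_le)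
  then have sW: "M.subspace W" by blast
  have "\<exists>y\<in>p - W. \<forall>x\<in>p. ad x y \<in> W"
  proof (rule engel[OF p(1,2) sW sp])
    show "\<forall>x\<in>p. \<forall>v\<in>p. ad x v \<in> p" using p(1) by (simp add: lie_closed_def)
  qed (use W(1) in simp_all)
  then obtain y where y: "y \<in> p" "y \<notin> W" "\<And>x. x \<in> p \<Longrightarrow> ad x y \<in> W" by blast
  let ?W' = "M.span (insert y W)"
  have W'p: "?W' \<subseteq> p" using W(1) y(1) sp by (intro M.span_minimal) auto
  have st: "ad a b \<in> W" if ap: "a \<in> p" and bW: "b \<in> ?W'" for a b
  proof -
    obtain k where k: "b - k *\<^sub>m y \<in> W" using bW unfolding M.span_insert M.span_eq_iff[THEN iffD2, OF sW] by blast
    have "ad a b = ad a (b - k *\<^sub>m y) + k *\<^sub>m ad a y" by (simp add: ad_simps)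
    moreover have "ad a (b - k *\<^sub>m y) \<in> W" using W(1) k ap by blast
    ultimately show ?thesis using y(3)[OF ap] sW by (simp add: M.subspace_add M.subspace_scale)
  qed
  have WW': "W \<subseteq> ?W'" by (meson M.span_superset insert_subset order_trans subset_insertI)
  have "?W' = p"
  proof (rule ccontr)
    assume "?W' \<noteq> p"
    then have "?Q ?W'" using W'p st WW' by auto
    then have "M.dim ?W' \<le> M.dim W" by (rule W(2))
    moreover have "M.dim ?W' = Suc (M.dim W)"
      unfolding M.dim_span M.dim_insert M.span_eq_iff[THEN iffD2, OF sW] using y(2) by simp
    ultimately show False by simp
  qed
  then have "brk p p \<subseteq> W" using st by (intro brk_least sW) auto
  then show False using p(3) W(1) by auto
qed

primrec derived :: "('k::field^'n^'n) set \<Rightarrow> nat \<Rightarrow> ('k^'n^'n) set" where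
  "derived r 0 = r"
| "derived r (Suc k) = brk (derived r k) (derived r k)"

lemma lie_closed_derived:
  assumes "lie_closed r"
  shows "lie_closed (derived r k)" "derived r (Suc k) \<subseteq> derived r k"
proof -
  have *: "lie_closed (derived r k) \<and> derived r (Suc k) \<subseteq> derived r k"
  proof (induction k)
    case 0
    show ?case using assms brk_least[of r r r] by (auto simp: lie_closed_def)
  next
    case (Suc k)
    then have "lie_closed (derived r (Suc k))"
      unfolding lie_closed_def derived.simps by (meson brk_in subsetD subspace_brk)
    moreover have "derived r (Suc (Suc k)) \<subseteq> derived r (Suc k)"
      using brk_mono[OF conjunct2[OF Suc] conjunct2[OF Suc]] by simp
    ultimately show ?case by blast
  qed
  then show "lie_closed (derived r k)" "derived r (Suc k) \<subseteq> derived r k" by auto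
qed

text \<open>A term of least dimension in the derived series is perfect; the criterion makes it
  consist of nilpotents, so it vanishes by \<open>perfect_nil\<close>.\<close>

lemma cartan_solvable:
  fixes r :: "('k::{alg_closed_field, field_char_0}^'n^'n) set" and \<sigma> :: "'k^'n^'n \<Rightarrow> 'k^'n^'n"
  assumes r: "lie_closed r"
    and s: "\<And>a b. a \<in> r \<Longrightarrow> b \<in> r \<Longrightarrow> \<sigma> (a + b) = \<sigma> a + \<sigma> b"
      "\<And>c a. a \<in> r \<Longrightarrow> \<sigma> (c *\<^sub>m a) = c *\<^sub>m \<sigma> a"
      "\<And>a b. a \<in> r \<Longrightarrow> b \<in> r \<Longrightarrow> \<sigma> (ad a b) = ad (\<sigma> a) (\<sigma> b)"
    and form: "\<And>a b. a \<in> r \<Longrightarrow> b \<in> r \<Longrightarrow> trace (a ** b) + trace (\<sigma> a ** \<sigma> b) = 0"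
  shows "\<exists>k. derived r k = {0}"
proof -
  obtain k where k: "\<And>j. M.dim (derived r k) \<le> M.dim (derived r j)"
    using ex_has_least_nat[of "\<lambda>_. True" 0 "\<lambda>k. M.dim (derived r k)"] by blast
  let ?p = "derived r k"
  have p: "lie_closed ?p" "lie_closed (derived r (Suc k))" "derived r (Suc k) \<subseteq> ?p"
    using lie_closed_derived[OF r] by blast+
  then have e: "derived r (Suc k) = ?p"
    using k[of "Suc k"] by (intro M.subspace_dim_equal) (auto simp: lie_closed_def)
  have pr: "?p \<subseteq> r"
  proof -
    have "derived r j \<subseteq> r" for j
      by (induction j) (use lie_closed_derived(2)[OF r] in auto)
    then show ?thesis .
  qed
  have "nilp x" if "x \<in> ?p" for x
  proof (rule cartan_nilp[where p = ?p and \<sigma> = \<sigma>])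
    show "x \<in> M.span {ad a b | a b. a \<in> ?p \<and> b \<in> ?p}" using that e by (auto simp: brk_def)
    show "M.subspace ?p" "\<And>a b. a \<in> ?p \<Longrightarrow> b \<in> ?p \<Longrightarrow> ad a b \<in> ?p"
      using p(1) unfolding lie_closed_def by blast+
  qed (use subsetD[OF pr] in \<open>blast intro: s form\<close>)+
  then have "?p = {0}" using perfect_nil[OF p(1)] e by auto
  then show ?thesis by blast
qed

declare M.dim_UNIV [simp del]

section \<open>Algebraic groups\<close>

subsection \<open>Exponentials of nilpotent matrices\<close>

text \<open>The right ideals of the powers shrink strictly until they vanish. A bound independent of
  \<open>A\<close> turns nilpotency into a polynomial condition and lets exponential and logarithm
  be fixed finite sums.\<close>

lemma nilp_bound:
  fixes A :: "'k::field^'n^'n"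
  assumes "nilp A"
  shows "mpow A (M.dim (UNIV :: ('k^'n^'n) set)) = 0"
proof (rule ccontr)
  let ?d = "M.dim (UNIV :: ('k^'n^'n) set)"
  assume nz: "mpow A ?d \<noteq> 0"
  obtain k where k: "mpow A k = 0" using assms by (auto simp: nilp_def)
  have "M.dim (right_ideal (mpow A i)) + i \<le> ?d" if "i \<le> ?d" for i
    using that
  proof (induction i)
    case 0
    show ?case by (simp add: M.dim_subset)
  next
    case (Suc i)
    have "mpow A i \<notin> right_ideal (mpow A (Suc i))"
    proof
      assume "mpow A i \<in> right_ideal (mpow A (Suc i))"
      then obtain X where X: "mpow A i = mpow A (Suc i) ** X" by (auto simp: right_ideal_def)
      have "mpow A i = mpow A m ** mpow A i ** mpow X m" for m
      proof (induction m)
        case (Suc m)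
        have "mpow A m ** mpow A i ** mpow X m = mpow A m ** (A ** mpow A i ** X) ** mpow X m"
          using X by (simp add: mpow_Suc)
        also have "\<dots> = mpow A (Suc m) ** mpow A i ** mpow X (Suc m)"
          by (simp only: mpow_Suc2[of A m] mpow_Suc[of X m] matrix_mul_assoc)
        finally show ?case using Suc by simp
      qed simp
      from this[of k] have "mpow A i = 0" using k by (simp add: mm_simps)
      then show False using nz mpow_zero_ge Suc.prems by (metis Suc_leD)
    qed
    then have "M.dim (right_ideal (mpow A (Suc i))) < M.dim (right_ideal (mpow A i))"
      by (rule dim_right_ideal_less[OF mpow_Suc2])
    with Suc show ?case by simp
  qed
  from this[of ?d] have "M.dim (right_ideal (mpow A ?d)) = 0" by simp
  then have "right_ideal (mpow A ?d) \<subseteq> {0}" by simp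
  then show False using right_ideal_self[of "mpow A ?d"] nz by auto
qed

text \<open>A formal power series evaluated at a matrix, truncated at the universal nilpotency
  bound. On nilpotent \<open>y\<close> the truncation loses nothing and evaluation respects products
  and composition, so identities of power series transfer to matrices.\<close>

definition ev :: "'k::field fps \<Rightarrow> 'k^'n^'n \<Rightarrow> 'k^'n^'n" where
  "ev F y = (\<Sum>i<M.dim (UNIV :: ('k^'n^'n) set). fps_nth F i *\<^sub>m mpow y i)"

lemma mult_sum_left: "(\<Sum>i\<in>S. (g i :: 'k::field^'n^'n)) ** v = (\<Sum>i\<in>S. g i ** (v :: 'k^'n^'n))"
  by (induction S rule: infinite_finite_induct) (simp_all add: mm_simps)

lemma mult_sum_right: "v ** (\<Sum>i\<in>S. (g i :: 'k::field^'n^'n)) = (\<Sum>i\<in>S. (v :: 'k^'n^'n) ** g i)"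
  by (induction S rule: infinite_finite_induct) (simp_all add: mm_simps)

lemma sum_square_triangle:
  fixes g :: "nat \<Rightarrow> nat \<Rightarrow> 'a::comm_monoid_add"
  assumes "\<And>i j. i \<ge> d \<Longrightarrow> g i j = 0" "\<And>i j. j \<ge> d \<Longrightarrow> g i j = 0"
    and "\<And>i j. i + j \<ge> m \<Longrightarrow> g i j = 0"
  shows "(\<Sum>i<d. \<Sum>j<d. g i j) = (\<Sum>k<m. \<Sum>i\<le>k. g i (k - i))"
proof -
  let ?T = "{(i, j). i + j < m}"
  have fin: "finite ?T" by (rule finite_subset[of _ "{..<m} \<times> {..<m}"]) auto
  have "(\<Sum>i<d. \<Sum>j<d. g i j) = (\<Sum>(i, j)\<in>{..<d} \<times> {..<d}. g i j)"
    by (simp add: sum.cartesian_product)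
  also have "\<dots> = (\<Sum>(i, j)\<in>?T. g i j)"
  proof (rule sum.mono_neutral_cong)
    show "(case p of (i, j) \<Rightarrow> g i j) = 0" if "p \<in> {..<d} \<times> {..<d} - ?T" for p
      using that assms(3) by auto
    show "(case p of (i, j) \<Rightarrow> g i j) = 0" if pT: "p \<in> ?T - {..<d} \<times> {..<d}" for p
    proof -
      obtain i j where "p = (i, j)" "i \<ge> d \<or> j \<ge> d" using pT by (cases p) auto
      then show ?thesis using assms(1)[of i j] assms(2)[of j i] by auto
    qed
  qed (use fin in auto)
  also have "\<dots> = (\<Sum>k<m. \<Sum>i\<le>k. g i (k - i))" by (rule sum.triangle_reindex)
  finally show ?thesis .
qed

lemma ev_mult:
  assumes "nilp y" shows "ev (F * G) y = ev F y ** ev G y"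
proof -
  let ?d = "M.dim (UNIV :: ('a^'b^'b) set)"
  have z: "mpow y i = 0" if "i \<ge> ?d" for i using mpow_zero_ge[OF nilp_bound[OF assms] that] .
  have "ev F y ** ev G y = (\<Sum>i<?d. \<Sum>j<?d. (fps_nth F i * fps_nth G j) *\<^sub>m mpow y (i + j))"
    by (simp only: ev_def mult_sum_left) (simp add: mult_sum_right mm_simps mpow_add mult.commute)
  also have "\<dots> = (\<Sum>i<?d. \<Sum>j<?d. if i + j < ?d then (fps_nth F i * fps_nth G j) *\<^sub>m mpow y (i + j) else 0)"
    by (intro sum.cong refl) (auto simp: z)
  also have "\<dots> = (\<Sum>k<?d. \<Sum>i\<le>k. if i + (k - i) < ?d then
      (fps_nth F i * fps_nth G (k - i)) *\<^sub>m mpow y (i + (k - i)) else 0)"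
    by (rule sum_square_triangle) auto
  also have "\<dots> = ev (F * G) y"
    unfolding ev_def fps_mult_nth M.scale_sum_left
    by (intro sum.cong) (auto simp: atLeast0AtMost)
  finally show ?thesis ..
qed

lemma ev_1:
  fixes y :: "'k::field^'n^'n"
  shows "ev 1 y = mat 1"
proof -
  have "M.dim (UNIV :: ('k^'n^'n) set) \<noteq> 0"
  proof
    assume "M.dim (UNIV :: ('k^'n^'n) set) = 0"
    then have "(mat 1 :: 'k^'n^'n) = 0" using M.dim_eq_0 by blast
    then have "(mat 1 :: 'k^'n^'n) $ i $ i = 0" for i by simp
    then show False by (simp add: mat_def)
  qed
  then obtain d where d: "M.dim (UNIV :: ('k^'n^'n) set) = Suc d" by (cases "M.dim (UNIV :: ('k^'n^'n) set)") auto
  have "ev 1 y = (\<Sum>i<Suc d. if i = 0 then mat 1 else 0)"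
    unfolding ev_def d by (intro sum.cong) auto
  then show ?thesis by simp
qed

lemma ev_power: "nilp y \<Longrightarrow> ev (F ^ k) y = mpow (ev F y) k"
  by (induction k) (simp_all add: ev_1 ev_mult mpow_Suc)

lemma ev_nilp:
  assumes y: "nilp y" and F: "fps_nth F 0 = 0"
  shows "nilp (ev F y)"
proof -
  let ?d = "M.dim (UNIV :: ('a^'b^'b) set)"
  have "fps_nth (F ^ ?d) i = 0" if "i < ?d" for i using startsby_zero_power_prefix[OF F] that by blast
  then have "ev (F ^ ?d) y = 0" unfolding ev_def by simp
  then show ?thesis unfolding ev_power[OF y] nilp_def by blast
qed

lemma ev_compose:
  assumes y: "nilp y" and G: "fps_nth G 0 = 0"
  shows "ev (fps_compose F G) y = ev F (ev G y)"
proof -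
  let ?d = "M.dim (UNIV :: ('a^'b^'b) set)"
  have z: "fps_nth (G ^ i) m = 0" if "m < i" for i m using startsby_zero_power_prefix[OF G] that by blast
  have "ev (fps_compose F G) y = (\<Sum>m<?d. \<Sum>i<?d. (fps_nth F i * fps_nth (G ^ i) m) *\<^sub>m mpow y m)"
    unfolding ev_def fps_compose_nth M.scale_sum_left
    by (intro sum.cong refl sum.mono_neutral_left) (auto simp: z)
  also have "\<dots> = (\<Sum>i<?d. \<Sum>m<?d. (fps_nth F i * fps_nth (G ^ i) m) *\<^sub>m mpow y m)" by (rule sum.swap)
  also have "\<dots> = (\<Sum>i<?d. fps_nth F i *\<^sub>m ev (G ^ i) y)"
    by (simp add: ev_def M.scale_sum_right)
  finally show ?thesis by (simp add: ev_def[of F] ev_power[OF y])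
qed

lemma ev_X:
  assumes "nilp y" shows "ev fps_X y = y"
proof -
  let ?d = "M.dim (UNIV :: ('a^'b^'b) set)"
  have "ev fps_X y = (\<Sum>i<?d. if i = 1 then mpow y i else 0)"
    unfolding ev_def by (intro sum.cong) (auto simp: fps_X_def)
  also have "\<dots> = (if 1 < ?d then y else 0)" by simp
  also have "\<dots> = y" using mpow_zero_ge[OF nilp_bound[OF assms], of 1] by auto
  finally show ?thesis .
qed

definition mexp :: "'k::field_char_0^'n^'n \<Rightarrow> 'k^'n^'n" where
  "mexp = ev (fps_exp 1)"

text \<open>The compositional inverse of \<open>exp X - 1\<close> is the series of
  \<open>log (1 + X)\<close>; in this form both inversion laws come from composition of power
  series.\<close>

definition mlog1 :: "'k::field_char_0^'n^'n \<Rightarrow> 'k^'n^'n" where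
  "mlog1 = ev (fps_inv (fps_exp 1 - 1))"

lemma ev_diff: "ev (F - G) y = ev F y - ev G y"
  by (simp add: ev_def msimps sum_subtractf)

lemma mexp_minus_1: "mexp x - mat 1 = ev (fps_exp 1 - 1) x"
  by (simp add: mexp_def ev_diff ev_1)

lemma mlog1_mexp: "nilp x \<Longrightarrow> mlog1 (mexp x - mat 1) = x"
  unfolding mexp_minus_1 mlog1_def
  by (subst ev_compose[symmetric]) (simp_all add: fps_inv ev_X)

lemma mexp_mlog1:
  assumes "nilp y" shows "mexp (mlog1 y) = mat 1 + y"
proof -
  have "mexp (mlog1 y) - mat 1 = ev (fps_compose (fps_exp 1 - 1) (fps_inv (fps_exp 1 - 1))) y"
    unfolding mexp_minus_1 mlog1_def
    by (subst ev_compose) (simp_all add: assms fps_inv_def)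
  also have "\<dots> = y" by (subst fps_inv_right) (simp_all add: ev_X assms)
  finally show ?thesis by (simp add: algebra_simps)
qed

lemma nilp_mexp: "nilp x \<Longrightarrow> nilp (mexp x - mat 1)"
  unfolding mexp_minus_1 by (rule ev_nilp) simp_all

lemma mexp_0 [simp]: "mexp 0 = mat 1"
proof -
  have "mlog1 (0 :: 'a^'b^'b) = 0"
  proof -
    have "mpow (0 :: 'a^'b^'b) i = (if i = 0 then mat 1 else 0)" for i
      by (cases i) (simp_all add: mpow_Suc mm_simps)
    then show ?thesis unfolding mlog1_def ev_def by (intro sum.neutral) (simp add: fps_inv_def)
  qed
  then show ?thesis using mexp_mlog1[of "0 :: 'a^'b^'b"] by simp
qed

text \<open>Divided powers, for which the binomial theorem has no coefficients.\<close>

definition divpow :: "'k::field_char_0^'n^'n \<Rightarrow> nat \<Rightarrow> 'k^'n^'n" where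
  "divpow x i = inverse (of_nat (fact i)) *\<^sub>m mpow x i"

lemma divpow_Suc: "x ** divpow x i = of_nat (Suc i) *\<^sub>m divpow x (Suc i)"
proof -
  have "(of_nat (Suc i) :: 'a) * inverse (of_nat (fact (Suc i))) = inverse (of_nat (fact i))"
    using of_nat_neq_0[of i, where 'a = 'a] by (simp only: fact_Suc of_nat_mult of_nat_id) (simp add: field_simps del: of_nat_Suc)
  then show ?thesis by (simp add: divpow_def mm_simps mpow_Suc del: of_nat_Suc fact_Suc)
qed

lemma divpow_add:
  fixes x y :: "'k::field_char_0^'n^'n"
  assumes xy: "x ** y = y ** x"
  shows "divpow (x + y) m = (\<Sum>i\<le>m. divpow x i ** divpow y (m - i))"
proof (induction m)
  case (Suc m)
  have cy: "y ** divpow x i = divpow x i ** y" for i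
    by (simp add: divpow_def mm_simps mpow_comm_gen[OF xy])
  let ?g = "\<lambda>i. divpow x i ** divpow y (Suc m - i)"
  have "of_nat (Suc m) *\<^sub>m divpow (x + y) (Suc m) = (x + y) ** divpow (x + y) m"
    by (rule divpow_Suc[symmetric])
  also have "\<dots> = (\<Sum>i\<le>m. x ** divpow x i ** divpow y (m - i)) + (\<Sum>i\<le>m. divpow x i ** (y ** divpow y (m - i)))"
    by (simp only: Suc mm_simps mult_sum_right matrix_mul_assoc cy sum.distrib)
  also have "(\<Sum>i\<le>m. x ** divpow x i ** divpow y (m - i)) = (\<Sum>i\<le>m. of_nat (Suc i) *\<^sub>m ?g (Suc i))"
    by (simp add: divpow_Suc mm_simps del: of_nat_Suc)
  also have "\<dots> = (\<Sum>i\<le>Suc m. of_nat i *\<^sub>m ?g i)"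
    unfolding sum.atMost_Suc_shift by simp
  also have "(\<Sum>i\<le>m. divpow x i ** (y ** divpow y (m - i))) = (\<Sum>i\<le>m. of_nat (Suc m - i) *\<^sub>m ?g i)"
    by (intro sum.cong refl) (simp add: divpow_Suc mm_simps Suc_diff_le del: of_nat_Suc)
  also have "\<dots> = (\<Sum>i\<le>Suc m. of_nat (Suc m - i) *\<^sub>m ?g i)" by simp
  also have "(\<Sum>i\<le>Suc m. of_nat i *\<^sub>m ?g i) + \<dots> = (\<Sum>i\<le>Suc m. of_nat (Suc m) *\<^sub>m ?g i)"
    unfolding sum.distrib[symmetric] M.scale_left_distrib[symmetric] of_nat_add[symmetric]
    by (intro sum.cong refl) simp
  also have "\<dots> = of_nat (Suc m) *\<^sub>m (\<Sum>i\<le>Suc m. ?g i)" by (simp only: M.scale_sum_right)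
  finally show ?case by (simp del: of_nat_Suc sum.atMost_Suc)
qed (simp add: divpow_def)

lemma mexp_divpow: "mexp (x :: 'k::field_char_0^'n^'n) = (\<Sum>i<M.dim (UNIV :: ('k^'n^'n) set). divpow x i)"
  by (simp add: mexp_def ev_def divpow_def inverse_eq_divide)

lemma mexp_add:
  fixes x y :: "'k::field_char_0^'n^'n"
  assumes "nilp x" "nilp y" and xy: "x ** y = y ** x"
  shows "mexp (x + y) = mexp x ** mexp y"
proof -
  let ?d = "M.dim (UNIV :: ('k^'n^'n) set)"
  have z: "divpow u i = 0" if "nilp u" "i \<ge> ?d" for u :: "'k^'n^'n" and i
    using mpow_zero_ge[OF nilp_bound[OF that(1)] that(2)] by (simp add: divpow_def)
  have "mexp x ** mexp y = (\<Sum>i<?d. \<Sum>j<?d. divpow x i ** divpow y j)"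
    by (simp only: mexp_divpow mult_sum_left) (simp only: mult_sum_right)
  \<comment> \<open>The range is \<open>2 * ?d\<close> because single products may survive in total
    degrees from \<open>?d\<close> on; only their sum over a fixed degree, a divided power of
    \<open>x + y\<close>, vanishes there.\<close>
  also have "\<dots> = (\<Sum>k<2*?d. \<Sum>i\<le>k. divpow x i ** divpow y (k - i))"
  proof (rule sum_square_triangle)
    fix i j assume "2 * ?d \<le> i + j"
    then have "i \<ge> ?d \<or> j \<ge> ?d" by arith
    then show "divpow x i ** divpow y j = 0" using z assms by (auto simp: mm_simps)
  qed (auto simp: z assms mm_simps)
  also have "\<dots> = (\<Sum>k<2*?d. divpow (x + y) k)" by (simp add: divpow_add[OF xy])
  also have "\<dots> = (\<Sum>k<?d. divpow (x + y) k)"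
    by (rule sum.mono_neutral_right) (auto intro!: z nilp_add assms)
  finally show ?thesis by (simp add: mexp_divpow)
qed

lemma mexp_inverse:
  assumes "nilp x" shows "mexp x ** mexp (- x) = mat 1" "mexp (- x) ** mexp x = mat 1"
  using mexp_add[OF assms nilp_minus[OF assms]] mexp_add[OF nilp_minus[OF assms] assms]
  by (simp_all add: mm_simps)

lemma matrix_inv_mult:
  assumes "invertible (A :: 'k::field^'n^'n)"
  shows "A ** matrix_inv A = mat 1" "matrix_inv A ** A = mat 1"
proof -
  have "\<exists>B. A ** B = mat 1 \<and> B ** A = mat 1" using assms by (simp add: invertible_def)
  from someI_ex[OF this] show "A ** matrix_inv A = mat 1" "matrix_inv A ** A = mat 1"
    by (simp_all add: matrix_inv_def)
qed

lemma matrix_inv_eq: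
  fixes A B :: "'k::field^'n^'n"
  assumes "A ** B = mat 1" "B ** A = mat 1"
  shows "matrix_inv A = B"
proof -
  have "invertible A" using assms by (auto simp: invertible_def)
  then have "A ** matrix_inv A = mat 1" by (simp add: matrix_inv_mult)
  then have "B ** A ** matrix_inv A = B" by (simp add: matrix_mul_assoc[symmetric])
  then show ?thesis using assms by simp
qed

subsection \<open>Polynomial functions\<close>

lemma poly_funs_sum: "(\<And>i. i \<in> S \<Longrightarrow> f i \<in> poly_funs s) \<Longrightarrow> (\<lambda>x. \<Sum>i\<in>S. f i x) \<in> poly_funs s"
  by (induction S rule: infinite_finite_induct) (auto intro: poly_funs.intros)

lemma poly_funs_scale: "f \<in> poly_funs s \<Longrightarrow> (\<lambda>x. c * f x) \<in> poly_funs s"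
  using poly_funs.mult[OF poly_funs.const] by blast

lemma poly_funs_diff: "f \<in> poly_funs s \<Longrightarrow> g \<in> poly_funs s \<Longrightarrow> (\<lambda>x. f x - g x) \<in> poly_funs s"
  using poly_funs.add[OF _ poly_funs_scale[of g s "-1"], of f] by simp

lemma linf_entry: "linf (\<lambda>A. A $ i $ j)"
  by (rule linfI) (simp_all add: mscale_def)

lemma linf_expand: "linf f \<Longrightarrow> f A = (\<Sum>p\<in>UNIV. A $ fst p $ snd p * f (munit p))"
proof -
  assume f: "linf f"
  have "A = (\<Sum>p\<in>UNIV. mscale (A $ fst p $ snd p) (munit p))"
    using munit_sum[of "\<lambda>p. A $ fst p $ snd p"] by (simp add: vec_eq_iff)
  then have "f A = f (\<Sum>p\<in>UNIV. mscale (A $ fst p $ snd p) (munit p))" by simp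
  also have "\<dots> = (\<Sum>p\<in>UNIV. A $ fst p $ snd p * f (munit p))"
    by (simp add: MK.linear_sum[OF f] MK.linear_scale[OF f])
  finally show ?thesis .
qed

lemma poly_funs_precompose:
  assumes "f \<in> poly_funs mscale" "lin T"
  shows "(\<lambda>A. f (T A)) \<in> poly_funs mscale"
  using assms(1)
proof induction
  case (lin f)
  have "linf (\<lambda>A. f (T A))"
    by (rule linfI) (simp_all add: MM.linear_add[OF assms(2)] MM.linear_scale[OF assms(2)]
        MK.linear_add[OF lin] MK.linear_scale[OF lin])
  then show ?case by (rule poly_funs.lin)
qed (auto intro: poly_funs.intros)

section \<open>Polynomial dependence on one parameter\<close>

definition pfun :: "('k::field \<Rightarrow> 'k) \<Rightarrow> bool" where
  "pfun F \<longleftrightarrow> (\<exists>p. \<forall>t. F t = poly p t)"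

lemma pfun_const: "pfun (\<lambda>t. c)"
  unfolding pfun_def by (rule exI[of _ "[:c:]"]) simp

lemma pfun_id: "pfun (\<lambda>t. t)"
  unfolding pfun_def by (rule exI[of _ "[:0, 1:]"]) simp

lemma pfun_add: "pfun F \<Longrightarrow> pfun H \<Longrightarrow> pfun (\<lambda>t. F t + H t)"
  unfolding pfun_def by (metis poly_add)

lemma pfun_mult: "pfun F \<Longrightarrow> pfun H \<Longrightarrow> pfun (\<lambda>t. F t * H t)"
  unfolding pfun_def by (metis poly_mult)

lemma pfun_diff: "pfun F \<Longrightarrow> pfun H \<Longrightarrow> pfun (\<lambda>t. F t - H t)"
  unfolding pfun_def by (metis poly_diff)

lemma pfun_sum: "(\<And>i. i \<in> S \<Longrightarrow> pfun (F i)) \<Longrightarrow> pfun (\<lambda>t. \<Sum>i\<in>S. F i t)"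
  by (induction S rule: infinite_finite_induct) (auto intro: pfun_const pfun_add)

definition mpfun :: "('k::field \<Rightarrow> 'k^'n^'n) \<Rightarrow> bool" where
  "mpfun F \<longleftrightarrow> (\<forall>i j. pfun (\<lambda>t. F t $ i $ j))"

lemma mpfun_const: "mpfun (\<lambda>t. c)"
  by (simp add: mpfun_def pfun_const)

lemma mpfun_add: "mpfun F \<Longrightarrow> mpfun H \<Longrightarrow> mpfun (\<lambda>t. F t + H t)"
  by (simp add: mpfun_def pfun_add)

lemma mpfun_scale: "pfun c \<Longrightarrow> mpfun F \<Longrightarrow> mpfun (\<lambda>t. c t *\<^sub>m F t)"
  by (simp add: mpfun_def mscale_def pfun_mult)

lemma mpfun_mult: "mpfun F \<Longrightarrow> mpfun H \<Longrightarrow> mpfun (\<lambda>t. F t ** H t)"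
  by (simp add: mpfun_def matrix_matrix_mult_def pfun_mult pfun_sum)

lemma mpfun_pow: "mpfun F \<Longrightarrow> mpfun (\<lambda>t. mpow (F t) k)"
  by (induction k) (simp_all add: mpfun_const mpow_Suc mpfun_mult)

lemma mpfun_sum: "(\<And>i. i \<in> S \<Longrightarrow> mpfun (F i)) \<Longrightarrow> mpfun (\<lambda>t. \<Sum>i\<in>S. F i t)"
  by (induction S rule: infinite_finite_induct) (auto intro: mpfun_const mpfun_add)

lemma pfun_trace: "mpfun F \<Longrightarrow> pfun (\<lambda>t. trace (F t))"
  unfolding trace_def by (rule pfun_sum) (simp add: mpfun_def)

lemma pfun_linf: "linf f \<Longrightarrow> mpfun F \<Longrightarrow> pfun (\<lambda>t. f (F t))"
  by (subst linf_expand, assumption) (auto simp: mpfun_def intro!: pfun_sum pfun_mult pfun_const)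

lemma pfun_poly_funs: "f \<in> poly_funs mscale \<Longrightarrow> mpfun F \<Longrightarrow> pfun (\<lambda>t. f (F t))"
  by (induction rule: poly_funs.induct) (auto intro: pfun_const pfun_add pfun_mult pfun_linf)

lemma mpfun_line: "mpfun (\<lambda>t. A + t *\<^sub>m X)"
  by (intro mpfun_add mpfun_scale mpfun_const pfun_id)

lemma pfun_zero_cofinite:
  assumes "pfun F" "finite {t. F t \<noteq> (0 :: 'k::field_char_0)}"
  shows "F t = 0"
proof -
  obtain p where p: "\<And>t. F t = poly p t" using assms(1) by (auto simp: pfun_def)
  have "infinite (UNIV :: 'k set)" by (rule infinite_UNIV_char_0)
  then have "infinite {t. poly p t = 0}"
    using assms(2) p by (metis (mono_tags, lifting) Collect_cong Collect_neg_eq finite_compl)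
  then have "p = 0" using poly_roots_finite by blast
  then show ?thesis using p by simp
qed

text \<open>Irreducibility of the affine line; the source of connectedness for the unipotent groups
  below.\<close>

lemma pfun_common_nonzero:
  assumes "pfun F" "pfun H" "F a \<noteq> 0" "H b \<noteq> (0 :: 'k::field_char_0)"
  shows "\<exists>t. F t \<noteq> 0 \<and> H t \<noteq> 0"
proof -
  obtain p q where pq: "\<And>t. F t = poly p t" "\<And>t. H t = poly q t" using assms(1,2) by (auto simp: pfun_def)
  then have "p * q \<noteq> 0" using assms by auto
  then have "finite {t. poly (p * q) t = 0}" by (rule poly_roots_finite)
  then have "\<exists>t. poly (p * q) t \<noteq> 0" using infinite_UNIV_char_0[where 'a = 'k] by (metis (mono_tags, lifting) Collect_cong UNIV_def)
  then show ?thesis using pq by auto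
qed

subsection \<open>The Zariski topology\<close>

lemma zariski_basis:
  assumes "openin (zariski s) U" "x \<in> U"
  shows "\<exists>f\<in>poly_funs s. f x \<noteq> 0 \<and> {y. f y \<noteq> 0} \<subseteq> U"
proof -
  have "generate_topology_on {{x. f x \<noteq> 0} | f. f \<in> poly_funs s} U"
    using assms(1) by (simp add: zariski_def openin_topology_generated_by_iff)
  then show ?thesis using assms(2)
  proof induction
    case (Int a b)
    then obtain f g where fg: "f \<in> poly_funs s" "f x \<noteq> 0" "{y. f y \<noteq> 0} \<subseteq> a"
      "g \<in> poly_funs s" "g x \<noteq> 0" "{y. g y \<noteq> 0} \<subseteq> b" by blast
    then show ?case by (intro bexI[of _ "\<lambda>x. f x * g x"]) (auto intro: poly_funs.mult)
  next
    case (UN K)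
    then obtain k where k: "k \<in> K" "x \<in> k" by blast
    then obtain f where "f \<in> poly_funs s" "f x \<noteq> 0" "{y. f y \<noteq> 0} \<subseteq> k" using UN.IH by blast
    then show ?case using k(1) by (intro bexI[of _ f]) auto
  next
    case (Basis S)
    then obtain f where "f \<in> poly_funs s" "S = {x. f x \<noteq> 0}" by blast
    then show ?case using Basis by (intro bexI[of _ f]) auto
  qed simp
qed

lemma zariski_basic_open: "f \<in> poly_funs s \<Longrightarrow> openin (zariski s) {x. f x \<noteq> 0}"
  unfolding zariski_def by (rule topology_generated_by_Basis) blast

lemma topspace_zariski [simp]:
  fixes s :: "'k::field \<Rightarrow> 'v::ab_group_add \<Rightarrow> 'v"
  shows "topspace (zariski s) = UNIV"
proof -
  have "openin (zariski s) {x. (1 :: 'k) \<noteq> 0}" by (rule zariski_basic_open) (rule poly_funs.const)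
  then show ?thesis using openin_subset by fastforce
qed

lemma zariski_closedI:
  assumes "\<And>A. A \<notin> S \<Longrightarrow> \<exists>f\<in>poly_funs s. f A \<noteq> 0 \<and> (\<forall>B\<in>S. f B = 0)"
  shows "closedin (zariski s) S"
proof -
  have "openin (zariski s) (- S)"
  proof (subst openin_subopen, intro ballI)
    fix A assume "A \<in> - S"
    then obtain f where "f \<in> poly_funs s" "f A \<noteq> 0" "\<forall>B\<in>S. f B = 0" using assms by blast
    then show "\<exists>T. openin (zariski s) T \<and> A \<in> T \<and> T \<subseteq> - S"
      by (intro exI[of _ "{x. f x \<noteq> 0}"]) (auto intro: zariski_basic_open)
  qed
  then show ?thesis by (simp add: closedin_def Compl_eq_Diff_UNIV)
qed

text \<open>A closed set is cut out by the polynomial functions vanishing on it; relative to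
  \<open>D\<close>, since algebraic groups are closed only among invertible matrices.\<close>

lemma zariski_closed_mem:
  assumes "closedin (subtopology (zariski s) D) G" "A \<in> D"
    and "\<And>f. f \<in> poly_funs s \<Longrightarrow> (\<forall>g\<in>G. f g = 0) \<Longrightarrow> f A = 0"
  shows "A \<in> G"
proof (rule ccontr)
  assume "A \<notin> G"
  obtain C where C: "closedin (zariski s) C" "G = C \<inter> D" using assms(1) by (auto simp: closedin_subtopology)
  then have "openin (zariski s) (UNIV - C)" "A \<in> UNIV - C"
    using \<open>A \<notin> G\<close> assms(2) by (auto simp: closedin_def)
  then obtain f where "f \<in> poly_funs s" "f A \<noteq> 0" "{y. f y \<noteq> 0} \<subseteq> UNIV - C" using zariski_basis by blast
  then show False using assms(3)[of f] C by auto
qed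

subsection \<open>The Lie algebra of an algebraic group\<close>

text \<open>The derivative at any point \<open>A\<close>, not only at \<open>mat 1\<close>, so that
  left-invariant derivations can be iterated; \<open>dird_eq\<close> shows that the polynomial is
  unique in characteristic zero.\<close>

definition dird :: "('k::field^'n^'n \<Rightarrow> 'k) \<Rightarrow> 'k^'n^'n \<Rightarrow> 'k^'n^'n \<Rightarrow> 'k" where
  "dird f A X = coeff (THE p. \<forall>t. f (A + t *\<^sub>m X) = poly p t) 1"

lemma dird_eq:
  fixes f :: "'k::field_char_0^'n^'n \<Rightarrow> 'k"
  assumes "\<And>t. f (A + t *\<^sub>m X) = poly p t"
  shows "dird f A X = coeff p 1"
proof -
  have "(THE p. \<forall>t. f (A + t *\<^sub>m X) = poly p t) = p"
  proof (rule the_equality)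
    show "q = p" if "\<forall>t. f (A + t *\<^sub>m X) = poly q t" for q
      using that assms by (simp add: poly_eq_poly_eq_iff[symmetric] fun_eq_iff)
  qed (use assms in blast)
  then show ?thesis by (simp add: dird_def)
qed

lemma poly_funs_line:
  assumes "f \<in> poly_funs mscale" obtains p where "\<And>t. f (A + t *\<^sub>m X) = poly p t"
  using pfun_poly_funs[OF assms mpfun_line[of A X]] unfolding pfun_def by blast

lemma dird_const: "dird (\<lambda>_. c) A (X :: 'k::field_char_0^'n^'n) = 0"
  by (subst dird_eq[of _ _ _ "[:c:]"]) auto

lemma dird_linf:
  assumes "linf f" shows "dird f A (X :: 'k::field_char_0^'n^'n) = f X"
  by (subst dird_eq[of _ _ _ "[:f A, f X:]"])
    (simp_all add: MK.linear_add[OF assms] MK.linear_scale[OF assms])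

lemma dird_add:
  fixes X :: "'k::field_char_0^'n^'n"
  assumes "f \<in> poly_funs mscale" "g \<in> poly_funs mscale"
  shows "dird (\<lambda>A. f A + g A) A X = dird f A X + dird g A X"
proof -
  obtain p q where pq: "\<And>t. f (A + t *\<^sub>m X) = poly p t" "\<And>t. g (A + t *\<^sub>m X) = poly q t"
    using poly_funs_line assms by metis
  then show ?thesis
    by (simp add: dird_eq[of f A X p] dird_eq[of g A X q] dird_eq[of "\<lambda>A. f A + g A" A X "p + q"])
qed

lemma dird_mult:
  fixes X :: "'k::field_char_0^'n^'n"
  assumes "f \<in> poly_funs mscale" "g \<in> poly_funs mscale"
  shows "dird (\<lambda>A. f A * g A) A X = f A * dird g A X + dird f A X * g A"
proof -
  obtain p q where pq: "\<And>t. f (A + t *\<^sub>m X) = poly p t" "\<And>t. g (A + t *\<^sub>m X) = poly q t"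
    using poly_funs_line assms by metis
  have "f A = coeff p 0" "g A = coeff q 0" using pq(1)[of 0] pq(2)[of 0] by (simp_all add: poly_0_coeff_0)
  moreover have "coeff (p * q) 1 = coeff p 0 * coeff q 1 + coeff p 1 * coeff q 0"
    by (simp add: coeff_mult)
  ultimately show ?thesis
    using pq by (simp add: dird_eq[of f A X p] dird_eq[of g A X q] dird_eq[of "\<lambda>A. f A * g A" A X "p * q"])
qed

lemma linf_dird:
  fixes f :: "'k::field_char_0^'n^'n \<Rightarrow> 'k"
  assumes "f \<in> poly_funs mscale" shows "linf (dird f A)"
  using assms
proof induction
  case (const c)
  show ?case by (rule linfI) (simp_all add: dird_const)
next
  case (lin f)
  have "dird f A = f" by (simp add: fun_eq_iff dird_linf[OF lin])
  then show ?case using lin by simp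
next
  case (add f g)
  show ?case by (rule linfI)
    (simp_all add: dird_add[OF add.hyps] MK.linear_add[OF add.IH(1)] MK.linear_add[OF add.IH(2)]
      MK.linear_scale[OF add.IH(1)] MK.linear_scale[OF add.IH(2)] algebra_simps)
next
  case (mult f g)
  show ?case by (rule linfI)
    (simp_all add: dird_mult[OF mult.hyps] MK.linear_add[OF mult.IH(1)] MK.linear_add[OF mult.IH(2)]
      MK.linear_scale[OF mult.IH(1)] MK.linear_scale[OF mult.IH(2)] algebra_simps)
qed

text \<open>The left-invariant derivation defined by \<open>X\<close>.\<close>

definition ldiff :: "'k::field^'n^'n \<Rightarrow> ('k^'n^'n \<Rightarrow> 'k) \<Rightarrow> 'k^'n^'n \<Rightarrow> 'k" where
  "ldiff X f A = dird f A (A ** X)"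

lemma ldiff_linf: "linf f \<Longrightarrow> ldiff X f = (\<lambda>A. f (A ** (X :: 'k::field_char_0^'n^'n)))"
  by (simp add: fun_eq_iff ldiff_def dird_linf)

lemma ldiff_const: "ldiff X (\<lambda>_. c) = (\<lambda>A :: 'k::field_char_0^'n^'n. 0)"
  by (simp add: fun_eq_iff ldiff_def dird_const)

lemma ldiff_add:
  fixes X :: "'k::field_char_0^'n^'n"
  assumes "f \<in> poly_funs mscale" "g \<in> poly_funs mscale"
  shows "ldiff X (\<lambda>A. f A + g A) = (\<lambda>A. ldiff X f A + ldiff X g A)"
  by (simp add: fun_eq_iff ldiff_def dird_add[OF assms])

lemma ldiff_mult:
  fixes X :: "'k::field_char_0^'n^'n"
  assumes "f \<in> poly_funs mscale" "g \<in> poly_funs mscale"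
  shows "ldiff X (\<lambda>A. f A * g A) = (\<lambda>A. f A * ldiff X g A + ldiff X f A * g A)"
  by (simp add: fun_eq_iff ldiff_def dird_mult[OF assms])

lemma linf_rmult: "linf f \<Longrightarrow> linf (\<lambda>A. f (A ** X))"
  by (rule linfI) (simp_all add: mm_simps MK.linear_add MK.linear_scale)

lemma ldiff_poly_funs:
  fixes f :: "'k::field_char_0^'n^'n \<Rightarrow> 'k"
  assumes "f \<in> poly_funs mscale" shows "ldiff X f \<in> poly_funs mscale"
  using assms
proof induction
  case (lin f)
  show ?case unfolding ldiff_linf[OF lin] by (rule poly_funs.lin[OF linf_rmult[OF lin]])
qed (simp_all add: ldiff_const ldiff_add ldiff_mult poly_funs.intros)

text \<open>Both sides are derivations of the algebra of polynomial functions, so agreement on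
  linear functions suffices.\<close>

lemma ldiff_commutator:
  fixes f :: "'k::field_char_0^'n^'n \<Rightarrow> 'k"
  assumes "f \<in> poly_funs mscale"
  shows "ldiff X (ldiff Y f) A - ldiff Y (ldiff X f) A = ldiff (ad X Y) f A"
  using assms
proof induction
  case (const c)
  then show ?case by (simp add: ldiff_const)
next
  case (lin f)
  have "ad X Y = X ** Y - Y ** X" by (simp add: ad_def)
  then show ?case
    by (simp add: ldiff_linf[OF lin] ldiff_linf[OF linf_rmult[OF lin]] mm_simps MK.linear_diff[OF lin]
        matrix_mul_assoc)
next
  case (add f g)
  then show ?case by (simp add: ldiff_add ldiff_poly_funs algebra_simps)
next
  case (mult f g)
  have "ldiff X (ldiff Y (\<lambda>A. f A * g A)) A - ldiff Y (ldiff X (\<lambda>A. f A * g A)) A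
    = f A * (ldiff X (ldiff Y g) A - ldiff Y (ldiff X g) A)
      + (ldiff X (ldiff Y f) A - ldiff Y (ldiff X f) A) * g A"
    by (simp add: ldiff_mult ldiff_add mult.hyps ldiff_poly_funs poly_funs.intros algebra_simps)
  then show ?case by (simp add: mult.IH ldiff_mult[OF mult.hyps])
qed

lemma lie_algebra_iff:
  fixes G :: "('k::field_char_0^'n^'n) set"
  shows "X \<in> lie_algebra G \<longleftrightarrow> (\<forall>f\<in>poly_funs mscale. (\<forall>g\<in>G. f g = 0) \<longrightarrow> dird f (mat 1) X = 0)"
proof -
  have "(\<forall>p. (\<forall>t. f (mat 1 + t *\<^sub>m X) = poly p t) \<longrightarrow> coeff p 1 = 0) \<longleftrightarrow> dird f (mat 1) X = 0"
    if f: "f \<in> poly_funs mscale" for f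
  proof -
    obtain p where "\<And>t. f (mat 1 + t *\<^sub>m X) = poly p t" using poly_funs_line[OF f] by blast
    then show ?thesis by (metis dird_eq)
  qed
  then show ?thesis by (auto simp: lie_algebra_def)
qed

lemma subspace_lie_algebra: "M.subspace (lie_algebra (G :: ('k::field_char_0^'n^'n) set))"
  by (rule M.subspaceI)
    (auto simp: lie_algebra_iff MK.linear_0[OF linf_dird] MK.linear_add[OF linf_dird] MK.linear_scale[OF linf_dird])

context
  fixes G :: "('k::field_char_0^'n^'n) set"
  assumes G: "algebraic_group G"
begin

lemma group_one: "mat 1 \<in> G" and group_mult: "g \<in> G \<Longrightarrow> h \<in> G \<Longrightarrow> g ** h \<in> G"
  and group_inv: "g \<in> G \<Longrightarrow> matrix_inv g \<in> G"
  using G by (auto simp: algebraic_group_def)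

lemma group_invertible: "g \<in> G \<Longrightarrow> invertible g"
  using G closedin_subset unfolding algebraic_group_def topspace_subtopology by fastforce

text \<open>Left translation by \<open>g\<close> preserves the functions vanishing on
  \<open>G\<close>, so tangency at \<open>mat 1\<close> spreads to every \<open>g\<close>: the
  derivation of \<open>X\<close> preserves the vanishing ideal of \<open>G\<close>.\<close>

lemma ldiff_vanish:
  assumes X: "X \<in> lie_algebra G" and f: "f \<in> poly_funs mscale" "\<forall>g\<in>G. f g = 0" and g: "g \<in> G"
  shows "ldiff X f g = 0"
proof -
  let ?f = "\<lambda>A. f (g ** A)"
  have "?f \<in> poly_funs mscale" by (rule poly_funs_precompose[OF f(1) lin_mult])
  moreover have "\<forall>h\<in>G. ?f h = 0" using f(2) g group_mult by blast
  ultimately have "dird ?f (mat 1) X = 0" using X by (auto simp: lie_algebra_iff)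
  moreover obtain p where p: "\<And>t. f (g + t *\<^sub>m (g ** X)) = poly p t" using poly_funs_line[OF f(1)] by blast
  then have "dird ?f (mat 1) X = coeff p 1" by (intro dird_eq) (simp add: mm_simps)
  ultimately show ?thesis using dird_eq[of f, OF p] by (simp add: ldiff_def)
qed

text \<open>Derivations preserving the vanishing ideal are closed under commutators; evaluation at
  \<open>mat 1\<close> returns to tangent vectors.\<close>

lemma lie_algebra_ad:
  assumes "X \<in> lie_algebra G" "Y \<in> lie_algebra G"
  shows "ad X Y \<in> lie_algebra G"
  unfolding lie_algebra_iff
proof safe
  fix f assume f: "f \<in> poly_funs mscale" "\<forall>g\<in>G. f g = 0"
  have "ldiff X (ldiff Y f) (mat 1) = 0" "ldiff Y (ldiff X f) (mat 1) = 0"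
    using assms ldiff_vanish f ldiff_poly_funs group_one by blast+
  then have "ldiff (ad X Y) f (mat 1) = 0" using ldiff_commutator[OF f(1), of X Y "mat 1"] by simp
  then show "dird f (mat 1) (ad X Y) = 0" by (simp add: ldiff_def)
qed

lemma lie_closed_lie_algebra: "lie_closed (lie_algebra G)"
  using lie_algebra_ad subspace_lie_algebra by (auto simp: lie_closed_def)

lemma lie_algebra_Ad:
  assumes "X \<in> lie_algebra G" "g \<in> G"
  shows "Ad g X \<in> lie_algebra G"
  unfolding lie_algebra_iff
proof safe
  fix f assume f: "f \<in> poly_funs mscale" "\<forall>g\<in>G. f g = 0"
  let ?f = "\<lambda>A. f (g ** A ** matrix_inv g)"
  have "lin (\<lambda>A. g ** A ** matrix_inv g)" by (rule linI) (simp_all add: mm_simps)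
  then have "?f \<in> poly_funs mscale" by (rule poly_funs_precompose[OF f(1)])
  moreover have "\<forall>h\<in>G. ?f h = 0" using f(2) assms(2) group_mult group_inv by blast
  ultimately have "dird ?f (mat 1) X = 0" using assms(1) by (auto simp: lie_algebra_iff)
  moreover obtain p where p: "\<And>t. f (mat 1 + t *\<^sub>m Ad g X) = poly p t" using poly_funs_line[OF f(1)] by blast
  then have "dird ?f (mat 1) X = coeff p 1"
    using group_invertible[OF assms(2)] by (intro dird_eq) (simp add: mm_simps Ad_def matrix_inv_mult)
  ultimately show "dird f (mat 1) (Ad g X) = 0" using dird_eq[of f, OF p] by simp
qed

end

lemma pderiv_sum: "pderiv (\<Sum>i\<in>S. f i) = (\<Sum>i\<in>S. pderiv (f i))"
  by (induction S rule: infinite_finite_induct) (simp_all add: pderiv_add)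

text \<open>The curve \<open>exp (t x)\<close> is an integral curve of the left-invariant field of
  \<open>x\<close>. Nilpotency keeps everything polynomial in \<open>t\<close>, so differentiation
  along the curve is \<open>pderiv\<close>.\<close>

lemma ldiff_mexp:
  fixes f :: "'k::field_char_0^'n^'n \<Rightarrow> 'k"
  assumes x: "nilp x" and f: "f \<in> poly_funs mscale"
  shows "\<exists>h. (\<forall>t. f (mexp (t *\<^sub>m x)) = poly h t) \<and> (\<forall>t. ldiff x f (mexp (t *\<^sub>m x)) = poly (pderiv h) t)"
  using f
proof induction
  case (const c)
  show ?case by (rule exI[of _ "[:c:]"]) (simp add: ldiff_const)
next
  case (lin f)
  let ?d = "M.dim (UNIV :: ('k^'n^'n) set)"
  have e: "mexp (t *\<^sub>m x) = (\<Sum>i<?d. (t ^ i) *\<^sub>m divpow x i)" for t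
    unfolding mexp_divpow by (simp add: divpow_def mpow_scale mult.commute)
  define h where "h = (\<Sum>i<?d. monom (f (divpow x i)) i)"
  have 1: "f (mexp (t *\<^sub>m x)) = poly h t" for t
    unfolding e h_def by (simp add: poly_sum poly_monom MK.linear_sum[OF lin] MK.linear_scale[OF lin] mult.commute)
  have "ldiff x f (mexp (t *\<^sub>m x)) = poly (pderiv h) t" for t
  proof -
    have "f (mexp (t *\<^sub>m x) ** x) = (\<Sum>i<?d. t ^ i * f (divpow x i ** x))"
      unfolding e mult_sum_left by (simp add: mm_simps MK.linear_sum[OF lin] MK.linear_scale[OF lin])
    also have "\<dots> = (\<Sum>i<?d. t ^ i * (of_nat (Suc i) * f (divpow x (Suc i))))"
    proof (intro sum.cong refl)
      fix i
      have "divpow x i ** x = of_nat (Suc i) *\<^sub>m divpow x (Suc i)"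
        unfolding divpow_Suc[symmetric] by (simp add: divpow_def mm_simps mpow_comm)
      then show "t ^ i * f (divpow x i ** x) = t ^ i * (of_nat (Suc i) * f (divpow x (Suc i)))"
        by (simp add: MK.linear_scale[OF lin] del: of_nat_Suc)
    qed
    also have "\<dots> = (\<Sum>i<Suc ?d. t ^ (i - 1) * (of_nat i * f (divpow x i)))"
      unfolding sum.lessThan_Suc_shift by simp
    also have "\<dots> = (\<Sum>i<?d. t ^ (i - 1) * (of_nat i * f (divpow x i)))"
      by (simp add: divpow_def nilp_bound[OF x] MK.linear_0[OF lin])
    also have "\<dots> = poly (pderiv h) t"
      by (simp add: h_def poly_sum poly_monom pderiv_sum pderiv_monom mult_ac)
    finally show ?thesis by (simp add: ldiff_linf[OF lin])
  qed
  with 1 show ?case by blast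
next
  case (add f g)
  then obtain h k where "\<forall>t. f (mexp (t *\<^sub>m x)) = poly h t" "\<forall>t. ldiff x f (mexp (t *\<^sub>m x)) = poly (pderiv h) t"
     "\<forall>t. g (mexp (t *\<^sub>m x)) = poly k t" "\<forall>t. ldiff x g (mexp (t *\<^sub>m x)) = poly (pderiv k) t" by blast
  then show ?case by (intro exI[of _ "h + k"]) (simp add: ldiff_add[OF add.hyps] pderiv_add)
next
  case (mult f g)
  then obtain h k where "\<forall>t. f (mexp (t *\<^sub>m x)) = poly h t" "\<forall>t. ldiff x f (mexp (t *\<^sub>m x)) = poly (pderiv h) t"
     "\<forall>t. g (mexp (t *\<^sub>m x)) = poly k t" "\<forall>t. ldiff x g (mexp (t *\<^sub>m x)) = poly (pderiv k) t" by blast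
  then show ?case by (intro exI[of _ "h * k"]) (simp add: ldiff_mult[OF mult.hyps] pderiv_mult)
qed

text \<open>For \<open>f\<close> vanishing on \<open>G\<close> the Taylor coefficients of
  \<open>f (exp (t x))\<close> at zero are, up to factorials, values at \<open>mat 1\<close> of
  iterated derivatives of \<open>f\<close> along \<open>x\<close>. These derivatives stay in the
  vanishing ideal, so the polynomial in \<open>t\<close> is zero.\<close>

lemma mexp_in_group:
  fixes G :: "('k::field_char_0^'n^'n) set"
  assumes G: "algebraic_group G" and x: "x \<in> lie_algebra G" "nilp x"
  shows "mexp x \<in> G"
proof (rule zariski_closed_mem)
  show "closedin (subtopology (zariski mscale) {A. invertible A}) G" using G by (simp add: algebraic_group_def)
  show "mexp x \<in> {A. invertible A}" using mexp_inverse[OF x(2)] by (auto simp: invertible_def)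
  have coeffs: "coeff h k = 0" if "f \<in> poly_funs mscale" "\<forall>g\<in>G. f g = 0" "\<forall>t. f (mexp (t *\<^sub>m x)) = poly h t"
    for f h k
    using that
  proof (induction k arbitrary: f h)
    case 0
    then have "poly h 0 = f (mat 1)" by (metis M.scale_zero_left mexp_0)
    then show ?case using 0 group_one[OF G] by (simp add: poly_0_coeff_0)
  next
    case (Suc k)
    obtain h' where h': "\<forall>t. f (mexp (t *\<^sub>m x)) = poly h' t" "\<forall>t. ldiff x f (mexp (t *\<^sub>m x)) = poly (pderiv h') t"
      using ldiff_mexp[OF x(2) Suc.prems(1)] by blast
    then have "h' = h" using Suc.prems(3) by (simp add: poly_eq_poly_eq_iff[symmetric] fun_eq_iff)
    moreover have "coeff (pderiv h') k = 0"
      using Suc.IH[OF ldiff_poly_funs[OF Suc.prems(1)] _ h'(2)] ldiff_vanish[OF G x(1) Suc.prems(1,2)] by blast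
    ultimately show ?case by (simp add: coeff_pderiv del: of_nat_Suc)
  qed
  fix f assume f: "f \<in> poly_funs mscale" "\<forall>g\<in>G. f g = 0"
  obtain h where h: "\<forall>t. f (mexp (t *\<^sub>m x)) = poly h t" using ldiff_mexp[OF x(2) f(1)] by blast
  then have "h = 0" using coeffs[OF f h] by (simp add: poly_eq_iff)
  then show "f (mexp x) = 0" using h[THEN spec, of 1] by simp
qed

subsection \<open>Commutative unipotent normal subgroups\<close>

lemma Ad_mpow: "invertible g \<Longrightarrow> mpow (Ad g x) k = Ad g (mpow x k)"
proof (induction k)
  case (Suc k)
  have "Ad g (x ** mpow x k) = g ** x ** (matrix_inv g ** g) ** mpow x k ** matrix_inv g"
    using Suc.prems by (simp add: Ad_def matrix_inv_mult matrix_mul_assoc)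
  then show ?case using Suc by (simp add: mpow_Suc Ad_def matrix_mul_assoc)
qed (simp add: Ad_def matrix_inv_mult)

lemma lin_Ad: "lin (Ad g)"
  by (rule linI) (simp_all add: Ad_def mm_simps)

lemma Ad_mult: "invertible g \<Longrightarrow> Ad g (x ** y) = Ad g x ** Ad g y"
proof -
  assume "invertible g"
  then have "g ** x ** (matrix_inv g ** g) ** y ** matrix_inv g = Ad g (x ** y)"
    by (simp add: Ad_def matrix_inv_mult matrix_mul_assoc)
  then show ?thesis by (simp add: Ad_def matrix_mul_assoc)
qed

lemma Ad_ad: "invertible g \<Longrightarrow> Ad g (ad x y) = ad (Ad g x) (Ad g y)"
  by (simp add: ad_def MM.linear_diff[OF lin_Ad] Ad_mult)

lemma trace_Ad: "invertible g \<Longrightarrow> trace (Ad g x) = trace x"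
  by (simp add: Ad_def trace_mul_sym[of "g ** x"] matrix_mul_assoc matrix_inv_mult)

lemma Ad_mexp: "invertible g \<Longrightarrow> Ad g (mexp x) = mexp (Ad g x)"
  by (simp add: mexp_def ev_def MM.linear_sum[OF lin_Ad] MM.linear_scale[OF lin_Ad] Ad_mpow)

lemma mpow_entry_poly: "(\<lambda>A. mpow (A - mat 1) k $ i $ j) \<in> poly_funs mscale"
proof (induction k arbitrary: i j)
  case (Suc k)
  have "(\<lambda>A. (A - mat 1 :: 'a^'b^'b) $ i $ l) \<in> poly_funs mscale" for l
    using poly_funs_diff[OF poly_funs.lin[OF linf_entry] poly_funs.const] by simp
  then show ?case
    by (simp add: mpow_Suc matrix_matrix_mult_def poly_funs_sum poly_funs.mult Suc)
qed (simp add: poly_funs.const)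

lemma linf_ev_poly:
  assumes "linf f" shows "(\<lambda>A. f (ev F (A - mat 1))) \<in> poly_funs mscale"
proof -
  have "(\<lambda>A. f (mpow (A - mat 1) i)) \<in> poly_funs mscale" for i
    by (subst linf_expand[OF assms]) (intro poly_funs_sum poly_funs.mult poly_funs.const mpow_entry_poly)
  then have "(\<lambda>A. \<Sum>i<M.dim (UNIV :: ('a^'b^'b) set). fps_nth F i * f (mpow (A - mat 1) i)) \<in> poly_funs mscale"
    by (intro poly_funs_sum poly_funs_scale)
  then show ?thesis by (simp add: ev_def MK.linear_sum[OF assms] MK.linear_scale[OF assms])
qed

lemma separating_functional:
  assumes "M.subspace S" "x \<notin> S"
  shows "\<exists>f. linf f \<and> (\<forall>y\<in>S. f y = 0) \<and> f x = 1"
proof -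
  obtain B where B: "B \<subseteq> S" "M.independent B" "S = M.span B"
    using M.basis_exists M.span_subspace assms(1) by metis
  then have "M.independent (insert x B)" using assms(2) by (simp add: M.independent_insert)
  then obtain f where f: "linf f" "\<forall>y\<in>insert x B. f y = (if y = x then 1 else 0)"
    using MK.linear_independent_extend[of "insert x B" "\<lambda>y. if y = x then 1 else 0"] by blast
  have "f y = 0" if "y \<in> M.span B" for y
    using that
  proof (induction rule: M.span_induct_alt)
    case (step c y z)
    have "y \<noteq> x" using step(1) B(1) assms(2) by blast
    then show ?case using step f by (simp add: MK.linear_add[OF f(1)] MK.linear_scale[OF f(1)])
  qed (simp add: MK.linear_0[OF f(1)])
  then show ?thesis using f B(3) by (intro exI[of _ f]) auto
qed

text \<open>The set \<open>exp b\<close> is a closed connected normal unipotent subgroup, hence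
  trivial. It is closed because nilpotency of \<open>A - mat 1\<close> is polynomial, and for such
  \<open>A\<close> membership means that the logarithm, polynomial in \<open>A\<close>, satisfies
  the linear equations of \<open>b\<close>. It is connected because any two of its points lie on a
  polynomial curve inside it.\<close>

lemma no_commutative_nilpotent:
  fixes G :: "('k::field_char_0^'n^'n) set"
  assumes G: "reductive_group G" and b: "M.subspace b" "b \<subseteq> lie_algebra G"
    and comm: "\<And>x y. x \<in> b \<Longrightarrow> y \<in> b \<Longrightarrow> x ** y = y ** x" and nil: "\<And>x. x \<in> b \<Longrightarrow> nilp x"
    and Ad: "\<And>g x. g \<in> G \<Longrightarrow> x \<in> b \<Longrightarrow> Ad g x \<in> b"
  shows "b = {0}"
proof -
  have alg: "algebraic_group G" using G by (simp add: reductive_group_def)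
  let ?d = "M.dim (UNIV :: ('k^'n^'n) set)"
  let ?U = "mexp ` b"
  have clo: "closedin (zariski mscale) ?U"
  proof (rule zariski_closedI)
    fix A assume A: "A \<notin> ?U"
    show "\<exists>f\<in>poly_funs mscale. f A \<noteq> 0 \<and> (\<forall>B\<in>?U. f B = 0)"
    proof (cases "nilp (A - mat 1)")
      case False
      then have "mpow (A - mat 1) ?d \<noteq> 0" by (auto simp: nilp_def)
      then obtain i j where "mpow (A - mat 1) ?d $ i $ j \<noteq> 0" by (auto simp: vec_eq_iff)
      moreover have "mpow (B - mat 1) ?d $ i $ j = 0" if "B \<in> ?U" for B
        using that nilp_bound[OF nilp_mexp[OF nil]] by auto
      ultimately show ?thesis
        by (intro bexI[of _ "\<lambda>A. mpow (A - mat 1) ?d $ i $ j"]) (auto simp: mpow_entry_poly)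
    next
      case True
      have "mlog1 (A - mat 1) \<notin> b"
      proof
        assume "mlog1 (A - mat 1) \<in> b"
        moreover have "mexp (mlog1 (A - mat 1)) = A" using mexp_mlog1[OF True] by simp
        ultimately show False using A by (metis imageI)
      qed
      then obtain f where f: "linf f" "\<forall>y\<in>b. f y = 0" "f (mlog1 (A - mat 1)) = 1"
        using separating_functional[OF b(1)] by blast
      have "(\<lambda>A. f (mlog1 (A - mat 1))) \<in> poly_funs mscale" unfolding mlog1_def by (rule linf_ev_poly[OF f(1)])
      moreover have "f (mlog1 (B - mat 1)) = 0" if "B \<in> ?U" for B
        using that f(2) by (auto simp: mlog1_mexp nil)
      ultimately show ?thesis using f(3) by (intro bexI[of _ "\<lambda>A. f (mlog1 (A - mat 1))"]) auto
    qed
  qed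
  have inv: "invertible A \<and> matrix_inv A \<in> ?U" if AU: "A \<in> ?U" for A
  proof -
    obtain x where x: "x \<in> b" "A = mexp x" using AU by blast
    have "invertible A" using mexp_inverse[OF nil[OF x(1)]] x(2) by (auto simp: invertible_def)
    moreover have "matrix_inv A = mexp (- x)" unfolding x(2)
      by (rule matrix_inv_eq) (rule mexp_inverse[OF nil[OF x(1)]])+
    moreover have "- x \<in> b" using x(1) b(1) by (rule M.subspace_neg[rotated])
    ultimately show ?thesis by auto
  qed
  have "algebraic_group ?U"
    unfolding algebraic_group_def
  proof (intro conjI ballI)
    have "closedin (subtopology (zariski mscale) {A. invertible A}) ({A. invertible A} \<inter> ?U)"
      using clo by (auto simp: closedin_subtopology)
    moreover have "{A. invertible A} \<inter> ?U = ?U" using inv by auto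
    ultimately show "closedin (subtopology (zariski mscale) {A. invertible A}) ?U" by simp
    show "mat 1 \<in> ?U" using M.subspace_0[OF b(1)] mexp_0 by (metis imageI)
  next
    fix g h assume "g \<in> ?U" "h \<in> ?U"
    then obtain x y where xy: "x \<in> b" "y \<in> b" "g = mexp x" "h = mexp y" by blast
    then have "g ** h = mexp (x + y)" using mexp_add[OF nil nil comm] by simp
    then show "g ** h \<in> ?U" using xy M.subspace_add[OF b(1)] by blast
  qed (use inv in blast)
  moreover have "?U \<subseteq> G" using mexp_in_group[OF alg] b(2) nil by blast
  moreover have "\<forall>g\<in>G. \<forall>u\<in>?U. Ad g u \<in> ?U"
    by (metis (no_types, lifting) Ad_mexp group_invertible[OF alg] Ad imageE imageI)
  moreover have "connectedin (zariski mscale) ?U"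
    unfolding connectedin
  proof (intro conjI notI)
    assume "\<exists>E1 E2. openin (zariski mscale) E1 \<and> openin (zariski mscale) E2 \<and> ?U \<subseteq> E1 \<union> E2 \<and>
      E1 \<inter> E2 \<inter> ?U = {} \<and> E1 \<inter> ?U \<noteq> {} \<and> E2 \<inter> ?U \<noteq> {}"
    then obtain E1 E2 x y where E: "openin (zariski mscale) E1" "openin (zariski mscale) E2"
      "E1 \<inter> E2 \<inter> ?U = {}" "x \<in> b" "y \<in> b" "mexp x \<in> E1" "mexp y \<in> E2" by blast
    obtain f where f: "f \<in> poly_funs mscale" "f (mexp x) \<noteq> 0" "{y. f y \<noteq> 0} \<subseteq> E1"
      using zariski_basis[OF E(1,6)] by blast
    obtain g where g: "g \<in> poly_funs mscale" "g (mexp y) \<noteq> 0" "{y. g y \<noteq> 0} \<subseteq> E2"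
      using zariski_basis[OF E(2,7)] by blast
    define F where "F t = mexp (x + t *\<^sub>m (y - x))" for t
    have "mpfun F" unfolding F_def mexp_def ev_def
      by (intro mpfun_sum mpfun_scale mpfun_pow mpfun_line pfun_const)
    then have "pfun (\<lambda>t. f (F t))" "pfun (\<lambda>t. g (F t))" using pfun_poly_funs f(1) g(1) by blast+
    moreover have "f (F 0) \<noteq> 0" "g (F 1) \<noteq> 0" using f g by (auto simp: F_def)
    ultimately obtain t where t: "f (F t) \<noteq> 0" "g (F t) \<noteq> 0"
      using pfun_common_nonzero[of "\<lambda>t. f (F t)" "\<lambda>t. g (F t)"] by blast
    moreover have "F t \<in> ?U" unfolding F_def
      using E b(1) by (intro imageI) (simp add: M.subspace_add M.subspace_diff M.subspace_scale)
    ultimately show False using E(3) f(3) g(3) by blast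
  qed simp
  moreover have "\<forall>u\<in>?U. unipotent u"
    using nilp_mexp[OF nil] by (auto simp: unipotent_def nilp_def mpow_def)
  ultimately have U: "?U = {mat 1}" using G by (simp add: reductive_group_def)
  have "x = 0" if "x \<in> b" for x
  proof -
    have "mexp x = mexp 0" using U that by auto
    then show ?thesis using mlog1_mexp[OF nil[OF that]] mlog1_mexp[of "0 :: 'k^'n^'n"] by simp
  qed
  then show ?thesis using M.subspace_0[OF b(1)] by auto
qed

section \<open>Reductive Lie algebras with an involution\<close>

lemma mpow_derivation:
  assumes "ad e z = v" "v ** e = e ** v"
  shows "mpow e (Suc k) ** z = z ** mpow e (Suc k) + of_nat (Suc k) *\<^sub>m (v ** mpow e k)"
proof (induction k)
  case 0
  show ?case using assms(1) by (simp add: ad_def algebra_simps)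
next
  case (Suc k)
  have ez: "e ** z = z ** e + v" using assms(1) by (simp add: ad_def algebra_simps)
  have "mpow e (Suc (Suc k)) ** z = e ** (mpow e (Suc k) ** z)"
    by (simp only: mpow_Suc[of e "Suc k"] matrix_mul_assoc)
  also have "\<dots> = e ** z ** mpow e (Suc k) + of_nat (Suc k) *\<^sub>m (e ** v ** mpow e k)"
    unfolding Suc by (simp only: mm_simps matrix_mul_assoc)
  also have "e ** z ** mpow e (Suc k) = z ** mpow e (Suc (Suc k)) + v ** mpow e (Suc k)"
    unfolding ez mm_simps by (simp only: mpow_Suc[of e "Suc k"] matrix_mul_assoc)
  also have "e ** v ** mpow e k = v ** mpow e (Suc k)"
    unfolding assms(2)[symmetric] by (simp only: mpow_Suc matrix_mul_assoc)
  finally show ?case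
    by (simp only: of_nat_Suc[of "Suc k"] M.scale_left_distrib M.scale_one add.assoc)
qed

text \<open>In fact \<open>e ** z\<close> is nilpotent. The commutator \<open>v = [e, z]\<close> is
  nilpotent since it commutes with \<open>e\<close>; and \<open>e ** z\<close> preserves the kernels
  of the powers of \<open>e\<close>, acting on the kernel of \<open>e^(j+1)\<close> modulo that of
  \<open>e^j\<close> as \<open>(j+1) v\<close>, seen through \<open>e^j\<close>.\<close>

lemma trace_nilp_ad2:
  fixes e z :: "'k::{alg_closed_field, field_char_0}^'n^'n"
  assumes e: "nilp e" and ez: "ad e (ad e z) = 0"
  shows "trace (e ** z) = 0"
proof -
  define v where "v = ad e z"
  have ve: "v ** e = e ** v" using ez by (simp add: v_def ad_eq_0_iff)
  have "trace (mpow v (Suc k)) = 0" for k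
  proof -
    have "trace (ad z e ** mpow v k) = 0" by (rule trace_mpow_ad) (rule mpow_comm_gen[OF ve])
    moreover have "v = - ad z e" unfolding v_def by (rule ad_antisym)
    ultimately show ?thesis by (simp add: mpow_Suc mm_simps trace_neg)
  qed
  then have "nilp v" by (rule nilp_if_traces)
  then obtain m where m: "mpow v m = 0" by (auto simp: nilp_def)
  \<comment> \<open>A matrix \<open>V\<close> with \<open>mpow e j ** V = 0\<close> stands for a
    family of vectors in the kernel of \<open>e^j\<close>, its columns.\<close>
  have "\<exists>N. mpow (e ** z) N ** V = 0" if "mpow e j ** V = 0" for j and V :: "'k^'n^'n"
    using that
  proof (induction j arbitrary: V)
    case 0
    then show ?case by (intro exI[of _ 0]) simp
  next
    case (Suc j)
    let ?c = "of_nat (Suc j) :: 'k"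
    have step: "mpow e j ** (e ** z ** W) = ?c *\<^sub>m (v ** (mpow e j ** W))"
      if W: "mpow e (Suc j) ** W = 0" for W
    proof -
      have "mpow e j ** (e ** z ** W) = mpow e (Suc j) ** z ** W"
        by (simp only: mpow_Suc2 matrix_mul_assoc)
      also have "\<dots> = z ** (mpow e (Suc j) ** W) + ?c *\<^sub>m (v ** (mpow e j ** W))"
        unfolding mpow_derivation[OF v_def[symmetric] ve] by (simp only: mm_simps matrix_mul_assoc)
      finally show ?thesis using W by (simp add: mm_simps)
    qed
    have "mpow e (Suc j) ** (mpow (e ** z) k ** V) = 0 \<and>
      mpow e j ** (mpow (e ** z) k ** V) = (?c ^ k) *\<^sub>m (mpow v k ** (mpow e j ** V))" for k
    proof (induction k)
      case 0
      then show ?case using Suc.prems by simp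
    next
      case (Suc k)
      let ?W = "mpow (e ** z) k ** V"
      have W: "mpow e (Suc j) ** ?W = 0" "mpow e j ** ?W = (?c ^ k) *\<^sub>m (mpow v k ** (mpow e j ** V))"
        using Suc by blast+
      have eq: "mpow (e ** z) (Suc k) ** V = e ** z ** ?W" by (simp only: mpow_Suc matrix_mul_assoc)
      have a: "mpow e j ** (e ** z ** ?W) = ?c *\<^sub>m (v ** (mpow e j ** ?W))" by (rule step[OF W(1)])
      have "mpow e (Suc j) ** (e ** z ** ?W) = e ** (mpow e j ** (e ** z ** ?W))"
        by (simp only: mpow_Suc matrix_mul_assoc)
      also have "\<dots> = ?c *\<^sub>m (v ** (mpow e (Suc j) ** ?W))"
        unfolding a mm_simps by (simp only: mpow_Suc matrix_mul_assoc ve)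
      also have "\<dots> = 0" unfolding W(1) by (simp add: mm_simps)
      finally show ?case unfolding eq a W(2)
        by (simp add: mm_simps mpow_Suc matrix_mul_assoc del: of_nat_Suc)
    qed
    from this[of m] have "mpow e j ** (mpow (e ** z) m ** V) = 0" by (simp add: m mm_simps)
    then obtain N where "mpow (e ** z) N ** (mpow (e ** z) m ** V) = 0" using Suc.IH by blast
    then show ?case by (metis matrix_mul_assoc mpow_add)
  qed
  moreover obtain d where "mpow e d = 0" using e by (auto simp: nilp_def)
  then have "mpow e d ** mat 1 = 0" by simp
  ultimately obtain N where "mpow (e ** z) N ** mat 1 = 0" by blast
  then show ?thesis by (intro trace_nilp) (auto simp: nilp_def)
qed

lemma nilp_Ad: "nilp x \<Longrightarrow> invertible g \<Longrightarrow> nilp (Ad g x)"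
  unfolding nilp_def by (metis Ad_mpow MM.linear_0[OF lin_Ad])

lemma trace_brk:
  assumes "y \<in> brk S T" "\<And>x. x \<in> T \<Longrightarrow> c ** x = x ** c"
  shows "trace (y ** c) = 0"
  using assms(1) unfolding brk_def
  by (induction rule: M.span_induct_alt) (auto simp: mm_simps trace_simps trace_mpow_ad assms(2))

text \<open>The powers of \<open>y\<close> commute with \<open>T\<close>, so invariance of the trace
  form kills the trace of every positive power.\<close>

lemma nilp_brk:
  fixes y :: "'k::{alg_closed_field, field_char_0}^'n^'n"
  assumes "y \<in> brk S T" "\<And>x. x \<in> T \<Longrightarrow> y ** x = x ** y"
  shows "nilp y"
proof (rule nilp_if_traces)
  fix k show "trace (mpow y (Suc k)) = 0"
    unfolding mpow_Suc by (rule trace_brk[OF assms(1)]) (rule mpow_comm_gen[OF assms(2)])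
qed

lemma brk_ideal:
  assumes S: "\<And>x y. x \<in> L \<Longrightarrow> y \<in> S \<Longrightarrow> ad x y \<in> S" and T: "\<And>x y. x \<in> L \<Longrightarrow> y \<in> T \<Longrightarrow> ad x y \<in> T"
    and "x \<in> L" "y \<in> brk S T"
  shows "ad x y \<in> brk S T"
  using assms(4) unfolding brk_def
proof (induction rule: M.span_induct_alt)
  case (step c y z)
  then obtain a b where ab: "a \<in> S" "b \<in> T" "y = ad a b" by blast
  have "ad x (ad a b) = ad (ad x a) b + ad a (ad x b)" by (rule jacobi)
  moreover have "ad (ad x a) b \<in> brk S T" "ad a (ad x b) \<in> brk S T"
    using ab S T assms(3) by (auto intro: brk_in)
  ultimately have "ad x y \<in> M.span {ad a b |a b. a \<in> S \<and> b \<in> T}"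
    using ab by (simp add: brk_def M.span_add)
  then show ?case using step by (simp add: ad_simps M.span_add M.span_scale)
qed (simp add: ad_simps M.span_zero)

lemma brk_Ad:
  assumes g: "invertible g" and S: "\<And>y. y \<in> S \<Longrightarrow> Ad g y \<in> S" and T: "\<And>y. y \<in> T \<Longrightarrow> Ad g y \<in> T"
    and y: "y \<in> brk S T"
  shows "Ad g y \<in> brk S T"
  using y unfolding brk_def
proof (induction rule: M.span_induct_alt)
  case (step c y z)
  then obtain a b where ab: "a \<in> S" "b \<in> T" "y = ad a b" by blast
  then have "Ad g y \<in> brk S T" using S T by (auto simp: Ad_ad[OF g] intro: brk_in)
  then show ?case using step by (simp add: MM.linear_add[OF lin_Ad] MM.linear_scale[OF lin_Ad] brk_def M.span_add M.span_scale)
qed (simp add: MM.linear_0[OF lin_Ad] M.span_zero)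

definition cent :: "('k::field^'n^'n) set \<Rightarrow> ('k^'n^'n) set" where
  "cent L = {x \<in> L. \<forall>y\<in>L. ad y x = 0}"

text \<open>The last nonzero term of the derived series is abelian, hence central by
  \<open>ab\<close>. Were it not \<open>S\<close> itself, it would lie in \<open>[L, L]\<close>,
  which meets the centre in zero.\<close>

lemma solvable_central:
  assumes L: "lie_closed L" and S: "M.subspace S" "S \<subseteq> L" "\<And>x y. x \<in> L \<Longrightarrow> y \<in> S \<Longrightarrow> ad x y \<in> S"
    and k: "\<exists>k. derived S k = {0}"
    and Z: "cent L \<inter> brk L L = {0}"
    and ab: "\<And>j. (\<forall>x\<in>derived S j. \<forall>y\<in>derived S j. ad x y = 0) \<Longrightarrow> derived S j \<subseteq> cent L"
  shows "S \<subseteq> cent L"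
proof -
  define m where "m = (LEAST k. derived S k = {0})"
  have m: "derived S m = {0}" unfolding m_def using k by (rule LeastI_ex)
  have lS: "lie_closed S" using S by (auto simp: lie_closed_def)
  have sub: "derived S j \<subseteq> L" for j
    by (induction j) (use S(2) lie_closed_derived(2)[OF lS] in auto)
  show ?thesis
  proof (cases m)
    case 0
    then have "S = {0}" using m by simp
    moreover have "0 \<in> cent L" using L by (simp add: cent_def ad_simps lie_closed_def M.subspace_0)
    ultimately show ?thesis by simp
  next
    case (Suc j)
    have "\<forall>x\<in>derived S j. \<forall>y\<in>derived S j. ad x y = 0"
      using brk_in[of _ "derived S j" _ "derived S j"] m Suc by auto
    then have c: "derived S j \<subseteq> cent L" by (rule ab)
    show ?thesis
    proof (cases j)
      case 0
      then show ?thesis using c by simp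
    next
      case (Suc i)
      have "derived S j \<subseteq> brk L L" unfolding Suc derived.simps by (rule brk_mono[OF sub sub])
      with c Z have "derived S j \<subseteq> {0}" by blast
      moreover have "0 \<in> derived S j" by (simp add: Suc M.subspace_0[OF subspace_brk])
      ultimately have "derived S j = {0}" by blast
      then have "m \<le> j" unfolding m_def by (rule Least_le)
      then show ?thesis using \<open>m = Suc j\<close> by simp
    qed
  qed
qed

section \<open>Centrality of the radicals for a reductive group\<close>

context
  fixes G :: "('k::{alg_closed_field, field_char_0}^'n^'n) set"
  assumes G: "reductive_group G"
begin

lemma red_alg: "algebraic_group G"
  using G by (simp add: reductive_group_def)

text \<open>The central nilpotents form a commutative \<open>Ad\<close>-stable subspace, to which
  \<open>no_commutative_nilpotent\<close> applies.\<close>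

lemma central_nilp:
  assumes "x \<in> cent (lie_algebra G)" "nilp x" shows "x = 0"
proof -
  let ?L = "lie_algebra G"
  let ?b = "{x \<in> cent ?L. nilp x}"
  have comm: "x ** y = y ** x" if "x \<in> ?L" "y \<in> cent ?L" for x y
    using that ad_eq_0_iff[of x y] unfolding cent_def by blast
  have "?b = {0}"
  proof (rule no_commutative_nilpotent[OF G])
    show "M.subspace ?b"
    proof (rule M.subspaceI)
      show "0 \<in> ?b" by (simp add: cent_def M.subspace_0[OF subspace_lie_algebra] ad_simps)
      show "x + y \<in> ?b" if "x \<in> ?b" "y \<in> ?b" for x y
        using that nilp_add[of x y] comm[of x y]
        by (simp add: cent_def M.subspace_add[OF subspace_lie_algebra] ad_simps)
      show "c *\<^sub>m x \<in> ?b" if "x \<in> ?b" for c x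
        using that by (simp add: cent_def M.subspace_scale[OF subspace_lie_algebra] ad_simps nilp_scale)
    qed
    show "Ad g x \<in> ?b" if "g \<in> G" "x \<in> ?b" for g x
    proof -
      have inv: "invertible g" by (rule group_invertible[OF red_alg that(1)])
      have "ad y (Ad g x) = 0" if y: "y \<in> ?L" for y
      proof -
        have "matrix_inv g \<in> G" by (rule group_inv[OF red_alg \<open>g \<in> G\<close>])
        have e: "matrix_inv (matrix_inv g) = g" by (rule matrix_inv_eq) (simp_all add: matrix_inv_mult inv)
        define y' where "y' = Ad (matrix_inv g) y"
        have "Ad g y' = (g ** matrix_inv g) ** y ** (g ** matrix_inv g)"
          unfolding y'_def Ad_def e by (simp only: matrix_mul_assoc)
        then have yy: "Ad g y' = y" by (simp add: matrix_inv_mult inv)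
        have "ad y (Ad g x) = Ad g (ad y' x)" by (simp add: Ad_ad[OF inv] yy)
        also have "ad y' x = 0" using lie_algebra_Ad[OF red_alg y \<open>matrix_inv g \<in> G\<close>] \<open>x \<in> ?b\<close>
          by (simp add: cent_def y'_def)
        also have "Ad g 0 = 0" by (rule MM.linear_0[OF lin_Ad])
        finally show ?thesis .
      qed
      moreover have "nilp (Ad g x)" using that(2) nilp_Ad[OF _ inv] by simp
      moreover have "Ad g x \<in> ?L" using that lie_algebra_Ad[OF red_alg] unfolding cent_def by blast
      ultimately show ?thesis unfolding cent_def by blast
    qed
    show "?b \<subseteq> ?L" unfolding cent_def by blast
    then show "x ** y = y ** x" if "x \<in> ?b" "y \<in> ?b" for x y using that comm by blast
    show "nilp x" if "x \<in> ?b" for x using that by blast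
  qed
  then show ?thesis using assms by blast
qed

lemma cent_brk: "cent (lie_algebra G) \<inter> brk (lie_algebra G) (lie_algebra G) = {0}"
proof -
  have "x = 0" if "x \<in> cent (lie_algebra G)" "x \<in> brk (lie_algebra G) (lie_algebra G)" for x
  proof (rule central_nilp[OF that(1)], rule nilp_brk[OF that(2)])
    show "x ** y = y ** x" if "y \<in> lie_algebra G" for y
      using \<open>x \<in> cent _\<close> that ad_eq_0_iff[of y x] unfolding cent_def by simp
  qed
  moreover have "0 \<in> cent (lie_algebra G)" "0 \<in> brk (lie_algebra G) (lie_algebra G)"
    by (auto simp: cent_def ad_simps M.subspace_0 subspace_lie_algebra subspace_brk)
  ultimately show ?thesis by blast
qed

text \<open>The elements of \<open>[L, a]\<close> lie in \<open>a\<close>, commute with it, and are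
  therefore nilpotent by \<open>nilp_brk\<close>; \<open>Ad\<close>-stability passes from
  \<open>a\<close> to \<open>[L, a]\<close>, and reductivity makes it zero.\<close>

lemma abelian_stable_ideal:
  assumes a: "M.subspace a" "a \<subseteq> lie_algebra G" "\<And>x y. x \<in> lie_algebra G \<Longrightarrow> y \<in> a \<Longrightarrow> ad x y \<in> a"
    and ab: "\<And>x y. x \<in> a \<Longrightarrow> y \<in> a \<Longrightarrow> ad x y = 0"
    and Ad: "\<And>g x. g \<in> G \<Longrightarrow> x \<in> a \<Longrightarrow> Ad g x \<in> a"
  shows "a \<subseteq> cent (lie_algebra G)"
proof -
  let ?b = "brk (lie_algebra G) a"
  have ba: "?b \<subseteq> a" by (rule brk_least[OF a(1,3)])
  have ab': "x ** y = y ** x" if "x \<in> a" "y \<in> a" for x y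
    using ab[OF that] by (simp only: ad_eq_0_iff)
  have "?b = {0}"
  proof (rule no_commutative_nilpotent[OF G subspace_brk])
    show "?b \<subseteq> lie_algebra G" using ba a(2) by blast
    show "x ** y = y ** x" if "x \<in> ?b" "y \<in> ?b" for x y using that ab' ba by blast
    show "nilp x" if "x \<in> ?b" for x
      by (rule nilp_brk[OF that]) (use that ab' ba in blast)
    show "Ad g x \<in> ?b" if "g \<in> G" "x \<in> ?b" for g x
      by (rule brk_Ad) (use that Ad lie_algebra_Ad[OF red_alg] group_invertible[OF red_alg] in auto)
  qed
  then have "ad x y = 0" if "x \<in> lie_algebra G" "y \<in> a" for x y using brk_in[OF that] by auto
  then show ?thesis using a(2) by (auto simp: cent_def)
qed

text \<open>Cyclicity of the trace makes this radical \<open>Ad\<close>-stable, and with it the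
  whole derived series, so the last abelian term falls under \<open>abelian_stable_ideal\<close>.
  Solvability is the criterion with the identity for \<open>\<sigma>\<close>.\<close>

lemma trace_radical_central:
  assumes x: "x \<in> lie_algebra G" "\<And>y. y \<in> lie_algebra G \<Longrightarrow> trace (x ** y) = 0"
  shows "x \<in> cent (lie_algebra G)"
proof -
  let ?L = "lie_algebra G"
  let ?R = "{x \<in> ?L. \<forall>y\<in>?L. trace (x ** y) = 0}"
  have L: "lie_closed ?L" by (rule lie_closed_lie_algebra[OF red_alg])
  have sR: "M.subspace ?R"
    by (rule M.subspaceI) (auto simp: M.subspace_0 M.subspace_add M.subspace_scale subspace_lie_algebra
        mm_simps trace_simps)
  have iR: "ad u v \<in> ?R" if "u \<in> ?L" "v \<in> ?R" for u v
  proof -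
    have "trace (ad u v ** y) = 0" if "y \<in> ?L" for y
    proof -
      have "trace (ad u v ** y) = - trace (ad v u ** y)" by (subst ad_antisym) (simp add: mm_simps trace_neg)
      also have "\<dots> = 0" using \<open>v \<in> ?R\<close> \<open>u \<in> ?L\<close> that L by (simp add: trace_ad lie_closed_def)
      finally show ?thesis .
    qed
    then show ?thesis using that L by (simp add: lie_closed_def)
  qed
  have AR: "Ad g v \<in> ?R" if g: "g \<in> G" and v: "v \<in> ?R" for g v
  proof -
    have inv: "invertible g" by (rule group_invertible[OF red_alg g])
    have gi: "matrix_inv g \<in> G" by (rule group_inv[OF red_alg g])
    have "trace (Ad g v ** y) = 0" if y: "y \<in> ?L" for y
    proof -
      have e: "matrix_inv (matrix_inv g) = g" by (rule matrix_inv_eq) (simp_all add: matrix_inv_mult inv)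
      have "trace (Ad g v ** y) = trace (v ** Ad (matrix_inv g) y)"
        unfolding Ad_def e using trace_mul_sym[of g "v ** matrix_inv g ** y"]
        by (simp add: matrix_mul_assoc)
      then show ?thesis using v lie_algebra_Ad[OF red_alg y gi] by simp
    qed
    then show ?thesis using v lie_algebra_Ad[OF red_alg _ g] by simp
  qed
  have lR: "lie_closed ?R" using sR iR by (auto simp: lie_closed_def)
  have RL: "?R \<subseteq> ?L" by blast
  have dI: "ad u v \<in> derived ?R j" if "u \<in> ?L" "v \<in> derived ?R j" for u v j
    using that
  proof (induction j arbitrary: u v)
    case (Suc j)
    then show ?case unfolding derived.simps by (intro brk_ideal[where L = ?L]) auto
  qed (use iR in simp)
  have dA: "Ad g v \<in> derived ?R j" if "g \<in> G" "v \<in> derived ?R j" for g v j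
    using that
  proof (induction j arbitrary: v)
    case (Suc j)
    then show ?case unfolding derived.simps
      by (intro brk_Ad group_invertible[OF red_alg]) auto
  qed (use AR in simp)
  have dS: "derived ?R j \<subseteq> ?R" for j
    by (induction j) (use lie_closed_derived(2)[OF lR] in auto)
  have "?R \<subseteq> cent ?L"
  proof (rule solvable_central[OF L sR RL iR _ cent_brk])
    show "\<exists>k. derived ?R k = {0}"
      by (rule cartan_solvable[OF lR, of id]) auto
    show "derived ?R j \<subseteq> cent ?L" if "\<forall>x\<in>derived ?R j. \<forall>y\<in>derived ?R j. ad x y = 0" for j
    proof (rule abelian_stable_ideal)
      show "M.subspace (derived ?R j)" using lie_closed_derived(1)[OF lR] by (simp add: lie_closed_def)
      show "derived ?R j \<subseteq> ?L" using dS[of j] by blast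
    qed (use that dI dA in auto)
  qed
  then show ?thesis using x by blast
qed

text \<open>Arbitrary ideals instead of \<open>Ad\<close>-stable ones: an element \<open>w\<close>
  of \<open>[L, a]\<close> is nilpotent with \<open>[w, [w, u]] = 0\<close> for all
  \<open>u\<close>, hence orthogonal to the Lie algebra under the trace form, hence central; and
  \<open>[L, L]\<close> contains no central element but zero.\<close>

lemma abelian_ideal_central:
  assumes a: "M.subspace a" "a \<subseteq> lie_algebra G" "\<And>x y. x \<in> lie_algebra G \<Longrightarrow> y \<in> a \<Longrightarrow> ad x y \<in> a"
    and ab: "\<And>x y. x \<in> a \<Longrightarrow> y \<in> a \<Longrightarrow> ad x y = 0"
  shows "a \<subseteq> cent (lie_algebra G)"
proof -
  let ?L = "lie_algebra G"
  have L: "lie_closed ?L" by (rule lie_closed_lie_algebra[OF red_alg])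
  have "w = 0" if w: "w \<in> brk ?L a" for w
  proof -
    have wa: "w \<in> a" using w brk_least[OF a(1,3)] by blast
    have nw: "nilp w"
    proof (rule nilp_brk[OF w])
      show "w ** x = x ** w" if "x \<in> a" for x using ab[OF wa that] by (simp only: ad_eq_0_iff)
    qed
    have "trace (w ** u) = 0" if u: "u \<in> ?L" for u
    proof (rule trace_nilp_ad2[OF nw])
      have "ad w u \<in> a" using a(3)[OF u wa] M.subspace_neg[OF a(1)] by (metis ad_antisym)
      then show "ad w (ad w u) = 0" using ab wa by blast
    qed
    then have "w \<in> cent ?L" using trace_radical_central wa a(2) by blast
    moreover have "w \<in> brk ?L ?L" using w brk_mono[OF order_refl a(2)] by blast
    ultimately show ?thesis using cent_brk by blast
  qed
  then have "ad x y = 0" if "x \<in> ?L" "y \<in> a" for x y using brk_in[OF that] by blast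
  then show ?thesis using a(2) by (auto simp: cent_def)
qed

text \<open>Since \<open>\<sigma>\<close> is not given on the group, \<open>Ad\<close>-stability of
  this radical is not at hand. The twisted form of Cartan's criterion gives solvability, and
  \<open>abelian_ideal_central\<close> treats the last derived term.\<close>

lemma twisted_radical_central:
  assumes s: "lie_involution (lie_algebra G) \<sigma>"
    and x: "x \<in> lie_algebra G" "\<And>y. y \<in> lie_algebra G \<Longrightarrow> trace (x ** y) + trace (\<sigma> x ** \<sigma> y) = 0"
  shows "x \<in> cent (lie_algebra G)"
proof -
  let ?L = "lie_algebra G"
  let ?R = "{x \<in> ?L. \<forall>y\<in>?L. trace (x ** y) + trace (\<sigma> x ** \<sigma> y) = 0}"
  have L: "lie_closed ?L" by (rule lie_closed_lie_algebra[OF red_alg])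
  have sL: "M.subspace ?L" and adL: "\<And>x y. x \<in> ?L \<Longrightarrow> y \<in> ?L \<Longrightarrow> ad x y \<in> ?L" using L by (auto simp: lie_closed_def)
  have sg: "\<And>x. x \<in> ?L \<Longrightarrow> \<sigma> x \<in> ?L" "\<And>x y. x \<in> ?L \<Longrightarrow> y \<in> ?L \<Longrightarrow> \<sigma> (x + y) = \<sigma> x + \<sigma> y"
    "\<And>x y. x \<in> ?L \<Longrightarrow> y \<in> ?L \<Longrightarrow> \<sigma> (ad x y) = ad (\<sigma> x) (\<sigma> y)" "\<And>c x. x \<in> ?L \<Longrightarrow> \<sigma> (c *\<^sub>m x) = c *\<^sub>m \<sigma> x"
    using s by (auto simp: lie_involution_def)
  have s0: "\<sigma> 0 = 0" using sg(4)[of 0 0] M.subspace_0[OF sL] by simp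
  have sR: "M.subspace ?R"
  proof (rule M.subspaceI)
    show "0 \<in> ?R" by (simp add: M.subspace_0[OF sL] s0 mm_simps)
    show "x + y \<in> ?R" if "x \<in> ?R" "y \<in> ?R" for x y
    proof -
      have "trace ((x + y) ** z) + trace (\<sigma> (x + y) ** \<sigma> z) = 0" if "z \<in> ?L" for z
      proof -
        have "trace ((x + y) ** z) + trace (\<sigma> (x + y) ** \<sigma> z)
          = (trace (x ** z) + trace (\<sigma> x ** \<sigma> z)) + (trace (y ** z) + trace (\<sigma> y ** \<sigma> z))"
          using \<open>x \<in> ?R\<close> \<open>y \<in> ?R\<close> by (simp add: sg mm_simps trace_simps)
        then show ?thesis using \<open>x \<in> ?R\<close> \<open>y \<in> ?R\<close> that by simp
      qed
      then show ?thesis using that M.subspace_add[OF sL] by simp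
    qed
    show "c *\<^sub>m x \<in> ?R" if "x \<in> ?R" for c x
    proof -
      have "trace ((c *\<^sub>m x) ** z) + trace (\<sigma> (c *\<^sub>m x) ** \<sigma> z) = 0" if "z \<in> ?L" for z
      proof -
        have "trace ((c *\<^sub>m x) ** z) + trace (\<sigma> (c *\<^sub>m x) ** \<sigma> z)
          = c * (trace (x ** z) + trace (\<sigma> x ** \<sigma> z))"
          using \<open>x \<in> ?R\<close> by (simp add: sg mm_simps trace_simps algebra_simps)
        then show ?thesis using \<open>x \<in> ?R\<close> that by simp
      qed
      then show ?thesis using that M.subspace_scale[OF sL] by simp
    qed
  qed
  have iR: "ad u v \<in> ?R" if u: "u \<in> ?L" and v: "v \<in> ?R" for u v
  proof -
    have "trace (ad u v ** y) + trace (\<sigma> (ad u v) ** \<sigma> y) = 0" if y: "y \<in> ?L" for y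
    proof -
      have "trace (ad u v ** y) + trace (\<sigma> (ad u v) ** \<sigma> y)
        = trace (- ad v u ** y) + trace (- ad (\<sigma> v) (\<sigma> u) ** \<sigma> y)"
      proof -
        have "\<sigma> (ad u v) = ad (\<sigma> u) (\<sigma> v)" using u v by (simp add: sg)
        then show ?thesis by (simp only: ad_antisym[of "\<sigma> u" "\<sigma> v"]) (simp only: ad_antisym[of u v])
      qed
      also have "\<dots> = - (trace (v ** ad u y) + trace (\<sigma> v ** \<sigma> (ad u y)))"
        using u y by (simp add: mm_simps trace_simps trace_ad sg)
      also have "trace (v ** ad u y) + trace (\<sigma> v ** \<sigma> (ad u y)) = 0" using v adL[OF u y] by simp
      finally show ?thesis by simp
    qed
    then show ?thesis using u v adL by simp
  qed
  have lR: "lie_closed ?R" using sR iR by (auto simp: lie_closed_def)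
  have RL: "?R \<subseteq> ?L" by blast
  have dI: "ad u v \<in> derived ?R j" if "u \<in> ?L" "v \<in> derived ?R j" for u v j
    using that
  proof (induction j arbitrary: u v)
    case (Suc j)
    then show ?case unfolding derived.simps by (intro brk_ideal[where L = ?L]) auto
  qed (use iR in simp)
  have dS: "derived ?R j \<subseteq> ?R" for j
    by (induction j) (use lie_closed_derived(2)[OF lR] in auto)
  have "?R \<subseteq> cent ?L"
  proof (rule solvable_central[OF L sR RL iR _ cent_brk])
    show "\<exists>k. derived ?R k = {0}"
      by (rule cartan_solvable[OF lR, of \<sigma>]) (auto simp: sg)
    show "derived ?R j \<subseteq> cent ?L" if "\<forall>x\<in>derived ?R j. \<forall>y\<in>derived ?R j. ad x y = 0" for j
    proof (rule abelian_ideal_central)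
      show "M.subspace (derived ?R j)" using lie_closed_derived(1)[OF lR] by (simp add: lie_closed_def)
      show "derived ?R j \<subseteq> ?L" using dS[of j] by blast
    qed (use that dI in auto)
  qed
  then show ?thesis using x by blast
qed

end

section \<open>Linear algebra\<close>

lemma subspace_image: "lin T \<Longrightarrow> M.subspace V \<Longrightarrow> M.subspace (T ` V)"
  by (rule MM.linear_subspace_image)

lemma injective_imp_onto:
  assumes T: "lin T" and V: "M.subspace V" "\<And>v. v \<in> V \<Longrightarrow> T v \<in> V"
    and inj: "\<And>v. v \<in> V \<Longrightarrow> T v = 0 \<Longrightarrow> v = 0" and v: "v \<in> V"
  shows "\<exists>w\<in>V. T w = v"
proof -
  have "inj_on T V"
  proof (rule inj_onI)
    fix x y assume "x \<in> V" "y \<in> V" "T x = T y"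
    then show "x = y" using inj[of "x - y"] V(1) MM.linear_diff[OF T, of x y] by (simp add: M.subspace_diff)
  qed
  then have "M.dim (T ` V) = M.dim V"
    using MM.dim_image_eq[OF T, of V] V(1) by (simp add: M.span_eq_iff[THEN iffD2])
  then have "T ` V = V"
    using V by (intro M.subspace_dim_equal subspace_image T) auto
  then show ?thesis using v by (metis imageE)
qed

text \<open>The condition on kernels makes \<open>T\<close> injective on its image, hence bijective
  there. Applied to a shifted semisimple operator it splits off one eigenspace.\<close>

lemma fitting:
  assumes T: "lin T" and V: "M.subspace V" "\<And>v. v \<in> V \<Longrightarrow> T v \<in> V"
    and ker: "\<And>v. v \<in> V \<Longrightarrow> T (T v) = 0 \<Longrightarrow> T v = 0" and v: "v \<in> V"
  shows "\<exists>a\<in>V. \<exists>b\<in>V. T a = 0 \<and> v = a + T b"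
proof -
  have "\<exists>w\<in>T ` V. T w = T v"
  proof (rule injective_imp_onto[OF T subspace_image[OF T V(1)]])
    show "T w \<in> T ` V" if "w \<in> T ` V" for w using that V(2) by blast
    show "w = 0" if "w \<in> T ` V" "T w = 0" for w using that ker by blast
  qed (use v in blast)
  then obtain b where b: "b \<in> V" "T (T b) = T v" by blast
  have "T (v - T b) = 0" using b(2) by (simp only: MM.linear_diff[OF T]) simp
  moreover have "v - T b \<in> V" by (rule M.subspace_diff[OF V(1) v V(2)[OF b(1)]])
  moreover have "v = (v - T b) + T b" by simp
  ultimately show ?thesis using b(1) by blast
qed

text \<open>Nondegeneracy is left to each use: it is asked of the second argument alone, on the
  subspace where a functional is to be represented.\<close>

locale pairing =
  fixes b :: "'k::field^'n^'n \<Rightarrow> 'k^'n^'n \<Rightarrow> 'k" and S :: "('k^'n^'n) set"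
  assumes S: "M.subspace S" and left: "\<And>v. linf (\<lambda>y. b y v)" and right: "\<And>y. linf (b y)"
begin

lemma solve_basis:
  assumes "finite F" "M.independent F"
    and "\<And>v. v \<in> M.span F \<Longrightarrow> (\<forall>y\<in>S. b y v = 0) \<Longrightarrow> v = 0"
  shows "\<exists>y\<in>S. \<forall>w\<in>F. b y w = c w"
  using assms
proof (induction F arbitrary: c rule: finite_induct)
  case empty
  then show ?case using M.subspace_0[OF S] by auto
next
  case (insert v F)
  have indF: "M.independent F" and vF: "v \<notin> M.span F"
    using insert.prems(1) insert.hyps(2) by (auto simp: M.independent_insert)
  have ndF: "u = 0" if "u \<in> M.span F" "\<forall>y\<in>S. b y u = 0" for u
    using insert.prems(2)[of u] that M.span_mono[of F "insert v F"] by blast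
  note IH = insert.IH[OF indF ndF]
  \<comment> \<open>If every \<open>y\<close> vanishing on \<open>F\<close> also vanished at
    \<open>v\<close>, subtracting from \<open>v\<close> its coordinates read off by the dual family
    \<open>d\<close> would leave a vector that all of \<open>S\<close> annihilates.\<close>
  have "\<exists>y0\<in>S. (\<forall>w\<in>F. b y0 w = 0) \<and> b y0 v \<noteq> 0"
  proof (rule ccontr)
    assume no: "\<not> ?thesis"
    have "\<forall>w. \<exists>y\<in>S. \<forall>w'\<in>F. b y w' = (if w' = w then 1 else 0)"
      using IH[of "\<lambda>w'. if w' = _ then 1 else 0"] by blast
    then obtain d where d: "\<And>w. d w \<in> S" "\<And>w w'. w' \<in> F \<Longrightarrow> b (d w) w' = (if w' = w then 1 else 0)"
      by metis
    let ?u = "\<Sum>w\<in>F. b (d w) v *\<^sub>m w"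
    have "b y (v - ?u) = 0" if y: "y \<in> S" for y
    proof -
      let ?y = "y - (\<Sum>w\<in>F. b y w *\<^sub>m d w)"
      have exp: "b ?y x = b y x - (\<Sum>w\<in>F. b y w * b (d w) x)" for x
        by (simp add: MK.linear_diff[OF left] MK.linear_sum[OF left] MK.linear_scale[OF left])
      have "?y \<in> S" using y d(1) by (intro M.subspace_diff[OF S] M.subspace_sum[OF S] M.subspace_scale[OF S])
      moreover have "b ?y w = 0" if "w \<in> F" for w
        unfolding exp using that insert.hyps(1) by (simp add: d(2) if_distrib[of "\<lambda>x. _ * x"] sum.delta cong: if_cong)
      ultimately have "b ?y v = 0" using no by blast
      then show ?thesis
        by (simp add: exp MK.linear_diff[OF right] MK.linear_sum[OF right] MK.linear_scale[OF right] mult.commute)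
    qed
    moreover have u: "?u \<in> M.span F" by (intro M.span_sum M.span_scale M.span_base)
    have "v - ?u \<in> M.span (insert v F)"
    proof (rule M.span_diff)
      show "v \<in> M.span (insert v F)" by (rule M.span_base) simp
      show "?u \<in> M.span (insert v F)" using u M.span_mono[of F "insert v F"] by blast
    qed
    ultimately have "v - ?u = 0" using insert.prems(2) by blast
    then show False using u vF by simp
  qed
  then obtain y0 where y0: "y0 \<in> S" "\<forall>w\<in>F. b y0 w = 0" "b y0 v \<noteq> 0" by blast
  obtain y1 where y1: "y1 \<in> S" "\<forall>w\<in>F. b y1 w = c w" using IH by blast
  let ?y = "y1 + ((c v - b y1 v) / b y0 v) *\<^sub>m y0"
  have "b ?y x = b y1 x + ((c v - b y1 v) / b y0 v) * b y0 x" for x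
    by (simp add: MK.linear_add[OF left] MK.linear_scale[OF left])
  moreover have "?y \<in> S" using y0 y1 S by (simp add: M.subspace_add M.subspace_scale)
  ultimately show ?case using y0 y1 by (intro bexI[of _ ?y]) auto
qed

lemma represent:
  assumes V: "M.subspace V" "\<And>v. v \<in> V \<Longrightarrow> (\<forall>y\<in>S. b y v = 0) \<Longrightarrow> v = 0"
    and f: "\<And>x y. x \<in> V \<Longrightarrow> y \<in> V \<Longrightarrow> f (x + y) = f x + f y" "\<And>c x. x \<in> V \<Longrightarrow> f (c *\<^sub>m x) = c * f x"
  shows "\<exists>y\<in>S. \<forall>v\<in>V. b y v = f v"
proof -
  obtain F where F: "F \<subseteq> V" "M.independent F" "V \<subseteq> M.span F" using M.basis_exists by metis
  have FV: "M.span F \<subseteq> V" using F(1) V(1) by (rule M.span_minimal)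
  have "\<exists>y\<in>S. \<forall>w\<in>F. b y w = f w"
    by (rule solve_basis) (use F FV V(2) M.finiteI_independent in auto)
  then obtain y where y: "y \<in> S" "\<forall>w\<in>F. b y w = f w" by blast
  have f0: "f 0 = 0" using f(2)[of 0 0] M.subspace_0[OF V(1)] by simp
  have "v \<in> V \<and> b y v = f v" if "v \<in> M.span F" for v
    using that
  proof (induction rule: M.span_induct_alt)
    case (step c x z)
    have "x \<in> V" using step F by blast
    then show ?case using step y f V(1)
      by (simp add: M.subspace_add M.subspace_scale MK.linear_add[OF right] MK.linear_scale[OF right])
  qed (simp add: f0 MK.linear_0[OF right] M.subspace_0[OF V(1)])
  then show ?thesis using y F by blast
qed

end

section \<open>Triples spanning \<open>sl\<^sub>2\<close>\<close>

locale sl2_triple =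
  fixes e h f :: "'k::{alg_closed_field, field_char_0}^'n^'n"
  assumes ef: "ad e f = h" and he: "ad h e = 2 *\<^sub>m e" and hf: "ad h f = -2 *\<^sub>m f"
begin

abbreviation "E \<equiv> ad e"
abbreviation "H \<equiv> ad h"
abbreviation "F \<equiv> ad f"

lemma nilp_e: "nilp e" by (rule nilp_eigen[OF he]) simp

lemma nilp_f: "nilp f" by (rule nilp_eigen[OF hf]) simp

lemma EF: "E (F x) = F (E x) + H x"
  using jacobi[of e f x] ef by simp

lemma HE: "H (E x) = E (H x) + 2 *\<^sub>m E x"
  using jacobi[of h e x] he by (simp add: ad_simps)

lemma HF: "H (F x) = F (H x) - 2 *\<^sub>m F x"
  using jacobi[of h f x] hf by (simp add: ad_simps)

lemma H_E_pow: "H ((E ^^ i) x) = (E ^^ i) (H x) + (2 * of_nat i) *\<^sub>m (E ^^ i) x"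
  by (induction i) (simp_all add: HE ad_simps distrib_left M.scale_left_distrib add_ac)

lemma H_F_pow: "H ((F ^^ i) x) = (F ^^ i) (H x) - (2 * of_nat i) *\<^sub>m (F ^^ i) x"
proof (induction i)
  case (Suc i)
  have "H ((F ^^ Suc i) x) = F (H ((F ^^ i) x)) - 2 *\<^sub>m F ((F ^^ i) x)" by (simp add: HF)
  also have "F (H ((F ^^ i) x)) = (F ^^ Suc i) (H x) - (2 * of_nat i) *\<^sub>m (F ^^ Suc i) x"
    unfolding Suc by (simp add: ad_simps)
  finally show ?case by (simp add: vec_eq_iff mscale_def algebra_simps)
qed simp

text \<open>The commutation rule of \<open>E\<close> with \<open>F^(i+1)\<close> in the enveloping
  algebra; at the end of an \<open>F\<close>-string it determines the highest weight.\<close>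

lemma E_F_pow: "E ((F ^^ Suc i) x) =
  (F ^^ Suc i) (E x) + of_nat (Suc i) *\<^sub>m ((F ^^ i) (H x) - of_nat i *\<^sub>m (F ^^ i) x)"
proof (induction i)
  case 0
  show ?case by (simp add: EF)
next
  case (Suc i)
  let ?P = "(F ^^ Suc i) (H x)" and ?Q = "(F ^^ Suc i) x" and ?c = "of_nat i :: 'k"
  have "E ((F ^^ Suc (Suc i)) x) = F (E ?Q) + H ?Q" by (simp add: EF)
  also have "F (E ?Q) = (F ^^ Suc (Suc i)) (E x) + (?c + 1) *\<^sub>m (?P - ?c *\<^sub>m ?Q)"
    unfolding Suc by (simp add: ad_simps add.commute)
  also have "H ?Q = ?P - (2 * (?c + 1)) *\<^sub>m ?Q" unfolding H_F_pow by (simp add: add.commute)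
  also have "(F ^^ Suc (Suc i)) (E x) + (?c + 1) *\<^sub>m (?P - ?c *\<^sub>m ?Q) + (?P - (2 * (?c + 1)) *\<^sub>m ?Q)
    = (F ^^ Suc (Suc i)) (E x) + (?c + 1 + 1) *\<^sub>m (?P - (?c + 1) *\<^sub>m ?Q)"
    by (simp add: vec_eq_iff mscale_def algebra_simps del: funpow.simps)
  finally show ?case by (simp add: add_ac)
qed

lemma E_pow_zero: "\<exists>k. \<forall>x. (E ^^ k) x = 0" by (rule nilp_ad[OF nilp_e])

lemma F_pow_zero: "\<exists>k. \<forall>x. (F ^^ k) x = 0" by (rule nilp_ad[OF nilp_f])

lemma highest_weight:
  assumes "E x = 0" "H x = c *\<^sub>m x" "x \<noteq> 0"
  obtains m where "c = of_nat m" "(F ^^ m) x \<noteq> 0" "\<And>i. i > m \<Longrightarrow> (F ^^ i) x = 0"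
proof -
  define N where "N = (LEAST N. (F ^^ N) x = 0)"
  have ex: "\<exists>N. (F ^^ N) x = 0" using F_pow_zero by blast
  have N: "(F ^^ N) x = 0" unfolding N_def using ex by (rule LeastI_ex)
  then have "N \<noteq> 0" using assms(3) by (intro notI) simp
  then obtain m where m: "N = Suc m" by (cases N) auto
  then have nz: "(F ^^ m) x \<noteq> 0" using not_less_Least[of m "\<lambda>N. (F ^^ N) x = 0"] by (simp add: N_def)
  have "0 = E ((F ^^ Suc m) x)" using N m by (simp add: ad_simps)
  also have "\<dots> = of_nat (Suc m) *\<^sub>m (c *\<^sub>m (F ^^ m) x - of_nat m *\<^sub>m (F ^^ m) x)"
    unfolding E_F_pow assms
    by (simp add: MM.linear_0[OF lin_funpow[OF lin_ad]] MM.linear_scale[OF lin_funpow[OF lin_ad]]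
        del: funpow.simps of_nat_Suc)
  also have "\<dots> = (of_nat (Suc m) * (c - of_nat m)) *\<^sub>m (F ^^ m) x"
    by (simp add: vec_eq_iff mscale_def algebra_simps del: of_nat_Suc)
  finally have "of_nat (Suc m) * (c - of_nat m) = 0" using nz by (metis M.scale_eq_0_iff)
  then have "c = of_nat m" by (simp del: of_nat_Suc)
  moreover have "(F ^^ i) x = 0" if "i > m" for i
  proof -
    have "i = (i - N) + N" using that m by simp
    then have "(F ^^ i) x = (F ^^ (i - N)) ((F ^^ N) x)" by (metis funpow_add comp_apply)
    then show ?thesis using N by (simp add: MM.linear_0[OF lin_funpow[OF lin_ad]])
  qed
  ultimately show ?thesis using nz that by blast
qed

lemma raise_to_highest:
  assumes "x \<noteq> 0"
  obtains k where "(E ^^ k) x \<noteq> 0" "E ((E ^^ k) x) = 0"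
proof -
  define N where "N = (LEAST N. (E ^^ N) x = 0)"
  have ex: "\<exists>N. (E ^^ N) x = 0" using E_pow_zero by blast
  have N: "(E ^^ N) x = 0" unfolding N_def using ex by (rule LeastI_ex)
  then have "N \<noteq> 0" using assms by (intro notI) simp
  then obtain m where m: "N = Suc m" by (cases N) auto
  then have "(E ^^ m) x \<noteq> 0" using not_less_Least[of m "\<lambda>N. (E ^^ N) x = 0"] by (simp add: N_def)
  then show ?thesis using that N m by simp
qed

lemma weight_int:
  assumes "H x = c *\<^sub>m x" "x \<noteq> 0"
  shows "\<exists>z. c = of_int z"
proof -
  obtain k where k: "(E ^^ k) x \<noteq> 0" "E ((E ^^ k) x) = 0" using raise_to_highest[OF assms(2)] .
  have "H ((E ^^ k) x) = (c + 2 * of_nat k) *\<^sub>m (E ^^ k) x"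
    unfolding H_E_pow assms by (simp add: MM.linear_scale[OF lin_funpow[OF lin_ad]] M.scale_left_distrib)
  then obtain m where "c + 2 * of_nat k = of_nat m" using highest_weight[OF k(2) _ k(1)] by blast
  then have "c = of_int (int m - 2 * int k)" by (simp add: algebra_simps)
  then show ?thesis by blast
qed

text \<open>A comparison of \<open>F\<close>-strings. From \<open>F^N x = 0\<close> follows
  \<open>F^N u = 0\<close>, so the string of \<open>x\<close> is at least as long as that of
  \<open>u\<close>, which ends at \<open>F^m u\<close>. With \<open>F^n x\<close> the end of the
  string of \<open>x\<close>, the rule for \<open>E\<close> gives
  \<open>(m - n) F^n x + F^n u = 0\<close>, impossible both for \<open>n = m\<close> and for
  \<open>n > m\<close>.\<close>

lemma highest_diag:
  assumes "E x = 0" "H x = c *\<^sub>m x + u" "H u = c *\<^sub>m u"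
  shows "u = 0"
proof (rule ccontr)
  assume u: "u \<noteq> 0"
  have lf: "lin (F ^^ j)" for j by (rule lin_funpow[OF lin_ad])
  have "H (E x) = E (H x) + 2 *\<^sub>m E x" by (rule HE)
  then have Eu: "E u = 0" using assms by (simp add: ad_simps)
  obtain m where m: "c = of_nat m" "(F ^^ m) u \<noteq> 0" "\<And>i. i > m \<Longrightarrow> (F ^^ i) u = 0"
    using highest_weight[OF Eu assms(3) u] by blast
  define N where "N = (LEAST N. (F ^^ N) x = 0)"
  have ex: "\<exists>N. (F ^^ N) x = 0" using F_pow_zero by blast
  have N: "(F ^^ N) x = 0" unfolding N_def using ex by (rule LeastI_ex)
  have "0 = H ((F ^^ N) x)" using N by (simp add: ad_simps)
  also have "\<dots> = (F ^^ N) u"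
    unfolding H_F_pow assms using N by (simp add: MM.linear_add[OF lf] MM.linear_scale[OF lf])
  finally have FNu: "(F ^^ N) u = 0" by simp
  have "N > m"
  proof (rule ccontr)
    assume "\<not> N > m"
    then have "m = (m - N) + N" by simp
    then have "(F ^^ m) u = (F ^^ (m - N)) ((F ^^ N) u)" by (metis funpow_add comp_apply)
    then show False using FNu m(2) by (simp add: MM.linear_0[OF lf])
  qed
  then obtain n where n: "N = Suc n" "n \<ge> m" by (cases N) auto
  have nz: "(F ^^ n) x \<noteq> 0" using n not_less_Least[of n "\<lambda>N. (F ^^ N) x = 0"] by (simp add: N_def)
  have "0 = E ((F ^^ Suc n) x)" using N n by (simp add: ad_simps)
  also have "\<dots> = of_nat (Suc n) *\<^sub>m ((c - of_nat n) *\<^sub>m (F ^^ n) x + (F ^^ n) u)"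
    unfolding E_F_pow assms by (simp add: MM.linear_0[OF lf] MM.linear_add[OF lf]
        MM.linear_scale[OF lf] del: funpow.simps of_nat_Suc)
      (simp add: vec_eq_iff mscale_def algebra_simps del: funpow.simps of_nat_Suc)
  finally have z: "(c - of_nat n) *\<^sub>m (F ^^ n) x + (F ^^ n) u = 0" by (metis M.scale_eq_0_iff of_nat_neq_0)
  show False
  proof (cases "n = m")
    case True
    then show ?thesis using z m by simp
  next
    case False
    then have "(of_nat m - of_nat n :: 'k) *\<^sub>m (F ^^ n) x = 0" using z m n by simp
    then show ?thesis using False nz by (simp add: of_nat_eq_iff)
  qed
qed

lemma opposite: "sl2_triple f (- h) e"
  by unfold_locales (simp_all add: ad_simps he hf ad_antisym[of f e] ef)

text \<open>It suffices that \<open>E F\<close> is injective on the space of the positive weight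
  \<open>c\<close>. If \<open>E (F x) = 0\<close> and \<open>E^(i+1) x = 0\<close>, the rule for the
  opposite triple gives \<open>(i + 1) (c + i) E^i x = 0\<close>; descent in \<open>i\<close> ends
  at \<open>x = 0\<close>.\<close>

lemma E_onto:
  assumes "H a = of_nat (Suc m) *\<^sub>m a"
  shows "\<exists>b. E b = a \<and> H b = (of_nat (Suc m) - 2) *\<^sub>m b"
proof -
  interpret opp: sl2_triple f "- h" e by (rule opposite)
  let ?c = "of_nat (Suc m) :: 'k"
  let ?W = "{x. H x = ?c *\<^sub>m x}"
  have HF': "H (F x) = (?c - 2) *\<^sub>m F x" if "x \<in> ?W" for x
    using that by (simp add: HF ad_simps msimps del: of_nat_Suc)
  have "\<exists>w\<in>?W. E (F w) = a"
  proof (rule injective_imp_onto)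
    show "lin (\<lambda>x. E (F x))" by (rule linI) (simp_all add: ad_simps)
    show "M.subspace ?W" by (rule M.subspaceI) (simp_all add: ad_simps msimps mult.commute del: of_nat_Suc)
    show "E (F x) \<in> ?W" if "x \<in> ?W" for x
      using HF'[OF that] by (simp add: HE ad_simps msimps del: of_nat_Suc)
    show "x = 0" if x: "x \<in> ?W" "E (F x) = 0" for x
    proof -
      have lE: "lin (E ^^ j)" for j by (rule lin_funpow[OF lin_ad])
      have down: "(E ^^ i) x = 0" if i: "(E ^^ Suc i) x = 0" for i
      proof -
        have "0 = F ((E ^^ Suc i) x)" using i by (simp add: ad_simps)
        also have "\<dots> = (E ^^ i) (E (F x)) + of_nat (Suc i) *\<^sub>m (- (?c *\<^sub>m (E ^^ i) x) - of_nat i *\<^sub>m (E ^^ i) x)"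
          by (subst opp.E_F_pow) (use x(1) in \<open>simp add: ad_simps MM.linear_scale[OF lE] MM.linear_neg[OF lE]
            funpow_swap1 del: of_nat_Suc\<close>)
        also have "\<dots> = - ((of_nat (Suc i) * (?c + of_nat i)) *\<^sub>m (E ^^ i) x)"
          using x(2) by (simp add: MM.linear_0[OF lE] del: of_nat_Suc)
            (simp add: vec_eq_iff mscale_def algebra_simps del: of_nat_Suc)
        also have "of_nat (Suc i) * (?c + of_nat i) = (of_nat (Suc i * (Suc m + i)) :: 'k)"
          by (simp only: of_nat_mult of_nat_add)
        finally have "(of_nat (Suc i * (Suc m + i)) :: 'k) *\<^sub>m (E ^^ i) x = 0"
          by (metis neg_0_equal_iff_equal)
        moreover have "(of_nat (Suc i * (Suc m + i)) :: 'k) \<noteq> 0" by (simp only: of_nat_eq_0_iff) simp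
        ultimately show ?thesis by (simp only: M.scale_eq_0_iff) blast
      qed
      obtain k where "(E ^^ k) x = 0" using E_pow_zero by blast
      then show ?thesis by (induction k) (use down in auto)
    qed
  qed (use assms in simp)
  then show ?thesis using HF' by blast
qed

text \<open>Semisimplicity of \<open>H\<close>. The defect \<open>u\<close> is raised to a highest
  weight vector \<open>u'\<close>; the raised vector \<open>x\<close> need not be killed by
  \<open>E\<close>, and is corrected by some \<open>b\<close> of the same weight with
  \<open>E b = E x\<close>, after which \<open>highest_diag\<close> applies.\<close>

lemma H_diag:
  assumes "shift H c (shift H c v) = 0"
  shows "shift H c v = 0"
proof (rule ccontr)
  define u where "u = shift H c v"
  assume "shift H c v \<noteq> 0"
  then obtain k where k: "(E ^^ k) u \<noteq> 0" "E ((E ^^ k) u) = 0" using raise_to_highest unfolding u_def by blast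
  have lE: "lin (E ^^ j)" for j by (rule lin_funpow[OF lin_ad])
  define x u' where "x = (E ^^ k) v" and "u' = (E ^^ k) u"
  define c' where "c' = c + 2 * of_nat k"
  have Hv: "H v = c *\<^sub>m v + u" by (simp add: u_def shift_def)
  have Hu: "H u = c *\<^sub>m u" using assms by (simp add: u_def shift_def)
  have Hx: "H x = c' *\<^sub>m x + u'"
    by (simp add: x_def u'_def c'_def H_E_pow Hv MM.linear_add[OF lE] MM.linear_scale[OF lE] msimps)
  have Hu': "H u' = c' *\<^sub>m u'"
    by (simp add: u'_def c'_def H_E_pow Hu MM.linear_add[OF lE] MM.linear_scale[OF lE] msimps)
  obtain m where m: "c' = of_nat m" using highest_weight[of u' c'] k Hu' by (auto simp: u'_def)
  have "H (E x) = E (H x) + 2 *\<^sub>m E x" by (rule HE)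
  also have "\<dots> = of_nat (Suc (Suc m)) *\<^sub>m E x"
    using k(2) by (simp add: Hx ad_simps msimps m u'_def)
  finally obtain b where b: "E b = E x" "H b = (of_nat (Suc (Suc m)) - 2) *\<^sub>m b" using E_onto by blast
  have "H b = c' *\<^sub>m b" using b(2) by (simp add: m)
  then have "H (x - b) = c' *\<^sub>m (x - b) + u'" by (simp add: ad_simps Hx msimps)
  moreover have "E (x - b) = 0" using b(1) by (simp add: ad_simps)
  ultimately have "u' = 0" using highest_diag Hu' by blast
  then show False using k(1) by (simp add: u'_def)
qed

text \<open>Conjugating \<open>(e, h, f)\<close> inside \<open>SL\<^sub>2\<close> moves \<open>h\<close> to \<open>e + f\<close>.\<close>

lemma rotated: "sl2_triple ((1/2) *\<^sub>m (h - e + f)) (e + f) ((1/2) *\<^sub>m (h + e - f))"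
proof -
  have "ad e h = - (2 *\<^sub>m e)" "ad f h = 2 *\<^sub>m f" "ad f e = - h"
    using he hf ef ad_antisym[of e h] ad_antisym[of f h] ad_antisym[of f e] by simp_all
  show ?thesis
    by unfold_locales
      (simp_all only: ad_simps he hf ef \<open>ad e h = _\<close> \<open>ad f h = _\<close> \<open>ad f e = _\<close>,
       simp_all add: vec_eq_iff mscale_def field_simps)
qed

end

text \<open>The product of the annihilating polynomials of the basis vectors annihilates
  \<open>T\<close>, and eigenvalues are among its roots.\<close>

lemma finite_eigenvalues:
  assumes T: "lin (T :: 'k::field^'n^'n \<Rightarrow> _)"
  shows "finite {c. \<exists>v. v \<noteq> 0 \<and> T v = c *\<^sub>m v}"
proof -
  have "\<exists>q. \<forall>v. q v \<noteq> 0 \<and> popT T (q v) v = 0" using annihilating_poly[OF T] by metis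
  then obtain q where q: "\<And>v. q v \<noteq> 0" "\<And>v. popT T (q v) v = 0" by blast
  define Q where "Q = (\<Prod>p\<in>(UNIV :: ('n \<times> 'n) set). q (munit p))"
  have Q0: "Q \<noteq> 0" unfolding Q_def using q(1) by simp
  have lp: "lin (popT T p)" for p
    by (induction p) (auto intro!: linI simp: popT_pCons[OF T] MM.linear_add MM.linear_scale MM.linear_add[OF T]
        MM.linear_scale[OF T] msimps algebra_simps)
  have Qm: "popT T Q (munit p) = 0" for p
  proof -
    have "Q = (\<Prod>r\<in>UNIV - {p}. q (munit r)) * q (munit p)"
      unfolding Q_def by (subst prod.remove[of _ p]) (simp_all add: mult.commute)
    then show ?thesis by (simp add: popT_mult[OF T] q(2) MM.linear_0[OF lp])
  qed
  have Qv: "popT T Q v = 0" for v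
  proof -
    have "v \<in> M.span (range munit)" by (simp add: M.span_Basis)
    then show ?thesis
      by (induction rule: M.span_induct_alt)
        (auto simp: MM.linear_0[OF lp] MM.linear_add[OF lp] MM.linear_scale[OF lp] Qm)
  qed
  have "poly Q c = 0" if "v \<noteq> 0" "T v = c *\<^sub>m v" for c v
  proof -
    have "popT T p v = poly p c *\<^sub>m v" for p
      by (induction p) (simp_all add: popT_pCons[OF T] MM.linear_scale[OF T] that(2) msimps mult.commute)
    then show ?thesis using Qv[of v] that(1) by simp
  qed
  then have "{c. \<exists>v. v \<noteq> 0 \<and> T v = c *\<^sub>m v} \<subseteq> {c. poly Q c = 0}" by blast
  then show ?thesis using poly_roots_finite[OF Q0] finite_subset by blast
qed

section \<open>Symmetric pairs of rank one\<close>

text \<open>What the Lie-theoretic part retains of the reductive group; the final theorem supplies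
  these facts from the section on reductive Lie algebras.\<close>

locale sym_lie =
  fixes L :: "('k::{alg_closed_field, field_char_0}^'n^'n) set" and \<sigma> :: "'k^'n^'n \<Rightarrow> 'k^'n^'n"
  assumes L: "lie_closed L" and inv: "lie_involution L \<sigma>"
    and cent_brk: "cent L \<inter> brk L L = {0}"
    and cent_nilp: "x \<in> cent L \<Longrightarrow> nilp x \<Longrightarrow> x = 0"
    and rad_trace: "x \<in> L \<Longrightarrow> (\<And>y. y \<in> L \<Longrightarrow> trace (x ** y) = 0) \<Longrightarrow> x \<in> cent L"
    and rad_twisted: "x \<in> L \<Longrightarrow> (\<And>y. y \<in> L \<Longrightarrow> trace (x ** y) + trace (\<sigma> x ** \<sigma> y) = 0) \<Longrightarrow> x \<in> cent L"
begin

lemma sL: "M.subspace L" and adL: "x \<in> L \<Longrightarrow> y \<in> L \<Longrightarrow> ad x y \<in> L"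
  using L by (auto simp: lie_closed_def)

lemma sig: "x \<in> L \<Longrightarrow> \<sigma> x \<in> L" "x \<in> L \<Longrightarrow> \<sigma> (\<sigma> x) = x"
  "x \<in> L \<Longrightarrow> y \<in> L \<Longrightarrow> \<sigma> (x + y) = \<sigma> x + \<sigma> y"
  "x \<in> L \<Longrightarrow> y \<in> L \<Longrightarrow> \<sigma> (ad x y) = ad (\<sigma> x) (\<sigma> y)" "x \<in> L \<Longrightarrow> \<sigma> (c *\<^sub>m x) = c *\<^sub>m \<sigma> x"
  using inv by (auto simp: lie_involution_def)

lemma sig_0: "\<sigma> 0 = 0"
  using sig(5)[of 0 0] M.subspace_0[OF sL] by simp

lemma sig_neg: "x \<in> L \<Longrightarrow> \<sigma> (- x) = - \<sigma> x"
  using sig(5)[of x "-1"] by simp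

lemma sig_diff: "x \<in> L \<Longrightarrow> y \<in> L \<Longrightarrow> \<sigma> (x - y) = \<sigma> x - \<sigma> y"
  using sig(3)[of x "- y"] sig_neg[of y] M.subspace_neg[OF sL, of y] by simp

abbreviation "L0 \<equiv> plus_part L \<sigma>"
abbreviation "L1 \<equiv> minus_part L \<sigma>"

lemma L0_L: "x \<in> L0 \<Longrightarrow> x \<in> L" and L1_L: "x \<in> L1 \<Longrightarrow> x \<in> L"
  and sig0: "x \<in> L0 \<Longrightarrow> \<sigma> x = x" and sig1: "x \<in> L1 \<Longrightarrow> \<sigma> x = - x"
  by (auto simp: plus_part_def minus_part_def)

lemma sL0: "M.subspace L0"
  by (rule M.subspaceI) (auto simp: plus_part_def M.subspace_0[OF sL] sig_0 sig M.subspace_add[OF sL] M.subspace_scale[OF sL])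

lemma sL1: "M.subspace L1"
  by (rule M.subspaceI) (auto simp: minus_part_def M.subspace_0[OF sL] sig_0 sig M.subspace_add[OF sL] M.subspace_scale[OF sL])

lemma ad00: "x \<in> L0 \<Longrightarrow> y \<in> L0 \<Longrightarrow> ad x y \<in> L0"
  and ad01: "x \<in> L0 \<Longrightarrow> y \<in> L1 \<Longrightarrow> ad x y \<in> L1"
  and ad10: "x \<in> L1 \<Longrightarrow> y \<in> L0 \<Longrightarrow> ad x y \<in> L1"
  and ad11: "x \<in> L1 \<Longrightarrow> y \<in> L1 \<Longrightarrow> ad x y \<in> L0"
  by (auto simp: plus_part_def minus_part_def adL sig ad_simps)

lemma L_split: assumes "x \<in> L" obtains a b where "a \<in> L0" "b \<in> L1" "x = a + b"
proof
  show "(1/2) *\<^sub>m (x + \<sigma> x) \<in> L0" using assms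
    by (simp add: plus_part_def sig M.subspace_add[OF sL] M.subspace_scale[OF sL] add.commute)
  have d: "x - \<sigma> x \<in> L" using assms by (simp add: sig M.subspace_diff[OF sL])
  have "\<sigma> (x - \<sigma> x) = - (x - \<sigma> x)" using assms by (simp add: sig sig_diff)
  then have "\<sigma> ((1/2) *\<^sub>m (x - \<sigma> x)) = - ((1/2) *\<^sub>m (x - \<sigma> x))"
    unfolding sig(5)[OF d] by (simp only: M.scale_minus_right)
  then show "(1/2) *\<^sub>m (x - \<sigma> x) \<in> L1" using M.subspace_scale[OF sL d]
    unfolding minus_part_def by blast
  show "x = (1/2) *\<^sub>m (x + \<sigma> x) + (1/2) *\<^sub>m (x - \<sigma> x)"
    by (simp add: vec_eq_iff mscale_def field_simps)
qed

lemma L0_L1: "x \<in> L0 \<Longrightarrow> x \<in> L1 \<Longrightarrow> x = 0"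
proof -
  assume "x \<in> L0" "x \<in> L1"
  then have "x = - x" using sig0 sig1 by metis
  then have "(2 :: 'k) *\<^sub>m x = 0" using M.scale_left_distrib[of 1 1 x] by (simp add: eq_neg_iff_add_eq_0)
  then show "x = 0" by simp
qed

text \<open>Adding the \<open>\<sigma>\<close>-transform makes \<open>L0\<close> and
  \<open>L1\<close> orthogonal, while on \<open>L1\<close> the form is twice the trace form, so that
  its values there can be compared with traces of powers.\<close>

definition B :: "'k^'n^'n \<Rightarrow> 'k^'n^'n \<Rightarrow> 'k" where
  "B x y = trace (x ** y) + trace (\<sigma> x ** \<sigma> y)"

lemma B_sym: "B x y = B y x"
  by (simp only: B_def trace_mul_sym[of x y] trace_mul_sym[of "\<sigma> x" "\<sigma> y"])

lemma B_add1: "x \<in> L \<Longrightarrow> y \<in> L \<Longrightarrow> B (x + y) z = B x z + B y z"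
  by (simp add: B_def sig mm_simps trace_simps)

lemma B_scale1: "x \<in> L \<Longrightarrow> B (c *\<^sub>m x) z = c * B x z"
  by (simp add: B_def sig mm_simps trace_simps algebra_simps)

lemma B_neg1: "x \<in> L \<Longrightarrow> B (- x) z = - B x z"
  using B_scale1[of x "-1" z] by simp

lemma B_diff1: "x \<in> L \<Longrightarrow> y \<in> L \<Longrightarrow> B (x - y) z = B x z - B y z"
  using B_add1[of x "- y" z] B_neg1[of y z] M.subspace_neg[OF sL, of y] by simp

lemma B_add2: "x \<in> L \<Longrightarrow> y \<in> L \<Longrightarrow> B z (x + y) = B z x + B z y"
  by (simp only: B_sym[of z]) (rule B_add1)

lemma B_scale2: "x \<in> L \<Longrightarrow> B z (c *\<^sub>m x) = c * B z x"
  by (simp only: B_sym[of z]) (rule B_scale1)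

lemma B_neg2: "x \<in> L \<Longrightarrow> B z (- x) = - B z x"
  by (simp only: B_sym[of z]) (rule B_neg1)

lemma B_diff2: "x \<in> L \<Longrightarrow> y \<in> L \<Longrightarrow> B z (x - y) = B z x - B z y"
  by (simp only: B_sym[of z]) (rule B_diff1)

lemma B_0: "B 0 z = 0" "B z 0 = 0"
  by (simp_all add: B_def sig_0 mm_simps)

lemma B_inv: "x \<in> L \<Longrightarrow> y \<in> L \<Longrightarrow> z \<in> L \<Longrightarrow> B (ad x y) z = B x (ad y z)"
  by (simp add: B_def sig trace_ad)

lemma B_ad_swap: "x \<in> L \<Longrightarrow> y \<in> L \<Longrightarrow> z \<in> L \<Longrightarrow> B x (ad y z) = - B (ad y x) z"
  using B_inv[of x y z] ad_antisym[of x y] B_neg1[OF adL, of y x z] by simp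

lemma B_01: "x \<in> L0 \<Longrightarrow> y \<in> L1 \<Longrightarrow> B x y = 0"
  by (simp add: B_def sig0 sig1 mm_simps trace_neg)

lemma B_11: "x \<in> L1 \<Longrightarrow> y \<in> L1 \<Longrightarrow> B x y = 2 * trace (x ** y)"
  by (simp add: B_def sig1 mm_simps)

lemma B_sig: "x \<in> L \<Longrightarrow> y \<in> L \<Longrightarrow> B (\<sigma> x) (\<sigma> y) = B x y"
  by (simp add: B_def sig)

lemma rad_B: "x \<in> L \<Longrightarrow> (\<And>y. y \<in> L \<Longrightarrow> B x y = 0) \<Longrightarrow> x \<in> cent L"
  using rad_twisted by (simp add: B_def)

lemma rad_B0:
  assumes "x \<in> L0" "\<And>y. y \<in> L0 \<Longrightarrow> B x y = 0" shows "x \<in> cent L"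
proof (rule rad_B[OF L0_L[OF assms(1)]])
  fix y assume "y \<in> L"
  then obtain a b where "a \<in> L0" "b \<in> L1" "y = a + b" by (rule L_split)
  then show "B x y = 0" using assms B_01 by (simp add: B_add2 L0_L L1_L)
qed

lemma rad_B1:
  assumes "x \<in> L1" "\<And>y. y \<in> L1 \<Longrightarrow> B x y = 0" shows "x \<in> cent L"
proof (rule rad_B[OF L1_L[OF assms(1)]])
  fix y assume "y \<in> L"
  then obtain a b where "a \<in> L0" "b \<in> L1" "y = a + b" by (rule L_split)
  then show "B x y = 0" using assms B_01[of a x] B_sym[of x a] by (simp add: B_add2 L0_L L1_L)
qed

lemma cent_brk_0: "x \<in> cent L \<Longrightarrow> x \<in> brk L L \<Longrightarrow> x = 0"
  using cent_brk by blast

subsection \<open>The Jacobson--Morozov theorem\<close>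

text \<open>Otherwise a functional separates \<open>e\<close> from the image and is
  \<open>trace (y ** v)\<close> on their span: a vector of that span orthogonal to \<open>L\<close>
  is central and nilpotent, hence zero. Then \<open>[e, [e, y]]\<close> is orthogonal to
  \<open>L\<close>, so it is central in \<open>[L, L]\<close> and vanishes, and
  \<open>trace_nilp_ad2\<close> contradicts \<open>trace (y ** e) = 1\<close>.\<close>

lemma e_in_image:
  assumes e: "e \<in> L" "nilp e"
  shows "e \<in> (\<lambda>f. ad e (ad e f)) ` L" (is "e \<in> ?I")
proof (rule ccontr)
  assume no: "e \<notin> ?I"
  have lI: "lin (\<lambda>f. ad e (ad e f))" by (rule linI) (simp_all add: ad_simps)
  have sI: "M.subspace ?I" using MM.linear_subspace_image[OF lI sL] by blast
  from no obtain \<psi> where \<psi>: "linf \<psi>" "\<forall>y\<in>?I. \<psi> y = 0" "\<psi> e = 1"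
    using separating_functional[OF sI] by blast
  interpret pairing "\<lambda>y v. trace (y ** v)" L
    by (rule pairing.intro[OF sL]; rule linfI; simp only: mm_simps trace_simps)
  let ?V = "M.span (insert e ?I)"
  have "\<exists>y\<in>L. \<forall>v\<in>?V. trace (y ** v) = \<psi> v"
  proof (rule represent)
    fix v assume v: "v \<in> ?V" "\<forall>y\<in>L. trace (y ** v) = 0"
    then obtain a where "v - a *\<^sub>m e \<in> ?I"
      unfolding M.span_insert M.span_eq_iff[THEN iffD2, OF sI] by blast
    then obtain g where g: "g \<in> L" "v - a *\<^sub>m e = ad e (ad e g)" by blast
    have ve: "v = a *\<^sub>m e + ad e (ad e g)" using g(2) by (simp add: algebra_simps)
    have vL: "v \<in> L" unfolding ve using e g by (simp add: M.subspace_add[OF sL] M.subspace_scale[OF sL] adL)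
    have vc: "v \<in> cent L"
    proof (rule rad_trace[OF vL])
      show "trace (v ** y) = 0" if "y \<in> L" for y using v(2) that by (simp only: trace_mul_sym[of v y])
    qed
    then have "ad e v = 0" using e(1) unfolding cent_def by blast
    then have ev: "v ** e = e ** v" by (simp only: ad_eq_0_iff)
    have "nilp v"
    proof (rule nilp_if_traces)
      fix k
      have ce: "mpow v k ** e = e ** mpow v k" by (rule mpow_comm_gen[OF ev])
      have "trace (ad (ad e g) e ** mpow v k) = 0" by (rule trace_mpow_ad[OF ce])
      then have t1: "trace (ad e (ad e g) ** mpow v k) = 0"
        by (simp only: ad_antisym[of "ad e g" e] mm_simps trace_neg neg_equal_0_iff_equal)
      have t2: "trace (e ** mpow v k) = 0"
        by (rule trace_nilp) (rule nilp_mult[OF e(2) ce[symmetric]])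
      have "mpow v (Suc k) = a *\<^sub>m (e ** mpow v k) + ad e (ad e g) ** mpow v k"
        unfolding mpow_Suc by (subst (1) ve) (simp only: mm_simps)
      then show "trace (mpow v (Suc k)) = 0" using t1 t2 by (simp add: trace_simps)
    qed
    then show "v = 0" by (rule cent_nilp[OF vc])
  qed (simp_all add: MK.linear_add[OF \<psi>(1)] MK.linear_scale[OF \<psi>(1)])
  then obtain y where y: "y \<in> L" "\<forall>v\<in>?V. trace (y ** v) = \<psi> v" by blast
  have z: "trace (ad e (ad e y) ** g) = 0" if g: "g \<in> L" for g
  proof -
    have "ad e (ad e g) \<in> ?V" using g by (intro M.span_base) blast
    then have "trace (y ** ad e (ad e g)) = \<psi> (ad e (ad e g))" using y(2) by blast
    also have "\<dots> = 0" using \<psi>(2) g by blast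
    finally have "trace (y ** ad e (ad e g)) = 0" .
    then have "trace (ad (ad y e) e ** g) = 0" by (simp only: trace_ad)
    moreover have "ad (ad y e) e = ad e (ad e y)"
      using ad_antisym[of "ad y e" e] ad_antisym[of y e] by (simp add: ad_simps)
    ultimately show ?thesis by simp
  qed
  have "ad e (ad e y) \<in> cent L" using adL[OF e(1) adL[OF e(1) y(1)]] z by (rule rad_trace)
  then have "ad e (ad e y) = 0" using brk_in[OF e(1) adL[OF e(1) y(1)]] cent_brk_0 by blast
  then have "trace (e ** y) = 0" by (rule trace_nilp_ad2[OF e(2)])
  moreover have "e \<in> ?V" by (rule M.span_base) simp
  then have "trace (y ** e) = 1" using y(2) \<psi>(3) by (metis (no_types))
  ultimately show False by (simp add: trace_mul_sym[of e y])
qed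

text \<open>From \<open>e = [e, [e, b]]\<close> with \<open>b\<close> in \<open>L1\<close>, the
  elements \<open>f0 = -2 b\<close> and \<open>h = [e, f0]\<close> satisfy every relation but the
  one for \<open>[h, f0]\<close>; the factor \<open>-2\<close> normalises \<open>[h, e]\<close> to
  \<open>2 e\<close>. The defect \<open>c\<close> commutes with \<open>e\<close> and is removed by
  some \<open>d\<close> in \<open>L1\<close> commuting with \<open>e\<close> with
  \<open>[h, d] + 2 d = c\<close>.\<close>

lemma jacobson_morozov:
  assumes e: "e \<in> L1" "nilp e"
  shows "\<exists>h\<in>L0. \<exists>f\<in>L1. sl2_triple e h f"
proof -
  obtain f1 where f1: "f1 \<in> L" "e = ad e (ad e f1)"
    using e_in_image[OF L1_L[OF e(1)] e(2)] by (rule imageE)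
  obtain a b where ab: "a \<in> L0" "b \<in> L1" "f1 = a + b" using f1(1) by (rule L_split)
  have "e - ad e (ad e b) = ad e (ad e a)"
    by (subst (1) f1(2)) (simp add: ab(3) ad_simps)
  moreover have "ad e (ad e a) \<in> L0" using ab e(1) by (intro ad11 ad10)
  moreover have "e - ad e (ad e b) \<in> L1" using ab e(1) by (intro M.subspace_diff[OF sL1] ad10 ad11)
  ultimately have eb: "ad e (ad e b) = e" using L0_L1 by (metis eq_iff_diff_eq_0)
  define f0 h where "f0 = - 2 *\<^sub>m b" and "h = ad e f0"
  have f0: "f0 \<in> L1" unfolding f0_def by (rule M.subspace_scale[OF sL1 ab(2)])
  have h: "h \<in> L0" unfolding h_def by (rule ad11[OF e(1) f0])
  have eh: "ad e h = - (2 *\<^sub>m e)" unfolding h_def f0_def using eb by (simp add: ad_simps)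
  have he: "ad h e = 2 *\<^sub>m e" using eh ad_antisym[of h e] by simp
  have HE: "ad h (ad e x) = ad e (ad h x) + 2 *\<^sub>m ad e x" for x
    using jacobi[of h e x] he by (simp add: ad_simps)
  have EF0: "ad e (ad f0 x) = ad f0 (ad e x) + ad h x" for x
    using jacobi[of e f0 x] by (simp add: h_def)
  have key: "(ad e ^^ Suc i) (ad f0 y) = ad f0 ((ad e ^^ Suc i) y)
      + of_nat (Suc i) *\<^sub>m (ad h ((ad e ^^ i) y) - of_nat i *\<^sub>m (ad e ^^ i) y)" for i y
  proof (induction i)
    case 0
    show ?case by (simp add: EF0)
  next
    case (Suc i)
    let ?Y = "(ad e ^^ Suc i) y" and ?c = "of_nat i :: 'k"
    have "(ad e ^^ Suc (Suc i)) (ad f0 y) = ad e ((ad e ^^ Suc i) (ad f0 y))" by simp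
    also have "\<dots> = ad e (ad f0 ?Y) + (?c + 1) *\<^sub>m (ad e (ad h ((ad e ^^ i) y)) - ?c *\<^sub>m ?Y)"
      unfolding Suc by (simp add: ad_simps add.commute)
    also have "ad e (ad f0 ?Y) = ad f0 ((ad e ^^ Suc (Suc i)) y) + ad h ?Y"
      unfolding EF0 by simp
    also have "ad e (ad h ((ad e ^^ i) y)) = ad h ?Y - 2 *\<^sub>m ?Y"
      using HE[of "(ad e ^^ i) y"] by simp
    also have "ad f0 ((ad e ^^ Suc (Suc i)) y) + ad h ?Y + (?c + 1) *\<^sub>m (ad h ?Y - 2 *\<^sub>m ?Y - ?c *\<^sub>m ?Y)
      = ad f0 ((ad e ^^ Suc (Suc i)) y) + (?c + 1 + 1) *\<^sub>m (ad h ?Y - (?c + 1) *\<^sub>m ?Y)"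
      by (simp add: vec_eq_iff mscale_def algebra_simps del: funpow.simps)
    finally show ?case by (simp add: add_ac)
  qed
  \<comment> \<open>A vector of weight \<open>-2\<close> killed by \<open>e\<close> lies in the
    image of every power of \<open>ad e\<close>, since each step multiplies it by
    \<open>-(i+1)(i+2)\<close>, which is never zero. Nilpotency of \<open>ad e\<close> then kills
    it, so \<open>ad h + 2\<close> is invertible on the centraliser of \<open>e\<close> in
    \<open>L1\<close>.\<close>
  have inj: "d = 0" if d: "ad e d = 0" "ad h d = - 2 *\<^sub>m d" for d
  proof -
    have ex: "\<exists>y. d = (ad e ^^ i) y" for i
    proof (induction i)
      case 0
      show ?case by (rule exI[of _ d]) simp
    next
      case (Suc i)
      then obtain y where y: "(ad e ^^ i) y = d" by metis
      have y': "(ad e ^^ Suc i) y = 0" by (simp add: y d)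
      have "(ad e ^^ Suc i) (ad f0 y) = of_nat (Suc i) *\<^sub>m (- 2 *\<^sub>m d - of_nat i *\<^sub>m d)"
        unfolding key y y' d by (simp add: ad_simps)
      also have "\<dots> = - of_nat (Suc i * (i + 2)) *\<^sub>m d"
        by (simp add: vec_eq_iff mscale_def algebra_simps)
      finally have k: "(ad e ^^ Suc i) (ad f0 y) = - of_nat (Suc i * (i + 2)) *\<^sub>m d" .
      define r where "r = - (of_nat (Suc i * (i + 2)) :: 'k)"
      have nz: "r \<noteq> 0" unfolding r_def neg_equal_0_iff_equal of_nat_eq_0_iff by simp
      have "(ad e ^^ Suc i) (inverse r *\<^sub>m ad f0 y) = inverse r *\<^sub>m r *\<^sub>m d"
        unfolding MM.linear_scale[OF lin_funpow[OF lin_ad]] k r_def ..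
      also have "\<dots> = d" using nz by simp
      finally show ?case by metis
    qed
    obtain k where "\<forall>y. (ad e ^^ k) y = 0" using nilp_ad[OF e(2)] by blast
    then show ?thesis using ex[of k] by auto
  qed
  define c where "c = ad h f0 + 2 *\<^sub>m f0"
  let ?K = "{d \<in> L1. ad e d = 0}"
  let ?T = "\<lambda>d. ad h d + 2 *\<^sub>m d"
  have sK: "M.subspace ?K" by (rule M.subspaceI)
    (auto simp: M.subspace_0[OF sL1] M.subspace_add[OF sL1] M.subspace_scale[OF sL1] ad_simps)
  have hK: "?T d \<in> ?K" if "d \<in> ?K" for d
  proof -
    have "ad e (ad h d) = 0" using HE[of d] that by (simp add: ad_simps)
    then show ?thesis using that h
      by (simp add: ad_simps ad01 M.subspace_add[OF sL1] M.subspace_scale[OF sL1])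
  qed
  have "ad e (ad h f0) = - (2 *\<^sub>m h)"
  proof -
    have "ad h (ad e f0) = ad e (ad h f0) + 2 *\<^sub>m ad e f0" by (rule HE)
    then have "ad e (ad h f0) + 2 *\<^sub>m h = 0" by (simp add: h_def[symmetric] ad_simps)
    then show ?thesis by (simp only: eq_neg_iff_add_eq_0)
  qed
  then have cK: "c \<in> ?K" unfolding c_def using f0 h
    by (simp add: ad_simps h_def[symmetric] ad01 M.subspace_add[OF sL1] M.subspace_scale[OF sL1])
  have "\<exists>d\<in>?K. ?T d = c"
  proof (rule injective_imp_onto[OF _ sK hK _ cK])
    show "lin ?T" by (rule linI) (simp_all add: ad_simps msimps mult.commute add_ac)
    show "d = 0" if "d \<in> ?K" "?T d = 0" for d
    proof (rule inj)
      show "ad h d = - 2 *\<^sub>m d" using that(2) by (simp only: M.scale_minus_left eq_neg_iff_add_eq_0)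
    qed (use that in simp)
  qed
  then obtain d where d: "d \<in> L1" "ad e d = 0" "ad h d + 2 *\<^sub>m d = c" by blast
  have "sl2_triple e h (f0 - d)"
  proof
    show "ad e (f0 - d) = h" by (simp add: ad_simps d h_def)
    show "ad h e = 2 *\<^sub>m e" by (rule he)
    have "ad h d = ad h f0 + 2 *\<^sub>m f0 - 2 *\<^sub>m d"
      using d(3) unfolding c_def by (simp only: eq_diff_eq)
    then show "ad h (f0 - d) = - 2 *\<^sub>m (f0 - d)" by (simp add: ad_simps msimps)
  qed
  moreover have "f0 - d \<in> L1" by (rule M.subspace_diff[OF sL1 f0 d(1)])
  ultimately show ?thesis using h by blast
qed

end

subsection \<open>Isotropic vectors are nilpotent\<close>

definition orb :: "('k::field^'n^'n) set \<Rightarrow> 'k^'n^'n \<Rightarrow> ('k^'n^'n) set" where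
  "orb S y = (\<lambda>u. ad u y) ` S"

lemma lin_ad_left: "lin (\<lambda>u. ad u y)"
  by (rule linI) (simp_all only: ad_simps)

lemma subspace_orb: "M.subspace S \<Longrightarrow> M.subspace (orb S y)"
  unfolding orb_def using MM.linear_subspace_image[OF lin_ad_left] by blast

text \<open>The vector \<open>y0\<close> has an orbit of largest dimension, and
  \<open>dim_y0\<close> is the rank one condition at \<open>y0\<close>; \<open>dim_max\<close>
  records the maximality in comparison with \<open>e\<close>.\<close>

locale rank_one = sym_lie +
  fixes e y0
  assumes e: "e \<in> L1" "e \<noteq> 0" "nilp e" and y0: "y0 \<in> L1"
    and dim_y0: "M.dim L1 = Suc (M.dim (orb L0 y0))"
    and dim_max: "M.dim (orb L0 e) \<le> M.dim (orb L0 y0)"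
begin

lemma orb_sub: "y \<in> L1 \<Longrightarrow> orb L0 y \<subseteq> L1"
  unfolding orb_def using ad01 by blast

lemma orb_y0_nonzero: "\<exists>u\<in>L0. ad u y0 \<noteq> 0"
proof (rule ccontr)
  assume no: "\<not> ?thesis"
  then have "orb L0 y0 \<subseteq> {0}" unfolding orb_def by blast
  then have "M.dim (orb L0 y0) = 0" by (simp only: M.dim_eq_0)
  then have "M.dim (orb L0 e) = 0" using dim_max by linarith
  then have z: "orb L0 e \<subseteq> {0}" by (simp only: M.dim_eq_0)
  obtain h f where hf: "h \<in> L0" "f \<in> L1" "sl2_triple e h f" using jacobson_morozov[OF e(1,3)] by blast
  then have "2 *\<^sub>m e \<in> orb L0 e" unfolding orb_def using sl2_triple.he[OF hf(3)] by (metis imageI)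
  then have "2 *\<^sub>m e = 0" using z by blast
  then show False using e(2) by simp
qed

lemma y0_not_central: "y0 \<notin> cent L"
  using orb_y0_nonzero L0_L unfolding cent_def by blast

lemma B_y0_nonzero: "\<exists>a\<in>L1. B a y0 \<noteq> 0"
proof (rule ccontr)
  assume no: "\<not> ?thesis"
  have "y0 \<in> cent L" by (rule rad_B1[OF y0]) (use no in \<open>simp add: B_sym[of y0]\<close>)
  then show False using y0_not_central by blast
qed

lemma B_orb_0: "u \<in> L \<Longrightarrow> y \<in> L \<Longrightarrow> B (ad u y) y = 0"
  by (simp add: B_inv ad_simps B_0)

text \<open>The orbit space \<open>[L0, y0]\<close> is orthogonal to \<open>y0\<close> and of
  codimension one, so any \<open>z\<close> not orthogonal to \<open>y0\<close> completes it.\<close>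

lemma hyperplane:
  assumes z: "z \<in> L1" "B z y0 \<noteq> 0" and v: "v \<in> L1"
  shows "\<exists>u\<in>L0. \<exists>c. v = ad u y0 + c *\<^sub>m z"
proof -
  let ?W = "orb L0 y0"
  have sW: "M.subspace ?W" by (rule subspace_orb[OF sL0])
  have "z \<notin> ?W" using z(2) B_orb_0 y0 unfolding orb_def by (auto simp: L0_L L1_L)
  then have "M.dim (insert z ?W) = M.dim L1"
    unfolding M.dim_insert M.span_eq_iff[THEN iffD2, OF sW] dim_y0 by simp
  then have "M.span (insert z ?W) = L1"
    by (intro M.subspace_dim_equal M.span_minimal sL1 M.subspace_span) (use z orb_sub[OF y0] in auto)
  then have "v \<in> M.span (insert z ?W)" using v by simp
  then obtain c where "v - c *\<^sub>m z \<in> ?W"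
    unfolding M.span_insert M.span_eq_iff[THEN iffD2, OF sW] by blast
  then obtain u where "u \<in> L0" "v - c *\<^sub>m z = ad u y0" unfolding orb_def by blast
  then show ?thesis by (intro bexI[of _ u] exI[of _ c]) (simp_all add: diff_eq_eq)
qed

text \<open>A vector of \<open>L1\<close> orthogonal to \<open>L1\<close> is central; being
  orthogonal to \<open>y0\<close> it lies in \<open>[L0, y0]\<close>, hence in
  \<open>[L, L]\<close>, and so vanishes.\<close>

lemma nondeg1:
  assumes x: "x \<in> L1" "\<And>y. y \<in> L1 \<Longrightarrow> B x y = 0" shows "x = 0"
proof -
  obtain a where a: "a \<in> L1" "B a y0 \<noteq> 0" using B_y0_nonzero by blast
  obtain u c where u: "u \<in> L0" "x = ad u y0 + c *\<^sub>m a" using hyperplane[OF a x(1)] by blast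
  have "B x y0 = B (ad u y0) y0 + c * B a y0"
    using u a y0 by (simp add: B_add1 B_scale1 adL L0_L L1_L M.subspace_scale[OF sL])
  then have "c = 0" using x(2)[OF y0] a(2) B_orb_0[of u y0] u(1) y0 by (simp add: L0_L L1_L)
  then have "x \<in> brk L L" using u y0 by (simp add: brk_in L0_L L1_L)
  moreover have "x \<in> cent L" by (rule rad_B1[OF x])
  ultimately show ?thesis using cent_brk_0 by blast
qed

text \<open>Where \<open>L1 = [L0, x'] + k z\<close>, writing \<open>x\<close> in this sum gives
  \<open>tr(z x') tr(x x'^k) = tr(x x') tr(z x'^k)\<close>. For \<open>x' = x + t y0\<close> the
  decomposition can fail at finitely many \<open>t\<close> only, so the identity extends to
  \<open>t = 0\<close>; there \<open>tr(x x)\<close> vanishes and \<open>tr(z x)\<close> does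
  not.\<close>

lemma isotropic_nilp:
  assumes x: "x \<in> L1" "B x x = 0" shows "nilp x"
proof (cases "x = 0")
  case False
  obtain z where z: "z \<in> L1" "B z y0 \<noteq> 0" "B z x \<noteq> 0"
  proof -
    obtain a where a: "a \<in> L1" "B a y0 \<noteq> 0" using B_y0_nonzero by blast
    have "\<exists>b\<in>L1. B x b \<noteq> 0" using nondeg1[OF x(1)] False by blast
    then obtain b where b: "b \<in> L1" "B b x \<noteq> 0" by (auto simp: B_sym[of x])
    consider "B a x \<noteq> 0" | "B b y0 \<noteq> 0" | "B a x = 0" "B b y0 = 0" by blast
    then show thesis
    proof cases
      case 3
      have "B (a + b) y0 \<noteq> 0" "B (a + b) x \<noteq> 0" using 3 a b by (simp_all add: B_add1 L1_L)
      then show ?thesis using that[of "a + b"] M.subspace_add[OF sL1 a(1) b(1)] by blast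
    qed (use that a b in blast)+
  qed
  let ?W = "orb L0 y0"
  have sW: "M.subspace ?W" by (rule subspace_orb[OF sL0])
  \<comment> \<open>With \<open>g\<close> a linear right inverse of
    \<open>u \<mapsto> [u, y0]\<close> and \<open>\<delta>\<close> the coordinate along
    \<open>z\<close>, every \<open>v\<close> in \<open>L1\<close> is
    \<open>[D v, y0] + \<delta> v z\<close>. A solution of \<open>(A + t) w = v\<close> decomposes
    \<open>v\<close> at \<open>x + t y0\<close>, and there is one unless \<open>- t\<close> is an
    eigenvalue of \<open>A\<close>.\<close>
  obtain g where g: "\<And>v. g v \<in> L0" "lin g" "\<And>v. v \<in> ?W \<Longrightarrow> ad (g v) y0 = v"
    using MM.linear_exists_right_inverse_on[OF lin_ad_left[of y0] sL0] unfolding orb_def by blast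
  have "z \<notin> ?W" using z(2) B_orb_0 y0 unfolding orb_def by (auto simp: L0_L L1_L)
  then obtain \<delta> where \<delta>: "linf \<delta>" "\<forall>y\<in>?W. \<delta> y = 0" "\<delta> z = 1" using separating_functional[OF sW] by blast
  define D where "D v = g (v - \<delta> v *\<^sub>m z)" for v
  define A where "A v = ad (D v) x + \<delta> v *\<^sub>m z" for v
  have linD: "lin D"
  proof (rule linI)
    show "D (u + v) = D u + D v" for u v
    proof -
      have "u + v - \<delta> (u + v) *\<^sub>m z = (u - \<delta> u *\<^sub>m z) + (v - \<delta> v *\<^sub>m z)"
        by (simp add: MK.linear_add[OF \<delta>(1)] M.scale_left_distrib)
      then show ?thesis unfolding D_def by (simp only: MM.linear_add[OF g(2)])
    qed
    show "D (c *\<^sub>m v) = c *\<^sub>m D v" for c v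
    proof -
      have "c *\<^sub>m v - \<delta> (c *\<^sub>m v) *\<^sub>m z = c *\<^sub>m (v - \<delta> v *\<^sub>m z)"
        by (simp add: MK.linear_scale[OF \<delta>(1)] M.scale_right_diff_distrib)
      then show ?thesis unfolding D_def by (simp only: MM.linear_scale[OF g(2)])
    qed
  qed
  have linA: "lin A"
    by (rule linI) (simp_all add: A_def MM.linear_add[OF linD] MM.linear_scale[OF linD]
      MK.linear_add[OF \<delta>(1)] MK.linear_scale[OF \<delta>(1)] ad_simps M.scale_left_distrib M.scale_right_distrib)
  have D0: "D v \<in> L0" for v unfolding D_def by (rule g(1))
  have dec: "ad (D v) y0 + \<delta> v *\<^sub>m z = v" if v: "v \<in> L1" for v
  proof -
    obtain u c where u: "u \<in> L0" "v = ad u y0 + c *\<^sub>m z" using hyperplane[OF z(1,2) v] by blast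
    have uW: "ad u y0 \<in> ?W" unfolding orb_def using u(1) by blast
    have "\<delta> v = c" using \<delta>(2,3) uW by (simp add: u(2) MK.linear_add[OF \<delta>(1)] MK.linear_scale[OF \<delta>(1)])
    then have "v - \<delta> v *\<^sub>m z = ad u y0" using u(2) by simp
    then have "ad (D v) y0 = ad u y0" unfolding D_def using g(3)[OF uW] by simp
    then show ?thesis using u(2) \<open>\<delta> v = c\<close> by simp
  qed
  have solve: "\<exists>u\<in>L0. \<exists>c. v = ad u (x + t *\<^sub>m y0) + c *\<^sub>m z"
    if t: "\<not> (\<exists>w. w \<noteq> 0 \<and> A w = (- t) *\<^sub>m w)" and v: "v \<in> L1" for t v
  proof -
    let ?S = "\<lambda>w. A w + t *\<^sub>m w"
    have "\<exists>w\<in>L1. ?S w = v"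
    proof (rule injective_imp_onto[OF _ sL1 _ _ v])
      show "lin ?S" by (rule linI)
        (simp_all add: MM.linear_add[OF linA] MM.linear_scale[OF linA] M.scale_right_distrib mult.commute)
      show "?S w \<in> L1" if "w \<in> L1" for w
        unfolding A_def using that z(1) x(1) D0 by (intro M.subspace_add[OF sL1] M.subspace_scale[OF sL1] ad01)
      show "w = 0" if "?S w = 0" for w
      proof -
        have "A w = (- t) *\<^sub>m w" using that by (simp only: M.scale_minus_left eq_neg_iff_add_eq_0)
        then show ?thesis using t by blast
      qed
    qed
    then obtain w where w: "w \<in> L1" "A w + t *\<^sub>m w = v" by blast
    have "v = A w + t *\<^sub>m (ad (D w) y0 + \<delta> w *\<^sub>m z)" unfolding dec[OF w(1)] using w(2) by simp
    also have "\<dots> = ad (D w) (x + t *\<^sub>m y0) + (\<delta> w + t * \<delta> w) *\<^sub>m z"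
      by (simp add: A_def ad_simps M.scale_right_distrib M.scale_left_distrib)
    finally show ?thesis using D0 by blast
  qed
  have zx: "trace (z ** x) \<noteq> 0" using z(3) B_11[OF z(1) x(1)] by simp
  have xx: "trace (x ** x) = 0" using x(2) B_11[OF x(1) x(1)] by simp
  show ?thesis
  proof (rule nilp_if_traces)
    fix k
    let ?x = "\<lambda>t. x + t *\<^sub>m y0"
    define \<Phi> where "\<Phi> t = trace (z ** ?x t) * trace (x ** mpow (?x t) k) - trace (x ** ?x t) * trace (z ** mpow (?x t) k)" for t
    have "pfun \<Phi>" unfolding \<Phi>_def
      by (intro pfun_diff pfun_mult pfun_trace mpfun_mult mpfun_const mpfun_pow mpfun_line)
    moreover have "finite {t. \<Phi> t \<noteq> 0}"
    proof (rule finite_subset)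
      show "finite (uminus ` {c. \<exists>w. w \<noteq> 0 \<and> A w = c *\<^sub>m w})" by (rule finite_imageI[OF finite_eigenvalues[OF linA]])
      show "{t. \<Phi> t \<noteq> 0} \<subseteq> uminus ` {c. \<exists>w. w \<noteq> 0 \<and> A w = c *\<^sub>m w}"
      proof
        fix t assume t: "t \<in> {t. \<Phi> t \<noteq> 0}"
        have "\<exists>w. w \<noteq> 0 \<and> A w = (- t) *\<^sub>m w"
        proof (rule ccontr)
          assume n: "\<not> ?thesis"
          obtain u c where u: "x = ad u (?x t) + c *\<^sub>m z" using solve[OF n x(1)] by blast
          have "trace (ad u (?x t) ** ?x t) = 0" by (rule trace_mpow_ad) simp
          moreover have "trace (x ** ?x t) = trace ((ad u (?x t) + c *\<^sub>m z) ** ?x t)"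
            by (rule arg_cong[of _ _ "\<lambda>a. trace (a ** ?x t)"]) (rule u)
          ultimately have 1: "trace (x ** ?x t) = c * trace (z ** ?x t)"
            by (simp only: mm_simps(2,9) trace_simps) simp
          have "trace (ad u (?x t) ** mpow (?x t) k) = 0" by (rule trace_mpow_ad) (rule mpow_comm)
          moreover have "trace (x ** mpow (?x t) k) = trace ((ad u (?x t) + c *\<^sub>m z) ** mpow (?x t) k)"
            by (rule arg_cong[of _ _ "\<lambda>a. trace (a ** mpow (?x t) k)"]) (rule u)
          ultimately have 2: "trace (x ** mpow (?x t) k) = c * trace (z ** mpow (?x t) k)"
            by (simp only: mm_simps(2,9) trace_simps) simp
          have "\<Phi> t = 0" unfolding \<Phi>_def 1 2 by simp
          then show False using t by simp
        qed
        then show "t \<in> uminus ` {c. \<exists>w. w \<noteq> 0 \<and> A w = c *\<^sub>m w}" by (intro image_eqI[of _ _ "- t"]) auto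
      qed
    qed
    ultimately have "\<Phi> 0 = 0" by (rule pfun_zero_cofinite)
    then have "trace (z ** x) * trace (x ** mpow x k) = 0"
      unfolding \<Phi>_def by (simp only: M.scale_zero_left add_0_right xx mult_zero_left diff_zero)
    then have "trace (x ** mpow x k) = 0" using zx mult_eq_0_iff by blast
    then show "trace (mpow x (Suc k)) = 0" by (simp only: mpow_Suc)
  qed
qed simp

end

subsection \<open>The semisimple element \<open>e + f\<close>\<close>

locale rank_one_triple = rank_one + sl2_triple e h f for h f +
  assumes h: "h \<in> L0" and f: "f \<in> L1"
begin

abbreviation "s \<equiv> e + f"
text \<open>The eigenvector of \<open>ad s\<close> with eigenvalue \<open>2\<close> in the rotated
  triple; it shows that \<open>s\<close> is not nilpotent and later tests integrality of
  weights.\<close>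

abbreviation "e' \<equiv> (1/2) *\<^sub>m (h - e + f)"

lemma eL: "e \<in> L" and fL: "f \<in> L" and hL: "h \<in> L"
  using e(1) f h by (simp_all add: L0_L L1_L)

lemma s1: "s \<in> L1"
  by (rule M.subspace_add[OF sL1 e(1) f])

lemma sLm: "s \<in> L"
  by (rule L1_L[OF s1])

sublocale rot: sl2_triple e' s "(1/2) *\<^sub>m (h + e - f)"
  by (rule rotated)

lemma e'_nonzero: "e' \<noteq> 0"
proof
  assume z: "e' = 0"
  have "s = 0" using rot.ef unfolding z by (simp add: ad_simps)
  then have fe: "f = - e" by (simp add: eq_neg_iff_add_eq_0 add.commute)
  have "- (2 *\<^sub>m e) = 2 *\<^sub>m e" using hf unfolding fe ad_simps he by simp
  then have "(4 :: 'a) *\<^sub>m e = 0" by (simp add: vec_eq_iff mscale_def eq_neg_iff_add_eq_0)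
  then show False using e(2) by simp
qed

lemma B_ss: "B s s \<noteq> 0"
proof
  assume "B s s = 0"
  then have "nilp s" by (rule isotropic_nilp[OF s1])
  then obtain k where k: "(ad s ^^ k) e' = 0" using nilp_ad by blast
  have "(ad s ^^ k) e' = (2 ^ k) *\<^sub>m e'" for k
  proof (induction k)
    case (Suc k)
    have "(ad s ^^ Suc k) e' = (2 ^ k) *\<^sub>m ad s e'" by (simp only: funpow.simps comp_apply Suc ad_simps(10))
    then show ?case unfolding rot.he by (simp only: M.scale_scale power_Suc2 mult.assoc)
  qed simp
  then have "(2 ^ k) *\<^sub>m e' = 0" using k by simp
  then show False using e'_nonzero by (simp only: M.scale_eq_0_iff) simp
qed

lemma B_ef: "B e f \<noteq> 0"
proof
  assume z: "B e f = 0"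
  have n: "B x x = 0" if x: "x \<in> L1" "nilp x" for x
    using trace_mpow_nilp[OF x(2), of 1] by (simp add: B_11[OF x(1) x(1)] mpow_Suc)
  have "B s s = B e e + B e f + (B f e + B f f)"
    by (simp add: B_add1 B_add2 eL fL)
  then show False using B_ss z n[OF e(1,3)] n[OF f nilp_f] B_sym[of f e] by simp
qed

text \<open>Otherwise \<open>s + a y\<close> and \<open>s - a y\<close> with
  \<open>a^2 = - B s s / B y y\<close> are isotropic, hence nilpotent; they commute, so their sum
  \<open>2 s\<close> would be nilpotent, against \<open>B_ss\<close>.\<close>

lemma commutant_isotropic:
  assumes y: "y \<in> L1" "ad s y = 0" "B s y = 0" shows "B y y = 0"
proof (rule ccontr)
  assume nz: "B y y \<noteq> 0"
  obtain a where a: "a ^ 2 = - B s s / B y y" using nth_root_exists[of 2] by auto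
  have yL: "y \<in> L" by (rule L1_L[OF y(1)])
  have com: "s ** y = y ** s" using y(2) by (simp only: ad_eq_0_iff)
  have iso: "nilp (s + c *\<^sub>m y)" if c: "c ^ 2 = a ^ 2" for c
  proof (rule isotropic_nilp)
    show "s + c *\<^sub>m y \<in> L1" by (intro M.subspace_add[OF sL1 s1] M.subspace_scale[OF sL1 y(1)])
    have cyL: "c *\<^sub>m y \<in> L" by (rule M.subspace_scale[OF sL yL])
    have "B s (s + c *\<^sub>m y) = B s s + c * B s y" "B y (s + c *\<^sub>m y) = B y s + c * B y y"
      by (simp_all only: B_add2[OF sLm cyL] B_scale2[OF yL])
    then have "B (s + c *\<^sub>m y) (s + c *\<^sub>m y) = B s s + c * B s y + c * (B y s + c * B y y)"
      by (simp only: B_add1[OF sLm cyL] B_scale1[OF yL])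
    also have "\<dots> = B s s + c ^ 2 * B y y" using y(3) B_sym[of y s] by (simp add: power2_eq_square)
    also have "\<dots> = 0" unfolding c a using nz by simp
    finally show "B (s + c *\<^sub>m y) (s + c *\<^sub>m y) = 0" .
  qed
  have n: "nilp (s + a *\<^sub>m y)" "nilp (s + (- a) *\<^sub>m y)" by (rule iso, simp)+
  have "(s + a *\<^sub>m y) ** (s + (- a) *\<^sub>m y) = (s + (- a) *\<^sub>m y) ** (s + a *\<^sub>m y)"
  proof -
    have "(S + a *\<^sub>m y) ** (S + (- a) *\<^sub>m y) = (S + (- a) *\<^sub>m y) ** (S + a *\<^sub>m y)"
      if "S ** y = y ** S" for S using that by (simp add: mm_simps algebra_simps)
    then show ?thesis using com .
  qed
  then have "nilp (s + a *\<^sub>m y + (s + (- a) *\<^sub>m y))" by (rule nilp_add[OF n])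
  moreover have "s + a *\<^sub>m y + (s + (- a) *\<^sub>m y) = 2 *\<^sub>m s"
    by (simp add: vec_eq_iff mscale_def)
  ultimately have "nilp ((1/2) *\<^sub>m (2 *\<^sub>m s))" using nilp_scale by metis
  then have "nilp s" by simp
  then have "B s s = 0" using trace_mpow_nilp[of s 1] by (simp add: B_11[OF s1 s1] mpow_Suc)
  then show False using B_ss by blast
qed

text \<open>Polarising \<open>commutant_isotropic\<close> makes \<open>y\<close> orthogonal to the
  part of the commutant orthogonal to \<open>s\<close>, and so to the whole commutant in
  \<open>L1\<close>. By semisimplicity of \<open>ad s\<close> the rest of \<open>L1\<close> is
  \<open>[s, L0]\<close>, orthogonal to \<open>y\<close> by invariance.\<close>

lemma commutant_zero:
  assumes y: "y \<in> L1" "ad s y = 0" "B s y = 0" shows "y = 0"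
proof (rule nondeg1[OF y(1)])
  fix v assume v: "v \<in> L1"
  have yL: "y \<in> L" by (rule L1_L[OF y(1)])
  have "\<exists>a\<in>L. \<exists>b\<in>L. ad s a = 0 \<and> v = a + ad s b"
  proof (rule fitting[OF lin_ad sL _ _ L1_L[OF v]])
    show "ad s (ad s v) = 0 \<Longrightarrow> ad s v = 0" for v using rot.H_diag[of 0 v] by (simp add: shift_def)
  qed (rule adL[OF sLm])
  then obtain a b where ab: "a \<in> L" "b \<in> L" "ad s a = 0" "v = a + ad s b" by blast
  obtain a0 a1 where a: "a0 \<in> L0" "a1 \<in> L1" "a = a0 + a1" using ab(1) by (rule L_split)
  obtain b0 b1 where b: "b0 \<in> L0" "b1 \<in> L1" "b = b0 + b1" using ab(2) by (rule L_split)
  have "ad s a0 + ad s a1 = 0" using ab(3) unfolding a(3) ad_simps(2) .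
  then have "ad s a1 = - ad s a0" by (simp only: eq_neg_iff_add_eq_0 add.commute)
  moreover have "- ad s a0 \<in> L1" using ad10[OF s1 a(1)] by (rule M.subspace_neg[OF sL1])
  ultimately have sa1: "ad s a1 = 0" using L0_L1[OF ad11[OF s1 a(2)]] by simp
  have "v - (a1 + ad s b0) = a0 + ad s b1" unfolding ab(4) a(3) b(3) ad_simps by simp
  moreover have "v - (a1 + ad s b0) \<in> L1"
    using v a(2) ad10[OF s1 b(1)] by (intro M.subspace_diff[OF sL1] M.subspace_add[OF sL1])
  moreover have "a0 + ad s b1 \<in> L0" using a(1) ad11[OF s1 b(2)] by (rule M.subspace_add[OF sL0])
  ultimately have "v - (a1 + ad s b0) = 0" using L0_L1 by metis
  then have v': "v = a1 + ad s b0" by simp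
  define c where "c = B s a1 / B s s"
  define u where "u = a1 - c *\<^sub>m s"
  have a1L: "a1 \<in> L" and b0L: "b0 \<in> L" using a b by (simp_all add: L0_L L1_L)
  have u: "u \<in> L1" "ad s u = 0" unfolding u_def
    using a(2) s1 sa1 by (simp_all add: M.subspace_diff[OF sL1] M.subspace_scale[OF sL1] ad_simps)
  have Bsu: "B s u = 0" unfolding u_def c_def using B_ss a1L sLm by (simp add: B_diff2 B_scale2 M.subspace_scale[OF sL])
  have uL: "u \<in> L" by (rule L1_L[OF u(1)])
  have "y + u \<in> L1" "ad s (y + u) = 0" "B s (y + u) = 0"
    using y u Bsu yL uL by (simp_all only: M.subspace_add[OF sL1] ad_simps B_add2) simp_all
  then have "B (y + u) (y + u) = 0" by (rule commutant_isotropic)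
  then have "B y y + B y u + (B u y + B u u) = 0" using yL uL by (simp add: B_add1 B_add2 add_ac)
  then have "B y u = 0" using commutant_isotropic[OF y] commutant_isotropic[OF u Bsu] B_sym[of u y] by simp
  moreover have "B y a1 = B y u + c * B y s"
    unfolding u_def using a1L sLm by (simp add: B_diff2 B_scale2 M.subspace_scale[OF sL])
  ultimately have "B y a1 = 0" using y(3) B_sym[of y s] by simp
  moreover have "B y (ad s b0) = 0" using B_ad_swap[OF yL sLm b0L] y(2) by (simp add: B_0)
  ultimately show "B y v = 0" unfolding v' using a1L adL[OF sLm b0L] by (simp add: B_add2)
qed

lemma commutant:
  assumes y: "y \<in> L1" "ad s y = 0" shows "\<exists>c. y = c *\<^sub>m s"
proof -
  define c where "c = B s y / B s s"
  have "y - c *\<^sub>m s = 0"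
  proof (rule commutant_zero)
    show "y - c *\<^sub>m s \<in> L1" by (intro M.subspace_diff[OF sL1 y(1)] M.subspace_scale[OF sL1 s1])
    show "ad s (y - c *\<^sub>m s) = 0" using y(2) by (simp add: ad_simps)
    show "B s (y - c *\<^sub>m s) = 0" unfolding c_def using B_ss sLm L1_L[OF y(1)]
      by (simp add: B_diff2 B_scale2 M.subspace_scale[OF sL])
  qed
  then show ?thesis by auto
qed

lemma no_odd_eigenvalue:
  assumes x: "x \<in> L" "ad s x = of_nat m *\<^sub>m x" and m: "odd m" "m \<ge> 3"
  shows "x = 0"
proof (rule ccontr)
  assume x0: "x \<noteq> 0"
  let ?m = "of_nat m :: 'a"
  have m0: "?m \<noteq> 0" using m by auto
  have sg: "ad s (\<sigma> a) = - \<sigma> (ad s a)" if "a \<in> L" for a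
    by (simp only: sig(4)[OF sLm that] sig1[OF s1] ad_simps(5) minus_minus)
  let ?V = "{x \<in> L. ad s x = ?m *\<^sub>m x}"
  \<comment> \<open>Since \<open>\<sigma> s = - s\<close>, the involution exchanges the eigenspaces
    of \<open>m\<close> and \<open>- m\<close>, the only ones that \<open>B\<close> can pair
    nontrivially with each other. So \<open>B X (\<sigma> Y)\<close> is a nonzero symmetric form on
    the eigenspace, and its quadratic form is nonzero too.\<close>
  have "\<exists>X\<in>?V. B X (\<sigma> X) \<noteq> 0"
  proof (rule ccontr)
    assume "\<not> ?thesis"
    then have iso: "B X (\<sigma> X) = 0" if "X \<in> ?V" for X using that by blast
    have pol: "B x (\<sigma> X) = 0" if X: "X \<in> ?V" for X
    proof -
      have XL: "X \<in> L" using X by blast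
      have sX: "ad s X = ?m *\<^sub>m X" using X by blast
      have "ad s (x + X) = ?m *\<^sub>m (x + X)" by (simp only: ad_simps(2) x(2) sX M.scale_right_distrib)
      then have "x + X \<in> ?V" using M.subspace_add[OF sL x(1) XL] by blast
      then have "B (x + X) (\<sigma> (x + X)) = 0" by (rule iso)
      then have "B x (\<sigma> x) + B x (\<sigma> X) + (B X (\<sigma> x) + B X (\<sigma> X)) = 0"
        using x(1) XL by (simp add: B_add1 B_add2 sig add_ac)
      moreover have "B X (\<sigma> x) = B x (\<sigma> X)"
        using B_sig[of X "\<sigma> x"] x(1) XL B_sym[of "\<sigma> X" x] by (simp add: sig)
      ultimately show ?thesis using iso[of x] iso[OF X] x by simp
    qed
    have "B x v = 0" if v: "v \<in> L" for v
    proof -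
      have "\<exists>a\<in>L. \<exists>b\<in>L. shift (ad s) (- ?m) a = 0 \<and> v = a + shift (ad s) (- ?m) b"
      proof (rule fitting[OF lin_shift[OF lin_ad] sL _ rot.H_diag v])
        show "shift (ad s) (- ?m) w \<in> L" if "w \<in> L" for w
          unfolding shift_def using that sLm by (intro M.subspace_diff[OF sL] M.subspace_scale[OF sL] adL)
      qed
      then obtain a b where a: "a \<in> L" "b \<in> L" "shift (ad s) (- ?m) a = 0" "v = a + shift (ad s) (- ?m) b"
        by blast
      have "ad s a = (- ?m) *\<^sub>m a" using a(3) unfolding shift_def by (simp only: right_minus_eq)
      moreover have "shift (ad s) (- ?m) b = ad s b + ?m *\<^sub>m b" by (simp add: shift_def)
      ultimately have ab: "a \<in> L" "b \<in> L" "ad s a = (- ?m) *\<^sub>m a" "v = a + (ad s b + ?m *\<^sub>m b)"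
        using a by simp_all
      have "ad s (\<sigma> a) = - \<sigma> (ad s a)" by (rule sg[OF ab(1)])
      also have "\<dots> = ?m *\<^sub>m \<sigma> a" unfolding ab(3) using ab(1) by (simp add: sig sig_neg M.subspace_scale[OF sL])
      finally have "\<sigma> a \<in> ?V" using ab(1) by (simp add: sig)
      then have "B x (\<sigma> (\<sigma> a)) = 0" by (rule pol)
      then have 1: "B x a = 0" using ab(1) by (simp add: sig)
      have 2: "B x (ad s b) = - (?m * B x b)"
        unfolding B_ad_swap[OF x(1) sLm ab(2)] x(2) using x(1) by (simp add: B_scale1)
      show ?thesis unfolding ab(4) using 1 2 ab(1,2) sLm
        by (simp add: B_add2 B_scale2 adL M.subspace_add[OF sL] M.subspace_scale[OF sL])
    qed
    then have "x \<in> cent L" by (rule rad_B[OF x(1)])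
    then have "ad s x = 0" using sLm unfolding cent_def by blast
    then show False using x(2) m0 x0 by simp
  qed
  then obtain X where X: "X \<in> L" "ad s X = ?m *\<^sub>m X" "B X (\<sigma> X) \<noteq> 0" by blast
  define Y where "Y = \<sigma> X"
  have YL: "Y \<in> L" unfolding Y_def using X(1) by (rule sig(1))
  have sY: "ad s Y = - (?m *\<^sub>m Y)"
  proof -
    have "ad s Y = - \<sigma> (ad s X)" unfolding Y_def by (rule sg[OF X(1)])
    then show ?thesis unfolding X(2) Y_def using X(1) by (simp add: sig)
  qed
  have "\<sigma> (ad X Y) = ad Y X" using X(1) YL by (simp add: sig) (simp add: Y_def sig X(1))
  then have W1: "ad X Y \<in> L1" unfolding minus_part_def using adL[OF X(1) YL] ad_antisym[of Y X] by simp
  have "ad s (ad X Y) = 0" unfolding jacobi[of s X Y] X(2) sY by (simp add: ad_simps)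
  then obtain c where c: "ad X Y = c *\<^sub>m s" using commutant[OF W1] by blast
  have "B (ad X Y) s = B X (ad Y s)" by (rule B_inv[OF X(1) YL sLm])
  also have "ad Y s = ?m *\<^sub>m Y" using sY ad_antisym[of Y s] by simp
  also have "B X (?m *\<^sub>m Y) = ?m * B X Y" by (rule B_scale2[OF YL])
  finally have "c * B s s = ?m * B X Y" unfolding c using sLm by (simp add: B_scale1)
  then have c0: "c \<noteq> 0" using m0 X(3) by (auto simp: Y_def)
  \<comment> \<open>The scalars normalise \<open>[X, Y] = c s\<close> and
    \<open>[s, X] = m X\<close> to the relations of a triple.\<close>
  interpret t: sl2_triple X "(2 / ?m) *\<^sub>m s" "(2 / (?m * c)) *\<^sub>m Y"
  proof
    show "ad X ((2 / (?m * c)) *\<^sub>m Y) = (2 / ?m) *\<^sub>m s" using c c0 m0 by (simp add: ad_simps)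
    show "ad ((2 / ?m) *\<^sub>m s) X = 2 *\<^sub>m X" unfolding ad_simps(9) X(2) using m0 by simp
    have "ad ((2 / ?m) *\<^sub>m s) ((2 / (?m * c)) *\<^sub>m Y) = (2 / ?m) *\<^sub>m ((2 / (?m * c)) *\<^sub>m (- (?m *\<^sub>m Y)))"
      unfolding ad_simps(9,10) sY by (rule M.scale_left_commute)
    also have "\<dots> = - 2 *\<^sub>m ((2 / (?m * c)) *\<^sub>m Y)" using m0 c0 by (simp add: vec_eq_iff mscale_def field_simps)
    finally show "ad ((2 / ?m) *\<^sub>m s) ((2 / (?m * c)) *\<^sub>m Y) = - 2 *\<^sub>m ((2 / (?m * c)) *\<^sub>m Y)" .
  qed
  \<comment> \<open>As \<open>[s, e'] = 2 e'\<close>, the new neutral element has eigenvalue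
    \<open>4 / m\<close> on \<open>e'\<close>; integrality makes \<open>m\<close> a divisor of
    \<open>4\<close>, excluded for odd \<open>m \<ge> 3\<close>.\<close>
  have "ad ((2 / ?m) *\<^sub>m s) e' = (2 / ?m) *\<^sub>m (2 *\<^sub>m e')" by (simp only: ad_simps(9) rot.he)
  also have "\<dots> = (4 / ?m) *\<^sub>m e'" by (simp only: M.scale_scale) simp
  finally have "\<exists>z. 4 / ?m = of_int z" using t.weight_int e'_nonzero by blast
  then obtain z where "4 / ?m = of_int z" by blast
  then have "(of_int 4 :: 'a) = of_int (z * int m)" using m0 by (simp add: field_simps)
  then have "4 = z * int m" by (simp only: of_int_eq_iff)
  then have "int m dvd 4" by (metis dvd_triv_right)
  then have "m dvd 4" by presburger
  then have "m \<le> 4" by (rule dvd_imp_le) simp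
  with m have "m = 3" by presburger
  then show False using \<open>m dvd 4\<close> by simp
qed

end

text \<open>For a highest weight vector \<open>x\<close> of weight \<open>j\<close>, these
  coefficients make the sum of \<open>kc j i\<close> times \<open>F^(2i) x\<close> commute with
  \<open>e + f\<close>: as \<open>E F^(2i+2) x = (2i+2) (j - 2i - 1) F^(2i+1) x\<close>, the image
  under \<open>E\<close> of each term cancels the image under \<open>F\<close> of the preceding one.
  The denominators are nonzero for even \<open>j\<close>.\<close>

primrec kc :: "'k::field_char_0 \<Rightarrow> nat \<Rightarrow> 'k" where
  "kc j 0 = 1"
| "kc j (Suc i) = - kc j i / (of_nat (2 * i + 2) * (j - of_nat (2 * i + 1)))"

section \<open>Weights of \<open>ad h\<close> on the centraliser of \<open>e\<close>\<close>

context rank_one_triple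
begin

lemma F_L: "x \<in> L \<Longrightarrow> (F ^^ i) x \<in> L"
  by (rule funpow_in) (rule adL[OF fL])

text \<open>The sum \<open>X\<close> of the divided powers of \<open>F\<close> on \<open>x\<close>
  is an eigenvector of \<open>ad s\<close> with eigenvalue \<open>j\<close>: on binary forms,
  \<open>x = u^j\<close> becomes \<open>(u + v)^j\<close>. It is nonzero because
  \<open>F^j X = F^j x\<close>, against \<open>no_odd_eigenvalue\<close>.\<close>

lemma no_odd_weight:
  assumes x: "x \<in> L" "ad e x = 0" "ad h x = of_nat j *\<^sub>m x" and j: "odd j" "j \<ge> 3"
  shows "x = 0"
proof (rule ccontr)
  assume x0: "x \<noteq> 0"
  obtain m where m: "(of_nat j :: 'a) = of_nat m" "(F ^^ m) x \<noteq> 0" "\<And>i. i > m \<Longrightarrow> (F ^^ i) x = 0"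
    using highest_weight[OF x(2,3) x0] by blast
  have mj: "m = j" using m(1) by (simp only: of_nat_eq_iff)
  have lf: "lin (F ^^ i)" for i by (rule lin_funpow[OF lin_ad])
  define a where "a i = inverse (of_nat (fact i)) *\<^sub>m (F ^^ i) x" for i
  have inv_fact: "of_nat (Suc i) * inverse (of_nat (fact (Suc i))) = (inverse (of_nat (fact i)) :: 'a)" for i
    using of_nat_neq_0[of i, where 'a = 'a] by (simp only: fact_Suc of_nat_mult of_nat_id) (simp add: field_simps del: of_nat_Suc)
  have Fa: "ad f (a i) = of_nat (Suc i) *\<^sub>m a (Suc i)" for i
    unfolding a_def M.scale_scale inv_fact ad_simps by simp
  have Ea: "ad e (a (Suc i)) = (of_nat j - of_nat i) *\<^sub>m a i" for i
  proof -
    have "ad e (a (Suc i)) = inverse (of_nat (fact (Suc i))) *\<^sub>m of_nat (Suc i) *\<^sub>m (of_nat j *\<^sub>m (F ^^ i) x - of_nat i *\<^sub>m (F ^^ i) x)"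
      unfolding a_def ad_simps E_F_pow x(2,3) MM.linear_scale[OF lf] MM.linear_0[OF lf] by simp
    also have "\<dots> = (of_nat j - of_nat i) *\<^sub>m a i"
      unfolding a_def M.scale_scale M.scale_left_diff_distrib[symmetric] inv_fact[of i, symmetric]
      by (simp only: mult_ac)
    finally show ?thesis .
  qed
  have a0: "a 0 = x" by (simp add: a_def)
  have sum: "(\<Sum>i\<le>n. ad s (a i) - of_nat j *\<^sub>m a i) = of_nat (Suc n) *\<^sub>m a (Suc n) - (of_nat j - of_nat n) *\<^sub>m a n" for n
  proof (induction n)
    case 0
    have "ad s (a 0) = of_nat (Suc 0) *\<^sub>m a (Suc 0)" using Fa[of 0] x(2) by (simp add: a0 ad_simps)
    then show ?case by simp
  next
    case (Suc n)
    have "ad s (a (Suc n)) = (of_nat j - of_nat n) *\<^sub>m a n + of_nat (Suc (Suc n)) *\<^sub>m a (Suc (Suc n))"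
      by (simp only: ad_simps(1) Ea Fa)
    then have "(\<Sum>i\<le>Suc n. ad s (a i) - of_nat j *\<^sub>m a i) = of_nat (Suc n) *\<^sub>m a (Suc n) - (of_nat j - of_nat n) *\<^sub>m a n
      + ((of_nat j - of_nat n) *\<^sub>m a n + of_nat (Suc (Suc n)) *\<^sub>m a (Suc (Suc n)) - of_nat j *\<^sub>m a (Suc n))"
      using Suc by simp
    then show ?case by (simp add: vec_eq_iff mscale_def algebra_simps)
  qed
  define X where "X = (\<Sum>i\<le>j. a i)"
  have "ad s X - of_nat j *\<^sub>m X = (\<Sum>i\<le>j. ad s (a i) - of_nat j *\<^sub>m a i)"
    unfolding X_def by (simp only: MM.linear_sum[OF lin_ad] M.scale_sum_right sum_subtractf)
  also have "\<dots> = 0" unfolding sum using m(3)[of "Suc j"] mj by (simp add: a_def)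
  finally have "ad s X = of_nat j *\<^sub>m X" by simp
  moreover have "X \<in> L" unfolding X_def a_def by (intro M.subspace_sum[OF sL] M.subspace_scale[OF sL] F_L x)
  ultimately have X0: "X = 0" using no_odd_eigenvalue j by blast
  have "(F ^^ j) X = (\<Sum>i\<le>j. inverse (of_nat (fact i)) *\<^sub>m (F ^^ (j + i)) x)"
    unfolding X_def a_def by (simp only: MM.linear_sum[OF lf] MM.linear_scale[OF lf] funpow_add comp_apply)
  also have "\<dots> = (\<Sum>i\<in>{0}. inverse (of_nat (fact i)) *\<^sub>m (F ^^ (j + i)) x)"
    by (rule sum.mono_neutral_right) (auto simp: m(3) mj)
  also have "\<dots> = (F ^^ j) x" by simp
  finally show False using m(2) mj X0 by (simp add: MM.linear_0[OF lf])
qed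

lemma F_s: "(F ^^ 2) s = - (2 *\<^sub>m f)" "i \<ge> 3 \<Longrightarrow> (F ^^ i) s = 0"
proof -
  have fe: "ad f e = - h" using ef ad_antisym[of f e] by simp
  have fh: "ad f h = 2 *\<^sub>m f" using hf ad_antisym[of f h] by simp
  show 2: "(F ^^ 2) s = - (2 *\<^sub>m f)" by (simp add: numeral_2_eq_2 ad_simps fe fh)
  have "(F ^^ 3) s = F ((F ^^ 2) s)" by (simp add: numeral_3_eq_3 numeral_2_eq_2)
  also have "\<dots> = 0" unfolding 2 by (simp add: ad_simps)
  finally have 3: "(F ^^ 3) s = 0" .
  assume "i \<ge> 3"
  then have "(F ^^ i) s = (F ^^ (i - 3)) ((F ^^ 3) s)" by (metis funpow_add comp_apply le_add_diff_inverse2)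
  then show "(F ^^ i) s = 0" unfolding 3 by (simp add: MM.linear_0[OF lin_funpow[OF lin_ad]])
qed

text \<open>The combination \<open>X\<close> with coefficients \<open>kc\<close> commutes with
  \<open>s\<close>, hence is \<open>c s\<close>, and \<open>F^j\<close> isolates its first term. For
  \<open>j > 2\<close> this contradicts \<open>F^3 s = 0\<close>. For \<open>j = 2\<close> it makes
  \<open>F^2 x\<close> a multiple of \<open>f\<close>, and orthogonality of \<open>x\<close> to
  \<open>f\<close> forces the factor to vanish.\<close>

lemma even_weight:
  assumes x: "x \<in> L1" "ad e x = 0" "ad h x = of_nat j *\<^sub>m x" and j: "even j" "j \<ge> 2" and xf: "B x f = 0"
  shows "x = 0"
proof (rule ccontr)
  assume x0: "x \<noteq> 0"
  obtain m where m: "(of_nat j :: 'a) = of_nat m" "(F ^^ m) x \<noteq> 0" "\<And>i. i > m \<Longrightarrow> (F ^^ i) x = 0"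
    using highest_weight[OF x(2,3) x0] by blast
  have mj: "m = j" using m(1) by (simp only: of_nat_eq_iff)
  have lf: "lin (F ^^ i)" for i by (rule lin_funpow[OF lin_ad])
  let ?j = "of_nat j :: 'a"
  define b where "b i = kc ?j i *\<^sub>m (F ^^ (2 * i)) x" for i
  have E: "ad e ((F ^^ Suc i) x) = (of_nat (Suc i) * (?j - of_nat i)) *\<^sub>m (F ^^ i) x" for i
    unfolding E_F_pow x(2,3) MM.linear_scale[OF lf] MM.linear_0[OF lf]
    by (simp only: M.scale_left_diff_distrib[symmetric] M.scale_scale add_0)
  have Eb: "ad e (b (Suc i)) = - (kc ?j i *\<^sub>m (F ^^ (2 * i + 1)) x)" for i
  proof -
    have "j \<noteq> 2 * i + 1" using j(1) by auto
    then have n1: "?j - of_nat (2 * i + 1) \<noteq> 0" by (simp only: right_minus_eq of_nat_eq_iff not_False_eq_True)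
    have n2: "(of_nat (2 * i + 2) :: 'a) \<noteq> 0" unfolding of_nat_eq_0_iff by simp
    have e1: "Suc (2 * i + 1) = 2 * i + 2" and e2: "2 * Suc i = 2 * i + 2" by simp_all
    have "ad e ((F ^^ (2 * i + 2)) x) = (of_nat (2 * i + 2) * (?j - of_nat (2 * i + 1))) *\<^sub>m (F ^^ (2 * i + 1)) x"
      using E[of "2 * i + 1"] unfolding e1 .
    then have "ad e (b (Suc i)) = kc ?j (Suc i) *\<^sub>m (of_nat (2 * i + 2) * (?j - of_nat (2 * i + 1))) *\<^sub>m (F ^^ (2 * i + 1)) x"
      unfolding b_def ad_simps e2 by (rule arg_cong)
    also have "\<dots> = (- kc ?j i) *\<^sub>m (F ^^ (2 * i + 1)) x"
      unfolding M.scale_scale kc.simps using n1 n2 by (simp del: of_nat_add of_nat_mult of_nat_Suc)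
    finally show ?thesis by simp
  qed
  have sum: "(\<Sum>i\<le>n. ad s (b i)) = kc ?j n *\<^sub>m (F ^^ (2 * n + 1)) x" for n
  proof (induction n)
    case 0
    show ?case using x(2) by (simp add: b_def ad_simps)
  next
    case (Suc n)
    have "ad s (b (Suc n)) = - (kc ?j n *\<^sub>m (F ^^ (2 * n + 1)) x) + kc ?j (Suc n) *\<^sub>m (F ^^ (2 * Suc n + 1)) x"
      unfolding ad_simps(1) Eb by (simp add: b_def ad_simps del: kc.simps)
    then show ?case using Suc by (simp del: kc.simps)
  qed
  define X where "X = (\<Sum>i\<le>j. b i)"
  have "ad s X = (\<Sum>i\<le>j. ad s (b i))" unfolding X_def by (rule MM.linear_sum[OF lin_ad])
  also have "\<dots> = 0" unfolding sum using m(3)[of "2 * j + 1"] mj by simp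
  finally have sX: "ad s X = 0" .
  have F2: "(F ^^ (2 * i)) x \<in> L1" for i
  proof (induction i)
    case (Suc i)
    have "(F ^^ (2 * Suc i)) x = F (F ((F ^^ (2 * i)) x))" by simp
    then show ?case using ad10[OF f ad11[OF f Suc]] by simp
  qed (simp add: x)
  have "X \<in> L1" unfolding X_def b_def by (intro M.subspace_sum[OF sL1] M.subspace_scale[OF sL1] F2)
  then obtain c where c: "X = c *\<^sub>m s" using commutant sX by blast
  have "(F ^^ j) X = (\<Sum>i\<le>j. kc ?j i *\<^sub>m (F ^^ (j + 2 * i)) x)"
    unfolding X_def b_def by (simp only: MM.linear_sum[OF lf] MM.linear_scale[OF lf] funpow_add comp_apply)
  also have "\<dots> = (\<Sum>i\<in>{0}. kc ?j i *\<^sub>m (F ^^ (j + 2 * i)) x)"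
    by (rule sum.mono_neutral_right) (auto simp: m(3) mj)
  also have "\<dots> = (F ^^ j) x" by simp
  finally have Fj: "(F ^^ j) x = c *\<^sub>m (F ^^ j) s" unfolding c MM.linear_scale[OF lf] by simp
  show False
  proof (cases "j = 2")
    case False
    then have "j \<ge> 3" using j by auto
    then show ?thesis using Fj m(2) mj by (simp add: F_s(2))
  next
    case True
    have xL: "x \<in> L" by (rule L1_L[OF x(1)])
    have "B (F (F x)) e = - B (F x) (F e)" using B_ad_swap[OF adL[OF fL xL] fL eL] by simp
    also have "\<dots> = B x (F (F e))" using B_ad_swap[OF xL fL adL[OF fL eL]] by simp
    also have "F (F e) = - (2 *\<^sub>m f)"
      using ef hf ad_antisym[of f e] ad_antisym[of f h] by (simp add: ad_simps)
    also have "B x (- (2 *\<^sub>m f)) = 0" using xf fL by (simp add: B_neg2 B_scale2 M.subspace_scale[OF sL])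
    finally have 0: "B (F (F x)) e = 0" .
    have FFx: "F (F x) = c *\<^sub>m (- (2 *\<^sub>m f))" using Fj unfolding True F_s(1) by (simp add: numeral_2_eq_2)
    have "B (F (F x)) e = c * (- (2 * B f e))" unfolding FFx using fL
      by (simp only: B_scale1 B_neg1 M.subspace_scale[OF sL] M.subspace_neg[OF sL])
    then have "c = 0" using 0 B_ef B_sym[of f e] by simp
    then have "(F ^^ j) x = 0" using Fj by simp
    then show ?thesis using m(2) mj by simp
  qed
qed

text \<open>Weight zero means that \<open>F\<close> kills \<open>x\<close> as well, so
  \<open>x\<close> commutes with \<open>s\<close>; moreover
  \<open>B ([h, e]) x = B h ([e, x]) = 0\<close> gives orthogonality to \<open>e\<close>, and
  likewise to \<open>f\<close>.\<close>

lemma zero_weight: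
  assumes x: "x \<in> L1" "ad e x = 0" "ad h x = 0" shows "x = 0"
proof (rule ccontr)
  assume x0: "x \<noteq> 0"
  have xL: "x \<in> L" by (rule L1_L[OF x(1)])
  have "ad h x = of_nat 0 *\<^sub>m x" using x(3) by simp
  then obtain m where m: "(of_nat 0 :: 'a) = of_nat m" "\<And>i. i > m \<Longrightarrow> (F ^^ i) x = 0"
    using highest_weight[OF x(2) _ x0] by blast
  have "m = 0" using m(1) by (simp only: of_nat_eq_iff)
  then have Fx: "F x = 0" using m(2)[of 1] by simp
  have "B (ad h e) x = 0" unfolding B_inv[OF hL eL xL] x(2) by (rule B_0)
  then have 1: "B e x = 0" unfolding he using eL by (simp add: B_scale1)
  have "B (ad h f) x = 0" unfolding B_inv[OF hL fL xL] Fx by (rule B_0)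
  then have 2: "B f x = 0" unfolding hf using fL by (simp add: B_scale1 B_neg1 M.subspace_scale[OF sL])
  have "ad s x = 0" using x(2) Fx by (simp add: ad_simps)
  moreover have "B s x = 0" using 1 2 eL fL by (simp add: B_add1)
  ultimately show False using commutant_zero[OF x(1)] x0 by blast
qed

text \<open>The vector \<open>[f, x]\<close> has weight \<open>-1\<close>, so within
  \<open>L0\<close> only weight one can pair with it. Elements of weight one in \<open>L0\<close>
  commute with \<open>e\<close>, since otherwise they could be raised to a highest weight vector of
  odd weight at least three; on them \<open>orth\<close> applies. So \<open>[f, x]\<close> is
  orthogonal to \<open>L0\<close> and vanishes, which weight one forbids.\<close>

lemma one_weight:
  assumes x: "x \<in> L1" "ad e x = 0" "ad h x = x"
    and orth: "\<And>u. u \<in> L0 \<Longrightarrow> ad e u = 0 \<Longrightarrow> B x (ad u f) = 0"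
  shows "x = 0"
proof (rule ccontr)
  assume x0: "x \<noteq> 0"
  have xL: "x \<in> L" by (rule L1_L[OF x(1)])
  let ?y = "ad f x"
  have y0: "?y \<in> L0" by (rule ad11[OF f x(1)])
  have yL: "?y \<in> L" by (rule L0_L[OF y0])
  have hy: "ad h ?y = - ?y" unfolding HF x(3) using M.scale_left_distrib[of 1 1 ?y] by simp
  have "B ?y w = 0" if w: "w \<in> L0" for w
  proof -
    have "\<exists>a\<in>L0. \<exists>b\<in>L0. shift (ad h) 1 a = 0 \<and> w = a + shift (ad h) 1 b"
    proof (rule fitting[OF lin_shift[OF lin_ad] sL0 _ H_diag w])
      show "shift (ad h) 1 v \<in> L0" if "v \<in> L0" for v
        unfolding shift_def using that h by (intro M.subspace_diff[OF sL0] M.subspace_scale[OF sL0] ad00)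
    qed
    then obtain a b where ab: "a \<in> L0" "b \<in> L0" "ad h a = a" "w = a + (ad h b - b)"
      unfolding shift_def by auto
    have aL: "a \<in> L" and bL: "b \<in> L" using ab by (simp_all add: L0_L)
    have "ad e a = 0"
    proof (rule ccontr)
      assume ea: "ad e a \<noteq> 0"
      obtain k where k: "(E ^^ k) (ad e a) \<noteq> 0" "E ((E ^^ k) (ad e a)) = 0" using raise_to_highest[OF ea] by blast
      let ?v = "(E ^^ Suc k) a"
      have v: "?v = (E ^^ k) (ad e a)" by (simp only: funpow_Suc_right comp_apply)
      have "H ?v = (E ^^ Suc k) a + (2 * of_nat (Suc k)) *\<^sub>m (E ^^ Suc k) a" unfolding H_E_pow ab(3) ..
      also have "\<dots> = of_nat (2 * k + 3) *\<^sub>m ?v" by (simp add: vec_eq_iff mscale_def algebra_simps)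
      finally have Hv: "H ?v = of_nat (2 * k + 3) *\<^sub>m ?v" .
      have vL: "?v \<in> L" by (rule funpow_in) (use adL[OF eL] aL in auto)
      have "?v = 0" by (rule no_odd_weight[OF vL _ Hv]) (use k(2) v in auto)
      then show False using k(1) v by simp
    qed
    then have "B x (ad a f) = 0" by (rule orth[OF ab(1)])
    moreover have "B ?y a = - B x (ad f a)" using B_ad_swap[OF xL fL aL] by simp
    moreover have "B x (ad f a) = - B x (ad a f)" unfolding ad_antisym[of f a] by (rule B_neg2[OF adL[OF aL fL]])
    ultimately have 1: "B ?y a = 0" by simp
    have "B ?y (ad h b) = - B (ad h ?y) b" by (rule B_ad_swap[OF yL hL bL])
    also have "\<dots> = B ?y b" unfolding hy B_neg1[OF yL] by simp
    finally have 2: "B ?y (ad h b) = B ?y b" .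
    show ?thesis unfolding ab(4) using 1 2 aL bL adL[OF hL bL]
      by (simp add: B_add2 B_diff2 M.subspace_diff[OF sL])
  qed
  then have "?y \<in> cent L" by (rule rad_B0[OF y0])
  then have Fx: "?y = 0" using brk_in[OF fL xL] by (rule cent_brk_0)
  have "ad h x = of_nat 1 *\<^sub>m x" using x(3) by simp
  then obtain m where m: "(of_nat 1 :: 'a) = of_nat m" "(F ^^ m) x \<noteq> 0"
    using highest_weight[OF x(2) _ x0] by blast
  have "m = 1" using m(1) by (simp only: of_nat_eq_iff)
  then show False using m(2) Fx by simp
qed

text \<open>The conditions cut out a subspace stable under \<open>ad h\<close>, so semisimplicity
  provides a weight vector in it; being killed by \<open>e\<close>, its weight is a natural number
  and falls under one of the four cases above.\<close>

lemma normal_slice: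
  assumes x: "x \<in> L1" "ad e x = 0" "B x f = 0"
    and orth: "\<And>u. u \<in> L0 \<Longrightarrow> ad e u = 0 \<Longrightarrow> B x (ad u f) = 0"
  shows "x = 0"
proof (rule ccontr)
  assume x0: "x \<noteq> 0"
  let ?K = "{x \<in> L1. ad e x = 0 \<and> B x f = 0 \<and> (\<forall>u\<in>L0. ad e u = 0 \<longrightarrow> B x (ad u f) = 0)}"
  have sK: "M.subspace ?K"
    by (rule M.subspaceI) (auto simp: M.subspace_0[OF sL1] M.subspace_add[OF sL1] M.subspace_scale[OF sL1]
      ad_simps B_0 B_add1 B_scale1 L1_L)
  have hK: "ad h v \<in> ?K" if v: "v \<in> ?K" for v
  proof -
    have vL: "v \<in> L" using v L1_L by blast
    have 1: "ad h v \<in> L1" using v by (intro ad01[OF h]) blast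
    have 2: "ad e (ad h v) = 0" using HE[of v] v by (simp add: ad_simps)
    have "B v (ad h f) = 0" unfolding hf using v fL by (simp add: B_scale2 B_neg2 M.subspace_scale[OF sL])
    then have 3: "B (ad h v) f = 0" using B_ad_swap[OF vL hL fL] by simp
    have 4: "B (ad h v) (ad u f) = 0" if u: "u \<in> L0" "ad e u = 0" for u
    proof -
      have uL: "u \<in> L" by (rule L0_L[OF u(1)])
      have "ad e (ad h u) = 0" using HE[of u] u(2) by (simp add: ad_simps)
      then have a: "B v (ad (ad h u) f) = 0" using v ad00[OF h u(1)] by blast
      have b: "B v (ad u f) = 0" using v u by blast
      have "ad h (ad u f) = ad (ad h u) f + (-2) *\<^sub>m ad u f" unfolding jacobi[of h u f] hf ad_simps ..
      then have "B v (ad h (ad u f)) = 0"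
        using a b adL[OF uL fL] adL[OF adL[OF hL uL] fL] by (simp only: B_add2 B_scale2 M.subspace_scale[OF sL]) simp
      then show ?thesis using B_ad_swap[OF vL hL adL[OF uL fL]] by simp
    qed
    show ?thesis using 1 2 3 4 by blast
  qed
  have "x \<in> ?K" using x orth by blast
  from geig_decomp[OF lin_ad sK hK this] obtain S w
    where w: "finite S" "\<And>c. w c \<in> geig (ad h) ?K c" "x = (\<Sum>c\<in>S. w c)" by blast
  obtain c where c: "w c \<noteq> 0"
  proof -
    have "\<exists>c\<in>S. w c \<noteq> 0"
    proof (rule ccontr)
      assume "\<not> ?thesis"
      then have "(\<Sum>c\<in>S. w c) = 0" by (intro sum.neutral) blast
      then show False using x0 w(3) by simp
    qed
    then show thesis using that by blast
  qed
  define v where "v = w c"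
  have vK: "v \<in> ?K" unfolding v_def using w(2)[of c] unfolding geig_def by blast
  obtain N where N: "(shift (ad h) c ^^ N) v = 0" unfolding v_def using w(2)[of c] unfolding geig_def by blast
  have "(shift (ad h) c ^^ Suc n) v = 0 \<Longrightarrow> shift (ad h) c v = 0" for n
  proof (induction n)
    case (Suc n)
    have "shift (ad h) c (shift (ad h) c ((shift (ad h) c ^^ n) v)) = 0" using Suc.prems by simp
    then have "shift (ad h) c ((shift (ad h) c ^^ n) v) = 0" by (rule H_diag)
    then show ?case using Suc.IH by simp
  qed simp
  moreover have "(shift (ad h) c ^^ Suc N) v = 0" using N by (simp add: MM.linear_0[OF lin_shift[OF lin_ad]])
  ultimately have "shift (ad h) c v = 0" by blast
  then have hv: "ad h v = c *\<^sub>m v" by (simp add: shift_def)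
  have v0: "v \<noteq> 0" unfolding v_def by (rule c)
  have v: "v \<in> L1" "ad e v = 0" "B v f = 0" "\<And>u. u \<in> L0 \<Longrightarrow> ad e u = 0 \<Longrightarrow> B v (ad u f) = 0"
    using vK by blast+
  obtain j where "c = of_nat j" using highest_weight[OF v(2) hv v0] by blast
  then have hv: "ad h v = of_nat j *\<^sub>m v" using hv by simp
  have "j = 0 \<or> j = 1 \<or> (even j \<and> j \<ge> 2) \<or> (odd j \<and> j \<ge> 3)" by presburger
  then consider "j = 0" | "j = 1" | "even j" "j \<ge> 2" | "odd j" "j \<ge> 3" by blast
  then have "v = 0"
  proof cases
    case 1
    then have "ad h v = 0" using hv by simp
    then show ?thesis by (rule zero_weight[OF v(1,2)])
  next
    case 2
    then have "ad h v = v" using hv by simp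
    then show ?thesis using v(4) by (rule one_weight[OF v(1,2)])
  next
    case 3
    show ?thesis by (rule even_weight[OF v(1,2) hv 3 v(3)])
  next
    case 4
    show ?thesis by (rule no_odd_weight[OF L1_L[OF v(1)] v(2) hv 4])
  qed
  then show False using v0 by blast
qed

text \<open>By duality: a functional vanishing on the right side is \<open>B y\<close> on
  \<open>L1\<close> for some \<open>y\<close>. Orthogonality to \<open>[L0, e]\<close> makes
  \<open>[e, y]\<close> orthogonal to \<open>L0\<close>, hence zero, and \<open>normal_slice\<close>
  gives \<open>y = 0\<close>.\<close>

lemma spanning: "L1 = M.span (insert f (orb L0 e \<union> orb {u \<in> L0. ad u e = 0} f))"
proof -
  let ?G = "insert f (orb L0 e \<union> orb {u \<in> L0. ad u e = 0} f)"
  have GL: "M.span ?G \<subseteq> L1"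
    by (rule M.span_minimal[OF _ sL1]) (use f orb_sub[OF e(1)] orb_sub[OF f] in \<open>auto simp: orb_def\<close>)
  have "v \<in> M.span ?G" if v: "v \<in> L1" for v
  proof (rule ccontr)
    assume nv: "v \<notin> M.span ?G"
    obtain \<psi> where \<psi>: "linf \<psi>" "\<forall>y\<in>M.span ?G. \<psi> y = 0" "\<psi> v = 1"
      using separating_functional[OF M.subspace_span nv] by blast
    interpret pairing "\<lambda>y v. 2 * trace (y ** v)" L1
      by (rule pairing.intro[OF sL1]; rule linfI; simp add: mm_simps trace_simps algebra_simps)
    have "\<exists>y\<in>L1. \<forall>v\<in>L1. 2 * trace (y ** v) = \<psi> v"
    proof (rule represent[OF sL1])
      fix v assume v: "v \<in> L1" "\<forall>y\<in>L1. 2 * trace (y ** v) = 0"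
      show "v = 0"
      proof (rule nondeg1[OF v(1)])
        show "B v y = 0" if "y \<in> L1" for y using v(2) that B_11[OF that v(1)] B_sym[of v y] by simp
      qed
    qed (simp_all add: MK.linear_add[OF \<psi>(1)] MK.linear_scale[OF \<psi>(1)])
    then obtain y where y: "y \<in> L1" "\<And>v. v \<in> L1 \<Longrightarrow> B y v = \<psi> v" using B_11 by metis
    have yL: "y \<in> L" by (rule L1_L[OF y(1)])
    have G0: "B y v = 0" if "v \<in> ?G" for v
    proof -
      have "v \<in> M.span ?G" using that by (rule M.span_base)
      then show ?thesis using y(2)[of v] \<psi>(2) GL by auto
    qed
    have "y = 0"
    proof (rule normal_slice[OF y(1)])
      show "B y f = 0" by (rule G0) simp
      show "B y (ad u f) = 0" if "u \<in> L0" "ad e u = 0" for u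
      proof (rule G0)
        have "ad u e = 0" using that(2) ad_antisym[of u e] by simp
        then show "ad u f \<in> ?G" using that(1) unfolding orb_def by blast
      qed
      have ey: "ad e y \<in> L0" by (rule ad11[OF e(1) y(1)])
      have "B (ad e y) u = 0" if u: "u \<in> L0" for u
      proof -
        have uL: "u \<in> L" by (rule L0_L[OF u])
        have "B y (ad u e) = 0" by (rule G0) (use u in \<open>auto simp: orb_def\<close>)
        moreover have "B y (ad u e) = - B y (ad e u)"
          unfolding ad_antisym[of u e] by (rule B_neg2[OF adL[OF eL uL]])
        ultimately show ?thesis using B_ad_swap[OF yL eL uL] by simp
      qed
      then have "ad e y \<in> cent L" by (rule rad_B0[OF ey])
      then show "ad e y = 0" using brk_in[OF eL yL] by (rule cent_brk_0)
    qed
    then show False using y(2)[OF v] \<psi>(3) by (simp add: B_0)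
  qed
  then show ?thesis using GL by blast
qed

end

context rank_one
begin

text \<open>The choice \<open>y = f\<close> works; the generator \<open>f\<close> of
  \<open>spanning\<close> accounts for the one extra dimension.\<close>

lemma slice_lower: "\<exists>y\<in>L1. M.dim L1 \<le> Suc (M.dim (orb L0 e \<union> orb {u \<in> L0. ad u e = 0} y))"
proof -
  obtain h f where trip: "h \<in> L0" "f \<in> L1" "sl2_triple e h f" using jacobson_morozov[OF e(1,3)] by blast
  interpret rank_one_triple L \<sigma> e y0 h f
    by (rule rank_one_triple.intro[OF rank_one_axioms trip(3)]) (simp add: rank_one_triple_axioms_def trip)
  let ?W = "orb L0 e \<union> orb {u \<in> L0. ad u e = 0} f"
  have "M.dim (M.span (insert f ?W)) = M.dim (insert f ?W)" by (rule M.dim_span)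
  then have "M.dim L1 = M.dim (insert f ?W)" by (simp only: spanning[symmetric])
  also have "\<dots> \<le> Suc (M.dim ?W)" unfolding M.dim_insert by simp
  finally show ?thesis using trip(2) by blast
qed

lemma slice_upper:
  assumes y: "y \<in> L1"
  shows "M.dim (orb L0 e \<union> orb {u \<in> L0. ad u e = 0} y) < M.dim L1"
proof -
  let ?P = "{v \<in> L1. B e v = 0}"
  have eL: "e \<in> L" by (rule L1_L[OF e(1)])
  have yL: "y \<in> L" by (rule L1_L[OF y])
  have sP: "M.subspace ?P"
    by (rule M.subspaceI) (auto simp: M.subspace_0[OF sL1] M.subspace_add[OF sL1] M.subspace_scale[OF sL1]
      B_0 B_add2 B_scale2 L1_L)
  obtain v where v: "v \<in> L1" "B e v \<noteq> 0" using nondeg1[OF e(1)] e(2) by blast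
  have 1: "B e (ad u e) = 0" if "u \<in> L0" for u
    using B_orb_0[OF L0_L[OF that] eL] B_sym[of e "ad u e"] by simp
  have 2: "B e (ad u y) = 0" if "u \<in> L0" "ad u e = 0" for u
    using B_ad_swap[OF eL L0_L[OF that(1)] yL] that(2) by (simp add: B_0)
  have "orb L0 e \<union> orb {u \<in> L0. ad u e = 0} y \<subseteq> ?P"
    using 1 2 ad01[OF _ e(1)] ad01[OF _ y] unfolding orb_def by blast
  then have "M.dim (orb L0 e \<union> orb {u \<in> L0. ad u e = 0} y) \<le> M.dim ?P" by (rule M.dim_subset)
  also have "\<dots> < M.dim L1"
  proof (rule M.dim_psubset)
    have "?P \<subset> L1" using v by blast
    then show "M.span ?P \<subset> M.span L1"
      by (simp only: M.span_eq_iff[THEN iffD2, OF sP] M.span_eq_iff[THEN iffD2, OF sL1])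
  qed
  finally show ?thesis .
qed

end

section \<open>Computing the indices\<close>

text \<open>The complement is delivered as a projection \<open>P\<close> along \<open>U\<close>; its
  image of \<open>V\<close> models \<open>V / U\<close> inside the matrix space.\<close>

lemma linear_complement:
  fixes U V :: "('k::field^'n^'n) set"
  assumes U: "M.subspace U" and V: "M.subspace V" and UV: "U \<subseteq> V"
  obtains P where "lin P" "\<And>u. u \<in> U \<Longrightarrow> P u = 0" "\<And>v. v \<in> V \<Longrightarrow> v - P v \<in> U"
proof -
  obtain A where A: "A \<subseteq> U" "M.independent A" "U \<subseteq> M.span A" using M.basis_exists by metis
  then have "A \<subseteq> V" using UV by blast
  then obtain C where C: "A \<subseteq> C" "C \<subseteq> V" "M.independent C" "V \<subseteq> M.span C"
    using M.maximal_independent_subset_extend[OF _ A(2)] by metis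
  obtain P where P: "lin P" "\<forall>b\<in>C. P b = (if b \<in> A then 0 else b)"
    using MM.linear_independent_extend[OF C(3), of "\<lambda>b. if b \<in> A then 0 else b"] by blast
  have PA: "P b = 0" if "b \<in> A" for b using P(2) C(1) that by auto
  have 1: "P u = 0" if "u \<in> M.span A" for u
    using that by (induction rule: M.span_induct_alt)
      (simp_all add: MM.linear_0[OF P(1)] MM.linear_add[OF P(1)] MM.linear_scale[OF P(1)] PA)
  have 2: "v - P v \<in> U" if "v \<in> M.span C" for v
    using that
  proof (induction rule: M.span_induct_alt)
    case (step c x y)
    have "x - P x \<in> U" using P(2) step(1) A(1) M.subspace_0[OF U] by auto
    then have "c *\<^sub>m (x - P x) + (y - P y) \<in> U" using step by (intro M.subspace_add[OF U] M.subspace_scale[OF U])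
    moreover have eq: "c *\<^sub>m x + y - P (c *\<^sub>m x + y) = c *\<^sub>m (x - P x) + (y - P y)"
      by (simp add: MM.linear_add[OF P(1)] MM.linear_scale[OF P(1)] M.scale_right_diff_distrib)
    ultimately show ?case unfolding eq by blast
  qed (simp add: MM.linear_0[OF P(1)] M.subspace_0[OF U])
  show thesis by (rule that[OF P(1)]) (use 1 2 A C in blast)+
qed

text \<open>A model \<open>\<pi> : V \<rightarrow> Q\<close> of the quotient \<open>V / U\<close>; it covers both the cosets and, for \<open>U = 0\<close>,
  the space \<open>V\<close> itself.\<close>

locale quotient_model =
  fixes V U :: "('k::field^'n^'n) set" and \<pi> :: "'k^'n^'n \<Rightarrow> 'q" and Q :: "'q set"
    and add :: "'q \<Rightarrow> 'q \<Rightarrow> 'q" and scl :: "'k \<Rightarrow> 'q \<Rightarrow> 'q"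
    and q :: "('k^'n^'n) set" and actQ :: "'k^'n^'n \<Rightarrow> 'q \<Rightarrow> 'q"
  assumes V: "M.subspace V" and U: "M.subspace U" and UV: "U \<subseteq> V" and Q: "Q = \<pi> ` V"
    and \<pi>_add: "\<And>x y. x \<in> V \<Longrightarrow> y \<in> V \<Longrightarrow> add (\<pi> x) (\<pi> y) = \<pi> (x + y)"
    and \<pi>_scl: "\<And>c x. x \<in> V \<Longrightarrow> scl c (\<pi> x) = \<pi> (c *\<^sub>m x)"
    and \<pi>_eq: "\<And>x y. x \<in> V \<Longrightarrow> y \<in> V \<Longrightarrow> \<pi> x = \<pi> y \<longleftrightarrow> x - y \<in> U"
    and act_V: "\<And>x v. x \<in> q \<Longrightarrow> v \<in> V \<Longrightarrow> ad x v \<in> V"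
    and act_Q: "\<And>x v. x \<in> q \<Longrightarrow> v \<in> V \<Longrightarrow> actQ x (\<pi> v) = \<pi> (ad x v)"
begin

abbreviation "D \<equiv> dual_space add scl Q"

lemma D_add:
  assumes f: "f \<in> D" and xy: "x \<in> V" "y \<in> V"
  shows "f (\<pi> (x + y)) = f (\<pi> x) + f (\<pi> y)"
proof -
  have "f (add (\<pi> x) (\<pi> y)) = f (\<pi> x) + f (\<pi> y)" using f xy unfolding dual_space_def Q by blast
  then show ?thesis by (simp only: \<pi>_add[OF xy])
qed

lemma D_scale:
  assumes f: "f \<in> D" and x: "x \<in> V"
  shows "f (\<pi> (c *\<^sub>m x)) = c * f (\<pi> x)"
proof -
  have "f (scl c (\<pi> x)) = c * f (\<pi> x)" using f x unfolding dual_space_def Q by blast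
  then show ?thesis by (simp only: \<pi>_scl[OF x])
qed

lemma D_out: "f \<in> D \<Longrightarrow> a \<notin> Q \<Longrightarrow> f a = 0"
  unfolding dual_space_def by blast

lemma D_I:
  assumes "\<And>x y. x \<in> V \<Longrightarrow> y \<in> V \<Longrightarrow> f (\<pi> (x + y)) = f (\<pi> x) + f (\<pi> y)"
    "\<And>c x. x \<in> V \<Longrightarrow> f (\<pi> (c *\<^sub>m x)) = c * f (\<pi> x)" "\<And>a. a \<notin> Q \<Longrightarrow> f a = 0"
  shows "f \<in> D"
  unfolding dual_space_def
proof (intro CollectI conjI ballI allI impI)
  fix a b assume "a \<in> Q" "b \<in> Q"
  then obtain x y where xy: "x \<in> V" "y \<in> V" "a = \<pi> x" "b = \<pi> y" unfolding Q by blast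
  show "f (add a b) = f a + f b" unfolding xy(3,4) \<pi>_add[OF xy(1,2)] by (rule assms(1)[OF xy(1,2)])
next
  fix c a assume "a \<in> Q"
  then obtain x where x: "x \<in> V" "a = \<pi> x" unfolding Q by blast
  show "f (scl c a) = c * f a" unfolding x(2) \<pi>_scl[OF x(1)] by (rule assms(2)[OF x(1)])
qed (rule assms(3))

lemma D_eqI:
  assumes "f \<in> D" "g \<in> D" "\<And>v. v \<in> V \<Longrightarrow> f (\<pi> v) = g (\<pi> v)"
  shows "f = g"
proof
  fix a show "f a = g a"
  proof (cases "a \<in> Q")
    case True
    then obtain v where "v \<in> V" "a = \<pi> v" unfolding Q by blast
    then show ?thesis using assms(3) by blast
  next
    case False
    show ?thesis using D_out[OF assms(1) False] D_out[OF assms(2) False] by simp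
  qed
qed

lemma D_subspace: "F.subspace D"
proof (rule F.subspaceI)
  show "0 \<in> D" by (rule D_I) simp_all
  show "f + g \<in> D" if "f \<in> D" "g \<in> D" for f g
    by (rule D_I) (simp_all add: D_add[OF that(1)] D_add[OF that(2)] D_scale[OF that(1)] D_scale[OF that(2)]
      D_out[OF that(1)] D_out[OF that(2)] distrib_left)
  show "fscale c f \<in> D" if "f \<in> D" for c f
    by (rule D_I) (simp_all add: fscale_def D_add[OF that] D_scale[OF that] D_out[OF that] distrib_left)
qed

text \<open>The module is a dual, so the functionals in \<open>lie_index\<close> live on that dual
  and are evaluations at vectors of \<open>V\<close>; their orbits are the orbits in
  \<open>V / U\<close>. The subtraction of \<open>M.dim U\<close> is the passage from
  \<open>q y + U\<close> to its image in the quotient.\<close>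

lemma index_formula:
  "lie_index fscale q (dual_act Q actQ) D =
    int (M.dim V) - int (M.dim U) - int (MAX y\<in>V. M.dim (orb q y \<union> U) - M.dim U)"
proof -
  obtain P where P: "lin P" "\<And>u. u \<in> U \<Longrightarrow> P u = 0" "\<And>v. v \<in> V \<Longrightarrow> v - P v \<in> U"
    using linear_complement[OF U V UV] by blast
  have PV: "P v \<in> V" if "v \<in> V" for v
  proof -
    have "v - (v - P v) \<in> V" by (rule M.subspace_diff[OF V that subsetD[OF UV P(3)[OF that]]])
    then show ?thesis by simp
  qed
  have PP: "P (P v) = P v" if "v \<in> V" for v
    using P(2)[OF P(3)[OF that]] by (simp add: MM.linear_diff[OF P(1)])
  define C where "C = P ` V"
  have sC: "M.subspace C" unfolding C_def by (rule MM.linear_subspace_image[OF P(1) V])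
  have CV: "C \<subseteq> V" unfolding C_def using PV by blast
  have PC: "P w = w" if w: "w \<in> C" for w
  proof -
    obtain v where "v \<in> V" "w = P v" using w unfolding C_def by blast
    then show ?thesis by (simp add: PP)
  qed
  have piP: "\<pi> (P v) = \<pi> v" if "v \<in> V" for v
  proof -
    have "\<pi> v = \<pi> (P v)" using \<pi>_eq[OF that PV[OF that]] P(3)[OF that] by blast
    then show ?thesis by (rule sym)
  qed
  have dimS: "M.dim (S \<union> U) = M.dim (P ` S) + M.dim U" if S: "S \<subseteq> V" for S
  proof -
    let ?W = "M.span (P ` S)"
    have WC: "?W \<subseteq> C" by (rule M.span_minimal[OF _ sC]) (use S in \<open>auto simp: C_def\<close>)
    have "?W \<inter> U = {0}"
    proof -
      have "w = 0" if w: "w \<in> ?W" "w \<in> U" for w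
      proof -
        have "P w = w" by (rule PC) (use w WC in blast)
        then show ?thesis using P(2)[OF w(2)] by simp
      qed
      then show ?thesis using M.span_zero M.subspace_0[OF U] by blast
    qed
    then have d0: "M.dim (?W \<inter> U) = 0" by simp
    have "M.span (S \<union> U) = {x + y |x y. x \<in> ?W \<and> y \<in> U}" (is "_ = ?X")
    proof
      have sX: "M.subspace ?X" by (rule M.subspace_sums[OF M.subspace_span U])
      have "s \<in> ?X" if s: "s \<in> S" for s
      proof -
        have "P s \<in> ?W" using s by (intro M.span_base) blast
        moreover have "s - P s \<in> U" by (rule P(3)) (use s S in blast)
        moreover have "s = P s + (s - P s)" by simp
        ultimately show ?thesis by blast
      qed
      moreover have "u \<in> ?X" if u: "u \<in> U" for u
      proof -
        have "u = 0 + u" by simp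
        then show ?thesis using u M.span_zero[of "P ` S"] by blast
      qed
      ultimately show "M.span (S \<union> U) \<subseteq> ?X" by (intro M.span_minimal sX) blast
      have Us: "U \<subseteq> M.span (S \<union> U)" by (meson M.span_superset le_supE)
      have "P s \<in> M.span (S \<union> U)" if s: "s \<in> S" for s
      proof -
        have "s - P s \<in> M.span (S \<union> U)" using P(3)[of s] s S Us by blast
        moreover have "s \<in> M.span (S \<union> U)" by (rule M.span_base) (use s in blast)
        ultimately have "s - (s - P s) \<in> M.span (S \<union> U)" by (rule M.span_diff[rotated])
        then show ?thesis by simp
      qed
      then have "?W \<subseteq> M.span (S \<union> U)" by (intro M.span_minimal) auto
      then show "?X \<subseteq> M.span (S \<union> U)" using Us by (auto intro!: M.span_add)
    qed
    then have "M.dim (M.span (S \<union> U)) = M.dim ?X" by (rule arg_cong)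
    then have "M.dim (S \<union> U) = M.dim ?X" by (simp only: M.dim_span)
    also have "\<dots> = M.dim ?W + M.dim U"
      using M.dim_sums_Int[OF M.subspace_span U, of "P ` S"] d0 by simp
    finally show ?thesis by simp
  qed
  have dimC: "M.dim V = M.dim C + M.dim U"
    using dimS[of V] UV by (simp add: C_def Un_absorb2)
  obtain A where A: "A \<subseteq> C" "M.independent A" "C \<subseteq> M.span A" "card A = M.dim C" using M.basis_exists by metis
  have finA: "finite A" by (rule M.finiteI_independent[OF A(2)])
  have spanA: "M.span A = C" by (rule M.span_subspace[OF A(1,3) sC])
  have "\<exists>f. linf f \<and> (\<forall>a\<in>A. f a = (if a = b then 1 else 0))" for b
    using MK.linear_independent_extend[OF A(2), of "\<lambda>a. if a = b then 1 else 0"] by blast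
  then obtain \<phi> where \<phi>: "\<And>b. linf (\<phi> b)" "\<And>a b. a \<in> A \<Longrightarrow> \<phi> b a = (if a = b then 1 else 0)" by metis
  have expand: "w = (\<Sum>b\<in>A. \<phi> b w *\<^sub>m b)" if "w \<in> C" for w
  proof -
    have "w \<in> M.span A" using that spanA by simp
    then show ?thesis
    proof (induction rule: M.span_induct_alt)
      case (step c x y)
      have "(\<Sum>b\<in>A. \<phi> b x *\<^sub>m b) = (\<Sum>b\<in>A. if b = x then b else 0)"
        using step(1) by (intro sum.cong refl) (auto simp: \<phi>(2))
      then have "(\<Sum>b\<in>A. \<phi> b x *\<^sub>m b) = x" using step(1) finA by simp
      moreover have "(\<Sum>b\<in>A. \<phi> b (c *\<^sub>m x + y) *\<^sub>m b) = c *\<^sub>m (\<Sum>b\<in>A. \<phi> b x *\<^sub>m b) + (\<Sum>b\<in>A. \<phi> b y *\<^sub>m b)"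
        by (simp add: MK.linear_add[OF \<phi>(1)] MK.linear_scale[OF \<phi>(1)] M.scale_left_distrib sum.distrib M.scale_sum_right)
      ultimately show ?case using step(2) by simp
    qed (simp add: MK.linear_0[OF \<phi>(1)])
  qed
  \<comment> \<open>The coordinate functional of the basis element \<open>b\<close> on cosets;
    composing with \<open>P\<close>, which kills \<open>U\<close>, makes it independent of the
    chosen representative.\<close>
  define lift where "lift b a = (if a \<in> Q then \<phi> b (P (SOME v. v \<in> V \<and> \<pi> v = a)) else 0)" for b a
  have lift: "lift b (\<pi> v) = \<phi> b (P v)" if v: "v \<in> V" for b v
  proof -
    define w where "w = (SOME w. w \<in> V \<and> \<pi> w = \<pi> v)"
    have w: "w \<in> V \<and> \<pi> w = \<pi> v" unfolding w_def by (rule someI[of _ v]) (use v in blast)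
    then have "w - v \<in> U" using \<pi>_eq[of w v] v by blast
    then have "P w = P v" using P(2)[of "w - v"] by (simp add: MM.linear_diff[OF P(1)])
    then show ?thesis unfolding lift_def w_def[symmetric] using v Q by auto
  qed
  have liftD: "lift b \<in> D" for b
    by (rule D_I) (simp_all add: lift M.subspace_add[OF V] M.subspace_scale[OF V] MM.linear_add[OF P(1)]
      MM.linear_scale[OF P(1)] MK.linear_add[OF \<phi>(1)] MK.linear_scale[OF \<phi>(1)], simp add: lift_def)
  have AV: "b \<in> V" if "b \<in> A" for b using that A(1) CV by blast
  have D_sum: "f (\<pi> (\<Sum>b\<in>A'. c b *\<^sub>m b)) = (\<Sum>b\<in>A'. c b * f (\<pi> b))" if f: "f \<in> D" and A': "A' \<subseteq> A" for f c A'
    using finite_subset[OF A' finA] A'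
  proof (induction A' rule: finite_induct)
    case empty
    show ?case using D_scale[OF f M.subspace_0[OF V], of 0] by simp
  next
    case (insert b A')
    have "(\<Sum>b\<in>A'. c b *\<^sub>m b) \<in> V" by (intro M.subspace_sum[OF V] M.subspace_scale[OF V] AV) (use insert in blast)
    moreover have "c b *\<^sub>m b \<in> V" by (intro M.subspace_scale[OF V] AV) (use insert in blast)
    ultimately show ?case using insert AV by (simp add: D_add[OF f] D_scale[OF f])
  qed
  have D_expand: "f (\<pi> v) = (\<Sum>b\<in>A. \<phi> b (P v) * f (\<pi> b))" if "f \<in> D" "v \<in> V" for f v
  proof -
    have "P v \<in> C" unfolding C_def using that(2) by blast
    have "f (\<pi> v) = f (\<pi> (P v))" using piP[OF that(2)] by simp
    also have "\<dots> = f (\<pi> (\<Sum>b\<in>A. \<phi> b (P v) *\<^sub>m b))" using expand[OF \<open>P v \<in> C\<close>] by (rule arg_cong)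
    also have "\<dots> = (\<Sum>b\<in>A. \<phi> b (P v) * f (\<pi> b))" by (rule D_sum[OF that(1) order_refl])
    finally show ?thesis .
  qed
  have lift_A: "lift b (\<pi> a) = (if a = b then 1 else 0)" if "a \<in> A" for a b
  proof -
    have "P a = a" by (rule PC) (use that A(1) in blast)
    then show ?thesis using lift[OF AV[OF that], of b] by (simp only: \<phi>(2)[OF that])
  qed
  have fsum: "(\<Sum>b\<in>S. g b) a = (\<Sum>b\<in>S. g b a)" for S :: "('k^'n^'n) set" and g :: "'k^'n^'n \<Rightarrow> 'q \<Rightarrow> 'k" and a
    by (induction S rule: infinite_finite_induct) simp_all
  have D_span: "f = (\<Sum>b\<in>A. fscale (f (\<pi> b)) (lift b))" if f: "f \<in> D" for f
  proof (rule D_eqI[OF f])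
    show "(\<Sum>b\<in>A. fscale (f (\<pi> b)) (lift b)) \<in> D"
      by (intro F.subspace_sum[OF D_subspace] F.subspace_scale[OF D_subspace] liftD)
    show "f (\<pi> v) = (\<Sum>b\<in>A. fscale (f (\<pi> b)) (lift b)) (\<pi> v)" if v: "v \<in> V" for v
      unfolding D_expand[OF f v] fsum by (simp add: fscale_def lift[OF v] mult.commute)
  qed
  \<comment> \<open>Evaluation at \<open>w\<close>, cut off outside \<open>D\<close> as
    \<open>dual_space\<close> demands; writing it in coordinates makes it linear in \<open>w\<close>
    over all matrices.\<close>
  define EV where "EV w = (\<lambda>f. if f \<in> D then (\<Sum>b\<in>A. \<phi> b w * f (\<pi> b)) else 0)" for w
  have linEV: "Vector_Spaces.linear mscale fscale EV"
  proof -
    have "EV (u + w) = EV u + EV w" for u w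
      by (rule ext) (simp add: EV_def MK.linear_add[OF \<phi>(1)] distrib_right sum.distrib)
    moreover have "EV (c *\<^sub>m w) = fscale c (EV w)" for c w
      by (rule ext) (simp add: EV_def fscale_def MK.linear_scale[OF \<phi>(1)] mult.assoc sum_distrib_left)
    ultimately show ?thesis by unfold_locales simp_all
  qed
  have EV_lift: "EV w (lift b) = \<phi> b w" if "b \<in> A" for b w
  proof -
    have "EV w (lift b) = (\<Sum>a\<in>A. if a = b then \<phi> a w else 0)"
      unfolding EV_def using liftD by (simp add: lift_A if_distrib[of "\<lambda>x. _ * x"] cong: if_cong)
    then show ?thesis using that finA by simp
  qed
  have injEV: "inj_on EV C"
  proof (rule inj_onI)
    fix u w assume "u \<in> C" "w \<in> C" "EV u = EV w"
    have \<phi>uw: "\<phi> b u = \<phi> b w" if "b \<in> A" for b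
      using EV_lift[OF that, of u] EV_lift[OF that, of w] \<open>EV u = EV w\<close> by simp
    have "u = (\<Sum>b\<in>A. \<phi> b u *\<^sub>m b)" by (rule expand[OF \<open>u \<in> C\<close>])
    also have "\<dots> = (\<Sum>b\<in>A. \<phi> b w *\<^sub>m b)" by (rule sum.cong[OF refl]) (simp only: \<phi>uw)
    also have "\<dots> = w" by (rule expand[OF \<open>w \<in> C\<close>, symmetric])
    finally show "u = w" .
  qed
  have dimEV: "F.dim (EV ` S) = M.dim S" if "S \<subseteq> C" for S
  proof (rule MF.dim_image_eq[OF linEV])
    have "M.span S \<subseteq> C" by (rule M.span_minimal[OF that sC])
    then show "inj_on EV (M.span S)" by (rule inj_on_subset[OF injEV])
  qed
  have dimD: "F.dim D = M.dim C"
  proof -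
    have inj: "inj_on lift A"
    proof (rule inj_onI)
      fix a b assume ab: "a \<in> A" "b \<in> A" "lift a = lift b"
      then have "lift b (\<pi> a) = 1" using lift_A[OF ab(1), of a] by simp
      then show "a = b" using lift_A[OF ab(1), of b] by (simp split: if_splits)
    qed
    have "F.independent (lift ` A)"
    proof (rule F.independent_if_scalars_zero)
      fix g x assume z: "(\<Sum>y\<in>lift ` A. fscale (g y) y) = 0" and "x \<in> lift ` A"
      then obtain a where a: "a \<in> A" "x = lift a" by blast
      have "0 = (\<Sum>b\<in>A. fscale (g (lift b)) (lift b)) (\<pi> a)" using z by (simp add: sum.reindex[OF inj])
      also have "\<dots> = (\<Sum>b\<in>A. if a = b then g (lift b) else 0)"
        unfolding fsum by (intro sum.cong refl) (simp add: fscale_def lift_A[OF a(1)])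
      also have "\<dots> = g x" using a finA by simp
      finally show "g x = 0" by simp
    qed (use finA in simp)
    moreover have "F.span (lift ` A) = D"
    proof
      show "F.span (lift ` A) \<subseteq> D" by (rule F.span_minimal[OF _ D_subspace]) (use liftD in blast)
      show "D \<subseteq> F.span (lift ` A)"
      proof
        fix f assume "f \<in> D"
        then have "f = (\<Sum>b\<in>A. fscale (f (\<pi> b)) (lift b))" by (rule D_span)
        also have "\<dots> \<in> F.span (lift ` A)" by (intro F.span_sum F.span_scale F.span_base) blast
        finally show "f \<in> F.span (lift ` A)" .
      qed
    qed
    ultimately have "F.dim D = card (lift ` A)" using F.dim_span_eq_card_independent by metis
    then show ?thesis using card_image[OF inj] A(4) by simp
  qed
  have EV_D: "EV (P v) = (\<lambda>f. if f \<in> D then f (\<pi> v) else 0)" if "v \<in> V" for v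
    unfolding EV_def by (rule ext) (simp add: D_expand[OF _ that])
  have act_D: "dual_act Q actQ x f \<in> D" if "x \<in> q" "f \<in> D" for x f
  proof -
    have e: "dual_act Q actQ x f (\<pi> v) = - f (\<pi> (ad x v))" if v: "v \<in> V" for v
      unfolding dual_act_def act_Q[OF \<open>x \<in> q\<close> v] using v Q by simp
    show ?thesis
    proof (rule D_I)
      fix u v assume uv: "u \<in> V" "v \<in> V"
      have "f (\<pi> (ad x (u + v))) = f (\<pi> (ad x u)) + f (\<pi> (ad x v))"
        unfolding ad_simps(2) by (rule D_add[OF that(2) act_V[OF that(1) uv(1)] act_V[OF that(1) uv(2)]])
      then show "dual_act Q actQ x f (\<pi> (u + v)) = dual_act Q actQ x f (\<pi> u) + dual_act Q actQ x f (\<pi> v)"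
        unfolding e[OF uv(1)] e[OF uv(2)] e[OF M.subspace_add[OF V uv]] by simp
    next
      fix c v assume v: "v \<in> V"
      have "f (\<pi> (ad x (c *\<^sub>m v))) = c * f (\<pi> (ad x v))"
        unfolding ad_simps(10) by (rule D_scale[OF that(2) act_V[OF that(1) v]])
      then show "dual_act Q actQ x f (\<pi> (c *\<^sub>m v)) = c * dual_act Q actQ x f (\<pi> v)"
        unfolding e[OF v] e[OF M.subspace_scale[OF V v]] by simp
    qed (simp add: dual_act_def)
  qed
  have act_EV: "dual_act D (dual_act Q actQ) x (EV (P v)) = EV (P (ad x v))" if "x \<in> q" "v \<in> V" for x v
  proof
    fix f show "dual_act D (dual_act Q actQ) x (EV (P v)) f = EV (P (ad x v)) f"
    proof (cases "f \<in> D")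
      case True
      have "dual_act Q actQ x f (\<pi> v) = - f (\<pi> (ad x v))"
        unfolding dual_act_def act_Q[OF that] using that(2) Q by simp
      then show ?thesis
        unfolding dual_act_def[of D] EV_D[OF that(2)] EV_D[OF act_V[OF that]]
        using True act_D[OF that(1) True] by simp
    next
      case False
      then show ?thesis unfolding dual_act_def[of D] EV_D[OF act_V[OF that]] by simp
    qed
  qed
  have EV_dual: "EV (P v) \<in> dual_space (+) fscale D" if v: "v \<in> V" for v
    unfolding dual_space_def[of "(+)" fscale D]
  proof (intro CollectI conjI ballI allI impI)
    fix f g assume fg: "f \<in> D" "g \<in> D"
    have "f + g \<in> D" by (rule F.subspace_add[OF D_subspace fg])
    then show "EV (P v) (f + g) = EV (P v) f + EV (P v) g" unfolding EV_D[OF v] using fg by simp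
  next
    fix c f assume f: "f \<in> D"
    have "fscale c f \<in> D" by (rule F.subspace_scale[OF D_subspace f])
    then show "EV (P v) (fscale c f) = c * EV (P v) f"
      unfolding EV_D[OF v] using f by (simp only: if_True) (simp only: fscale_def)
  next
    fix f assume "f \<notin> D"
    then show "EV (P v) f = 0" unfolding EV_D[OF v] by simp
  qed
  have dual_EV: "\<exists>v\<in>V. \<xi> = EV (P v)" if \<xi>: "\<xi> \<in> dual_space (+) fscale D" for \<xi>
  proof -
    have \<xi>a: "\<xi> (f + g) = \<xi> f + \<xi> g" if "f \<in> D" "g \<in> D" for f g using \<xi> that unfolding dual_space_def[of "(+)" fscale D] by blast
    have \<xi>s: "\<xi> (fscale c f) = c * \<xi> f" if "f \<in> D" for c f using \<xi> that unfolding dual_space_def[of "(+)" fscale D] by blast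
    have \<xi>o: "\<xi> f = 0" if "f \<notin> D" for f using \<xi> that unfolding dual_space_def[of "(+)" fscale D] by blast
    have "\<xi> (fscale 0 (lift 0)) = 0 * \<xi> (lift 0)" by (rule \<xi>s[OF liftD])
    then have \<xi>0: "\<xi> 0 = 0" by (simp only: F.scale_zero_left mult_zero_left)
    have \<xi>sum: "\<xi> (\<Sum>b\<in>S. fscale (c b) (lift b)) = (\<Sum>b\<in>S. c b * \<xi> (lift b))" for S c
    proof (induction S rule: infinite_finite_induct)
      case (insert b S)
      have "(\<Sum>b\<in>S. fscale (c b) (lift b)) \<in> D" and 1: "fscale (c b) (lift b) \<in> D"
        by (intro F.subspace_sum[OF D_subspace] F.subspace_scale[OF D_subspace] liftD)+
      then have "\<xi> (fscale (c b) (lift b) + (\<Sum>b\<in>S. fscale (c b) (lift b)))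
        = c b * \<xi> (lift b) + (\<Sum>b\<in>S. c b * \<xi> (lift b))"
        by (simp only: \<xi>a \<xi>s liftD insert.IH)
      then show ?case by (simp only: sum.insert[OF insert.hyps])
    next
      case (infinite S)
      show ?case unfolding sum.infinite[OF infinite] by (rule \<xi>0)
    next
      case empty
      show ?case unfolding sum.empty by (rule \<xi>0)
    qed
    define v where "v = (\<Sum>b\<in>A. \<xi> (lift b) *\<^sub>m b)"
    have vV: "v \<in> V" unfolding v_def by (intro M.subspace_sum[OF V] M.subspace_scale[OF V] AV)
    have "\<xi> f = EV (P v) f" for f
    proof (cases "f \<in> D")
      case True
      have "\<xi> f = \<xi> (\<Sum>b\<in>A. fscale (f (\<pi> b)) (lift b))" using D_span[OF True] by (rule arg_cong)
      also have "\<dots> = (\<Sum>b\<in>A. \<xi> (lift b) * f (\<pi> b))" unfolding \<xi>sum by (simp add: mult.commute)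
      also have "\<dots> = f (\<pi> v)" unfolding v_def by (rule D_sum[OF True order_refl, symmetric])
      finally show ?thesis unfolding EV_D[OF vV] using True by simp
    next
      case False
      then show ?thesis unfolding EV_D[OF vV] using \<xi>o by simp
    qed
    then show ?thesis using vV by blast
  qed
  have dims: "F.dim ((\<lambda>x. dual_act D (dual_act Q actQ) x (EV (P y))) ` q) = M.dim (orb q y \<union> U) - M.dim U"
    if y: "y \<in> V" for y
  proof -
    have "(\<lambda>x. dual_act D (dual_act Q actQ) x (EV (P y))) ` q = EV ` (P ` orb q y)"
      unfolding orb_def image_image by (rule image_cong[OF refl]) (rule act_EV[OF _ y])
    moreover have oV: "orb q y \<subseteq> V" unfolding orb_def using act_V y by blast
    then have "P ` orb q y \<subseteq> C" unfolding C_def by blast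
    ultimately have "F.dim ((\<lambda>x. dual_act D (dual_act Q actQ) x (EV (P y))) ` q) = M.dim (P ` orb q y)"
      using dimEV by simp
    then show ?thesis using dimS[OF oV] by simp
  qed
  have "dual_space (+) fscale D = (\<lambda>v. EV (P v)) ` V" using EV_dual dual_EV by blast
  then have "(\<lambda>\<xi>. F.dim ((\<lambda>x. dual_act D (dual_act Q actQ) x \<xi>) ` q)) ` dual_space (+) fscale D
     = (\<lambda>y. M.dim (orb q y \<union> U) - M.dim U) ` V"
    by (simp only: image_image) (rule image_cong[OF refl dims])
  then show ?thesis unfolding lie_index_def dimD using dimC by simp
qed

end

context sym_lie
begin

text \<open>Transfers the orbits in the dual of \<open>L1\<close> to orbits in \<open>L1\<close>.
  The form \<open>B\<close> may be degenerate on \<open>L1\<close>, but the orbit of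
  \<open>\<xi>\<close> depends only on its restriction to \<open>[L0, L1]\<close>, and a vector of
  \<open>[L0, L1]\<close> orthogonal to \<open>L1\<close> is central in \<open>[L, L]\<close>, hence
  zero.\<close>

lemma rank_orbits:
  "lie_index mscale L0 ad L1 = int (M.dim L1) - int (MAX y\<in>L1. M.dim (orb L0 y))"
proof -
  let ?D = "dual_space (+) mscale L1"
  define \<Theta> where "\<Theta> w = (\<lambda>v. if v \<in> L1 then 2 * trace (w ** v) else 0)" for w
  have lin\<Theta>: "Vector_Spaces.linear mscale fscale \<Theta>"
  proof -
    have "\<Theta> (u + w) = \<Theta> u + \<Theta> w" for u w
      by (rule ext) (simp add: \<Theta>_def mm_simps trace_simps distrib_left)
    moreover have "\<Theta> (c *\<^sub>m w) = fscale c (\<Theta> w)" for c w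
      by (rule ext) (simp add: \<Theta>_def fscale_def mm_simps trace_simps)
    ultimately show ?thesis by unfold_locales simp_all
  qed
  have \<Theta>B: "\<Theta> w v = B w v" if "w \<in> L1" "v \<in> L1" for w v
    unfolding \<Theta>_def B_11[OF that] using that(2) by simp
  have brk1: "brk L0 L1 \<subseteq> L1" by (rule brk_least[OF sL1]) (rule ad01)
  have brkL: "brk L0 L1 \<subseteq> brk L L" by (rule brk_mono) (use L0_L L1_L in blast)+
  have sep: "w = 0" if w: "w \<in> brk L0 L1" "\<And>y. y \<in> L1 \<Longrightarrow> B w y = 0" for w
  proof (rule cent_brk_0)
    show "w \<in> cent L" by (rule rad_B1[OF _ w(2)]) (use w(1) brk1 in blast)
    show "w \<in> brk L L" using w(1) brkL by blast
  qed
  have \<Theta>D: "\<Theta> y \<in> ?D" for y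
    unfolding dual_space_def
  proof (intro CollectI conjI ballI allI impI)
    fix a b assume ab: "a \<in> L1" "b \<in> L1"
    then show "\<Theta> y (a + b) = \<Theta> y a + \<Theta> y b"
      using M.subspace_add[OF sL1 ab] unfolding \<Theta>_def by (simp only: if_True mm_simps(1) trace_add distrib_left)
  next
    fix c a assume a: "a \<in> L1"
    then show "\<Theta> y (c *\<^sub>m a) = c * \<Theta> y a"
      using M.subspace_scale[OF sL1 a, of c] unfolding \<Theta>_def
      by (simp only: if_True mm_simps(10) mscale_trace mult.left_commute)
  next
    fix a assume "a \<notin> L1"
    then show "\<Theta> y a = 0" unfolding \<Theta>_def by (simp only: if_False)
  qed
  interpret pairing "\<lambda>y v. 2 * trace (y ** v)" L1
    by (rule pairing.intro[OF sL1]; rule linfI; simp add: mm_simps trace_simps algebra_simps)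
  have act: "dual_act L1 ad u \<xi> = \<Theta> (ad u y)"
    if y: "y \<in> L1" "\<And>v. v \<in> brk L0 L1 \<Longrightarrow> \<xi> v = B y v" and u: "u \<in> L0" for \<xi> y u
  proof
    fix v show "dual_act L1 ad u \<xi> v = \<Theta> (ad u y) v"
    proof (cases "v \<in> L1")
      case True
      have "\<xi> (ad u v) = B y (ad u v)" by (rule y(2)[OF brk_in[OF u True]])
      also have "\<dots> = - B (ad u y) v" by (rule B_ad_swap[OF L1_L[OF y(1)] L0_L[OF u] L1_L[OF True]])
      finally show ?thesis unfolding \<Theta>B[OF ad01[OF u y(1)] True] dual_act_def using True by simp
    next
      case False
      then show ?thesis by (simp add: dual_act_def \<Theta>_def)
    qed
  qed
  have dims: "F.dim ((\<lambda>u. dual_act L1 ad u \<xi>) ` L0) = M.dim (orb L0 y)"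
    if y: "y \<in> L1" "\<And>v. v \<in> brk L0 L1 \<Longrightarrow> \<xi> v = B y v" for \<xi> y
  proof -
    have "(\<lambda>u. dual_act L1 ad u \<xi>) ` L0 = \<Theta> ` orb L0 y"
      unfolding orb_def image_image by (rule image_cong[OF refl]) (rule act[OF y])
    moreover have "F.dim (\<Theta> ` orb L0 y) = M.dim (orb L0 y)"
    proof (rule MF.dim_image_eq[OF lin\<Theta>])
      have sub: "M.span (orb L0 y) \<subseteq> brk L0 L1"
      proof (rule M.span_minimal[OF _ subspace_brk])
        show "orb L0 y \<subseteq> brk L0 L1" unfolding orb_def using brk_in[OF _ y(1), of _ L0] by blast
      qed
      show "inj_on \<Theta> (M.span (orb L0 y))"
      proof (rule inj_onI)
        fix a b assume ab: "a \<in> M.span (orb L0 y)" "b \<in> M.span (orb L0 y)" "\<Theta> a = \<Theta> b"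
        have d: "a - b \<in> brk L0 L1" using ab(1,2) sub by (intro M.subspace_diff[OF subspace_brk]) blast+
        have "a - b = 0"
        proof (rule sep[OF d])
          fix z assume z: "z \<in> L1"
          have "a \<in> L1" "b \<in> L1" using ab(1,2) sub brk1 by blast+
          then have "B (a - b) z = \<Theta> a z - \<Theta> b z" using z by (simp add: \<Theta>B B_diff1 L1_L)
          then show "B (a - b) z = 0" using ab(3) by simp
        qed
        then show "a = b" by simp
      qed
    qed
    ultimately show ?thesis by simp
  qed
  have repr: "\<exists>y\<in>L1. \<forall>v\<in>brk L0 L1. \<xi> v = B y v" if \<xi>: "\<xi> \<in> ?D" for \<xi>
  proof -
    have "\<exists>y\<in>L1. \<forall>v\<in>brk L0 L1. 2 * trace (y ** v) = \<xi> v"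
    proof (rule represent[OF subspace_brk])
      fix v assume v: "v \<in> brk L0 L1" "\<forall>y\<in>L1. 2 * trace (y ** v) = 0"
      show "v = 0"
      proof (rule sep[OF v(1)])
        show "B v y = 0" if y: "y \<in> L1" for y
        proof -
          have "B v y = B y v" by (rule B_sym)
          also have "\<dots> = 2 * trace (y ** v)" by (rule B_11[OF y]) (use v(1) brk1 in blast)
          finally show ?thesis using v(2) y by simp
        qed
      qed
    next
      show "\<xi> (x + y) = \<xi> x + \<xi> y" if "x \<in> brk L0 L1" "y \<in> brk L0 L1" for x y
        using \<xi> that brk1 unfolding dual_space_def by blast
      show "\<xi> (c *\<^sub>m x) = c * \<xi> x" if "x \<in> brk L0 L1" for c x
        using \<xi> that brk1 unfolding dual_space_def by blast
    qed
    then obtain y where y: "y \<in> L1" "\<forall>v\<in>brk L0 L1. 2 * trace (y ** v) = \<xi> v" by blast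
    have "\<xi> v = B y v" if v: "v \<in> brk L0 L1" for v
    proof -
      have "B y v = 2 * trace (y ** v)" by (rule B_11[OF y(1)]) (use v brk1 in blast)
      then show ?thesis using y(2) v by simp
    qed
    then show ?thesis using y(1) by blast
  qed
  have "(\<lambda>\<xi>. F.dim ((\<lambda>u. dual_act L1 ad u \<xi>) ` L0)) ` ?D = (\<lambda>y. M.dim (orb L0 y)) ` L1"
  proof
    show "(\<lambda>\<xi>. F.dim ((\<lambda>u. dual_act L1 ad u \<xi>) ` L0)) ` ?D \<subseteq> (\<lambda>y. M.dim (orb L0 y)) ` L1"
    proof
      fix n assume "n \<in> (\<lambda>\<xi>. F.dim ((\<lambda>u. dual_act L1 ad u \<xi>) ` L0)) ` ?D"
      then obtain \<xi> where \<xi>: "\<xi> \<in> ?D" "n = F.dim ((\<lambda>u. dual_act L1 ad u \<xi>) ` L0)" by blast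
      obtain y where y: "y \<in> L1" "\<forall>v\<in>brk L0 L1. \<xi> v = B y v" using repr[OF \<xi>(1)] by blast
      have "n = M.dim (orb L0 y)" unfolding \<xi>(2) by (rule dims[OF y(1)]) (use y(2) in blast)
      then show "n \<in> (\<lambda>y. M.dim (orb L0 y)) ` L1" using y(1) by blast
    qed
    show "(\<lambda>y. M.dim (orb L0 y)) ` L1 \<subseteq> (\<lambda>\<xi>. F.dim ((\<lambda>u. dual_act L1 ad u \<xi>) ` L0)) ` ?D"
    proof
      fix n assume "n \<in> (\<lambda>y. M.dim (orb L0 y)) ` L1"
      then obtain y where y: "y \<in> L1" "n = M.dim (orb L0 y)" by blast
      have "F.dim ((\<lambda>u. dual_act L1 ad u (\<Theta> y)) ` L0) = M.dim (orb L0 y)"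
        by (rule dims[OF y(1)], rule \<Theta>B[OF y(1)]) (use brk1 in blast)
      then have "n = F.dim ((\<lambda>u. dual_act L1 ad u (\<Theta> y)) ` L0)" using y(2) by simp
      then show "n \<in> (\<lambda>\<xi>. F.dim ((\<lambda>u. dual_act L1 ad u \<xi>) ` L0)) ` ?D" using \<Theta>D by blast
    qed
  qed
  then show ?thesis unfolding lie_index_def by simp
qed

end

section \<open>Nilpotent vectors and cosets\<close>

lemma trace_mpow_poly: "(\<lambda>A :: 'k::field^'n^'n. trace (mpow A k)) \<in> poly_funs mscale"
proof -
  have "(\<lambda>A :: 'k^'n^'n. mpow A k $ i $ j) \<in> poly_funs mscale" for i j
  proof (induction k arbitrary: i j)
    case (Suc k)
    show ?case unfolding mpow_Suc matrix_matrix_mult_def vec_lambda_beta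
      by (intro poly_funs_sum poly_funs.mult poly_funs.lin[OF linf_entry] Suc)
  qed (simp add: poly_funs.const)
  then show ?thesis unfolding trace_def by (rule poly_funs_sum)
qed

text \<open>The traces of the powers are polynomial functions constant on the
  \<open>Ad\<close>-orbit, hence on its closure, which contains zero.\<close>

lemma nilpotent_vector_nilp:
  fixes G :: "('k::{alg_closed_field, field_char_0}^'n^'n) set"
  assumes G: "algebraic_group G" and v: "nilpotent_vector mscale G Ad v"
  shows "nilp v"
proof (rule nilp_if_traces)
  fix k
  let ?f = "\<lambda>A :: 'k^'n^'n. trace (mpow A (Suc k)) - trace (mpow v (Suc k))"
  show "trace (mpow v (Suc k)) = 0"
  proof (rule ccontr)
    assume nz: "trace (mpow v (Suc k)) \<noteq> 0"
    have "?f \<in> poly_funs mscale" by (rule poly_funs_diff[OF trace_mpow_poly poly_funs.const])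
    then have op: "openin (zariski mscale) {A. ?f A \<noteq> 0}" by (rule zariski_basic_open)
    have "mpow (0 :: 'k^'n^'n) (Suc k) = 0" by (simp only: mpow_Suc mm_simps)
    then have "?f 0 = - trace (mpow v (Suc k))" by (simp only: trace_zero diff_0)
    then have "?f 0 \<noteq> 0" using nz by simp
    then have z: "0 \<in> {A. ?f A \<noteq> 0}" by (rule CollectI)
    have "0 \<in> zariski mscale closure_of ((\<lambda>g. Ad g v) ` G)" using v unfolding nilpotent_vector_def .
    then have "\<forall>T. 0 \<in> T \<and> openin (zariski mscale) T \<longrightarrow> (\<exists>y. y \<in> (\<lambda>g. Ad g v) ` G \<and> y \<in> T)"
      unfolding in_closure_of by (rule conjunct2)
    from mp[OF spec[OF this] conjI[OF z op]]
    obtain g where g: "g \<in> G" "Ad g v \<in> {A. ?f A \<noteq> 0}" by (elim exE conjE imageE) (simp only:)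
    have inv: "invertible g" by (rule group_invertible[OF G g(1)])
    have "trace (mpow (Ad g v) (Suc k)) = trace (mpow v (Suc k))"
      by (simp only: Ad_mpow[OF inv] trace_Ad[OF inv])
    then show False using g(2) by simp
  qed
qed

lemma quot_coset_add:
  assumes "M.subspace U" shows "(x +o U) + (y +o U) = (x + y) +o U"
proof -
  have "U + U = U"
  proof
    show "U + U \<subseteq> U" using M.subspace_add[OF assms] by (auto simp: set_plus_def)
    show "U \<subseteq> U + U"
    proof
      fix u assume "u \<in> U"
      then have "u + 0 \<in> U + U" by (intro set_plus_intro M.subspace_0[OF assms])
      then show "u \<in> U + U" by simp
    qed
  qed
  then show ?thesis by (simp add: set_plus_rearrange)
qed

text \<open>Adding \<open>U\<close> restores a full coset where \<open>T\<close> shrinks one, as for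
  the scalar zero; this serves \<open>quot_scale\<close> and \<open>quot_act\<close> alike.\<close>

lemma quot_coset_map:
  assumes U: "M.subspace U" and T: "lin T" "\<And>u. u \<in> U \<Longrightarrow> T u \<in> U"
  shows "T ` (x +o U) + U = T x +o U"
proof
  show "T ` (x +o U) + U \<subseteq> T x +o U"
  proof
    fix z assume "z \<in> T ` (x +o U) + U"
    then obtain u w where uw: "u \<in> U" "w \<in> U" "z = T (x + u) + w"
      by (auto simp: set_plus_def elt_set_plus_def)
    have "z = T x + (T u + w)" unfolding uw(3) by (simp add: MM.linear_add[OF T(1)])
    moreover have "T u + w \<in> U" by (rule M.subspace_add[OF U T(2)[OF uw(1)] uw(2)])
    ultimately show "z \<in> T x +o U" by (auto simp: elt_set_plus_def)
  qed
  show "T x +o U \<subseteq> T ` (x +o U) + U"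
  proof
    fix z assume "z \<in> T x +o U"
    then obtain u where u: "u \<in> U" "z = T x + u" by (auto simp: elt_set_plus_def)
    have "x \<in> x +o U" using M.subspace_0[OF U] by (force simp: elt_set_plus_def)
    then show "z \<in> T ` (x +o U) + U" unfolding u(2) by (intro set_plus_intro imageI u(1))
  qed
qed

lemma coset_eq_iff:
  assumes U: "M.subspace U" shows "x +o U = y +o U \<longleftrightarrow> x - y \<in> U"
proof
  assume e: "x +o U = y +o U"
  have "x \<in> x +o U" using M.subspace_0[OF U] by (force simp: elt_set_plus_def)
  then have "x \<in> y +o U" unfolding e .
  then obtain u where "u \<in> U" "x = y + u" by (auto simp: elt_set_plus_def)
  then show "x - y \<in> U" by simp
next
  have sub: "a +o U \<subseteq> b +o U" if d: "a - b \<in> U" for a b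
  proof
    fix z assume "z \<in> a +o U"
    then obtain u where u: "u \<in> U" "z = a + u" by (auto simp: elt_set_plus_def)
    have "z = b + ((a - b) + u)" unfolding u(2) by simp
    moreover have "(a - b) + u \<in> U" by (rule M.subspace_add[OF U d u(1)])
    ultimately show "z \<in> b +o U" unfolding elt_set_plus_def by blast
  qed
  assume d: "x - y \<in> U"
  have "y - x \<in> U" using M.subspace_neg[OF U d] by simp
  then show "x +o U = y +o U" using sub d by blast
qed

theorem proposition7p1:
  fixes G G\<^sub>0 :: "('k::{alg_closed_field, field_char_0}^'n^'n) set"
    and \<sigma> :: "'k^'n^'n \<Rightarrow> 'k^'n^'n"
  assumes "symmetric_pair G \<sigma> G\<^sub>0"
    and "symmetric_rank G \<sigma> = 1"
  shows "GNIB mscale G\<^sub>0 Ad ad (minus_part (lie_algebra G) \<sigma>)"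
proof -
  let ?L = "lie_algebra G"
  have G: "reductive_group G" and inv: "lie_involution ?L \<sigma>" and G0: "algebraic_group G\<^sub>0"
    and L0: "lie_algebra G\<^sub>0 = plus_part ?L \<sigma>"
    using assms(1) by (simp_all add: symmetric_pair_def)
  interpret sym_lie ?L \<sigma>
  proof (rule sym_lie.intro[OF lie_closed_lie_algebra[OF red_alg[OF G]] inv cent_brk[OF G]])
    show "x = 0" if "x \<in> cent ?L" "nilp x" for x using that by (rule central_nilp[OF G])
    show "x \<in> cent ?L" if "x \<in> ?L" "\<And>y. y \<in> ?L \<Longrightarrow> trace (x ** y) = 0" for x
      using that by (rule trace_radical_central[OF G])
    show "x \<in> cent ?L"
      if "x \<in> ?L" "\<And>y. y \<in> ?L \<Longrightarrow> trace (x ** y) + trace (\<sigma> x ** \<sigma> y) = 0" for x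
      using that by (rule twisted_radical_central[OF G inv])
  qed
  define \<mu> where "\<mu> = (MAX y\<in>L1. M.dim (orb L0 y))"
  have fin: "finite ((\<lambda>y. M.dim (orb S y \<union> U) - M.dim U) ` L1)" for S U
  proof (rule finite_subset)
    have "M.dim (orb S y \<union> U) - M.dim U \<le> M.dim (UNIV :: ('k^'n^'n) set)" for y
      by (rule le_trans[OF diff_le_self M.dim_subset[OF subset_UNIV]])
    then show "(\<lambda>y. M.dim (orb S y \<union> U) - M.dim U) ` L1 \<subseteq> {..M.dim (UNIV :: ('k^'n^'n) set)}"
      by (intro image_subsetI) (simp only: atMost_iff)
  qed (rule finite_atMost)
  have fin0: "finite ((\<lambda>y. M.dim (orb L0 y)) ` L1)"
  proof (rule finite_subset)
    have "M.dim (orb L0 y) \<le> M.dim (UNIV :: ('k^'n^'n) set)" for y by (rule M.dim_subset[OF subset_UNIV])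
    then show "(\<lambda>y. M.dim (orb L0 y)) ` L1 \<subseteq> {..M.dim (UNIV :: ('k^'n^'n) set)}"
      by (intro image_subsetI) (simp only: atMost_iff)
  qed (rule finite_atMost)
  have ne: "L1 \<noteq> {}" using M.subspace_0[OF sL1] by blast
  have rank: "int (M.dim L1) - int \<mu> = 1"
    using assms(2) unfolding symmetric_rank_def rank_orbits \<mu>_def .
  have "\<mu> \<in> (\<lambda>y. M.dim (orb L0 y)) ` L1" unfolding \<mu>_def by (rule Max_in[OF fin0]) (use ne in blast)
  \<comment> \<open>One maximiser of the orbit dimension serves as the generic vector for every
    nilpotent \<open>v\<close>.\<close>
  then obtain y0 where y0: "y0 \<in> L1" "\<mu> = M.dim (orb L0 y0)" by blast
  have \<mu>_ge: "M.dim (orb L0 y) \<le> \<mu>" if "y \<in> L1" for y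
    unfolding \<mu>_def by (rule Max_ge[OF fin0]) (use that in blast)
  have un0: "M.dim (S \<union> {0}) = M.dim S" for S :: "('k^'n^'n) set"
    using M.dim_insert[of 0 S] M.span_zero[of S] by simp
  \<comment> \<open>The module on the left is the dual of \<open>L1\<close> itself, so the quotient
    model is taken with the zero subspace.\<close>
  have lhs: "lie_index fscale L0 (dual_act L1 ad) (dual_space (+) mscale L1) = int (M.dim L1) - int \<mu>"
  proof -
    interpret q: quotient_model L1 "{0}" "\<lambda>x. x" L1 "(+)" mscale L0 ad
      by unfold_locales (simp_all add: sL1 M.subspace_single_0 M.subspace_0[OF sL1] ad01)
    show ?thesis unfolding q.index_formula un0 \<mu>_def by simp
  qed
  show ?thesis
    unfolding GNIB_def Let_def L0
  proof (intro ballI impI)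
    fix v assume v: "v \<in> L1" and nv: "nilpotent_vector mscale G\<^sub>0 Ad v"
    define U where "U = orb L0 v"
    define S where "S = stabiliser L0 ad v"
    have S: "S = {u \<in> L0. ad u v = 0}" by (simp add: S_def stabiliser_def)
    have sU: "M.subspace U" unfolding U_def by (rule subspace_orb[OF sL0])
    have UL: "U \<subseteq> L1" unfolding U_def orb_def using ad01[OF _ v] by blast
    \<comment> \<open>Elements of \<open>S\<close> kill \<open>v\<close>, so they preserve
      \<open>[L0, v]\<close> and act on the quotient.\<close>
    have SU: "ad x u \<in> U" if x: "x \<in> S" and u: "u \<in> U" for x u
    proof -
      obtain w where w: "w \<in> L0" "u = ad w v" using u unfolding U_def orb_def by blast
      have "ad x u = ad (ad x w) v" unfolding w(2) jacobi[of x w v] using x by (simp add: S ad_simps)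
      moreover have "ad x w \<in> L0" by (rule ad00) (use x w S in blast)+
      ultimately show ?thesis unfolding U_def orb_def by blast
    qed
    interpret q: quotient_model L1 U "\<lambda>x. x +o U" "quot_space L1 U" "(+)" "quot_scale mscale U" S "quot_act U ad"
    proof
      show "quot_space L1 U = (\<lambda>x. x +o U) ` L1" by (simp add: quot_space_def)
      show "(x +o U) + (y +o U) = (x + y) +o U" for x y by (rule quot_coset_add[OF sU])
      show "quot_scale mscale U c (x +o U) = c *\<^sub>m x +o U" for c x
        unfolding quot_scale_def
      proof (rule quot_coset_map[OF sU])
        show "lin (mscale c)" by (rule linI) (simp_all add: M.scale_right_distrib mult.commute)
        show "c *\<^sub>m u \<in> U" if "u \<in> U" for u by (rule M.subspace_scale[OF sU that])
      qed
      show "x +o U = y +o U \<longleftrightarrow> x - y \<in> U" for x y by (rule coset_eq_iff[OF sU])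
      show "ad x w \<in> L1" if "x \<in> S" "w \<in> L1" for x w by (rule ad01) (use that S in blast)+
      show "quot_act U ad x (w +o U) = ad x w +o U" if "x \<in> S" for x w
        unfolding quot_act_def by (rule quot_coset_map[OF sU lin_ad SU[OF that]])
    qed (fact sL1 sU UL)+
    have rhs: "lie_index fscale S (dual_act (quot_space L1 U) (quot_act U ad))
        (dual_space (+) (quot_scale mscale U) (quot_space L1 U)) = int (M.dim L1) - int \<mu>"
    proof (cases "v = 0")
      \<comment> \<open>There is no triple for \<open>v = 0\<close>; the slice is then all of
        \<open>L1\<close> with its full stabiliser, and both indices are the same
        expression.\<close>
      case True
      have Ueq: "U = {0}" unfolding U_def orb_def True using M.subspace_0[OF sL0] by (auto simp: ad_simps)
      have Seq: "S = L0" unfolding S True by (auto simp: ad_simps)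
      show ?thesis unfolding q.index_formula unfolding Ueq Seq un0 \<mu>_def by simp
    next
      case False
      interpret rank_one ?L \<sigma> v y0
      proof
        show "nilp v" by (rule nilpotent_vector_nilp[OF G0 nv])
        show "M.dim L1 = Suc (M.dim (orb L0 y0))" using rank y0(2) by simp
        show "M.dim (orb L0 v) \<le> M.dim (orb L0 y0)" using \<mu>_ge[OF v] y0(2) by simp
      qed (fact v False y0(1))+
      have up: "M.dim (orb S y \<union> U) < M.dim L1" if "y \<in> L1" for y
        using slice_upper[OF that] unfolding U_def[symmetric] S[symmetric] by (simp only: Un_commute[of U])
      obtain z where z1: "z \<in> L1" "M.dim L1 \<le> Suc (M.dim (U \<union> orb S z))"
        using slice_lower unfolding U_def[symmetric] S[symmetric] by blast
      then have z: "z \<in> L1" "M.dim L1 \<le> Suc (M.dim (orb S z \<union> U))"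
        by (simp_all only: Un_commute[of U])
      have dU: "M.dim U \<le> M.dim (orb S z \<union> U)" by (rule M.dim_subset) blast
      \<comment> \<open>Every slice orbit together with \<open>U\<close> misses at least one
        dimension of \<open>L1\<close>, and that of \<open>z\<close> misses exactly one; subtracting
        the maximum leaves index one.\<close>
      have "(MAX y\<in>L1. M.dim (orb S y \<union> U) - M.dim U) = M.dim (orb S z \<union> U) - M.dim U"
      proof (rule Max_eqI[OF fin])
        fix n assume "n \<in> (\<lambda>y. M.dim (orb S y \<union> U) - M.dim U) ` L1"
        then obtain y where y: "y \<in> L1" "n = M.dim (orb S y \<union> U) - M.dim U" by blast
        show "n \<le> M.dim (orb S z \<union> U) - M.dim U" unfolding y(2) using up[OF y(1)] z(2) by simp
      qed (use z(1) in blast)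
      then show ?thesis unfolding q.index_formula using up[OF z(1)] z(2) dU rank by simp
    qed
    show "lie_index fscale L0 (dual_act L1 ad) (dual_space (+) mscale L1) =
      lie_index fscale (stabiliser L0 ad v)
        (dual_act (quot_space L1 ((\<lambda>x. ad x v) ` L0)) (quot_act ((\<lambda>x. ad x v) ` L0) ad))
        (dual_space (+) (quot_scale mscale ((\<lambda>x. ad x v) ` L0)) (quot_space L1 ((\<lambda>x. ad x v) ` L0)))"
      by (rule trans[OF lhs rhs[unfolded U_def S_def orb_def, symmetric]])
  qed
qed

end
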